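(* Let $\varepsilon>0$ be a constant, let $p=p(n)\in[0,1]$, and let $\mathbf{G}\sim G_{n,p}$. 1. If $p\ge (1+\varepsilon)n^{-1/3}$, then w.h.p. there exists a tree $T\subseteq \mathbf{G}$ such that $T\to\mathbf{G}$. 2. If $p<n^{-1/3-\varepsilon}$, then w.h.p. there is no tree $T\subseteq\mathbf{G}$ such that $T\to\mathbf{G}$. In particular, $p_{K_3}=n^{-1/3-o(1)}$.
   Context: $G_{n,p}$ is the binomial random graph on $[n]$ (each pair is an edge independently with probability $p$). W.h.p. means with probability tending to $1$ as $n\to\infty$. For a graph $G$ and a spanning subgraph $H\subseteq G$ (i.e. $V(H)=V(G)$), we say that $H$ activates $G$, and write $H\to G$, if there is a sequence of graphs $H=H_0\subset H_1\subset\cdots\subset H_s=G$ such that for every $i\in\{1,\dots,s\}$ the graph $H_i$ is obtained from $H_{i-1}$ by adding one edge that belongs to a triangle of $H_i$ (a $K_3$-bootstrap percolation process). In particular a tree $T$ with $T\to G$ is a spanning tree of $G$. $\mathrm{wsat}(G,K_3)$ denotes the minimum number of edges of a spanning subgraph $H$ of $G$ with $H\to G$. One has $\mathrm{wsat}(K_n,K_3)=n-1$. $p_{K_3}=p_{K_3}(n)$ denotes the threshold probability for the property $\mathrm{wsat}(\mathbf{G},K_3)=n-1$ of $\mathbf{G}\sim G_{n,p}$: w.h.p. the property holds if $p/p_{K_3}\to\infty$, and w.h.p. it fails if $p/p_{K_3}\to0$ (the existence of such a threshold is known from earlier work). *)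

theory Defs
  imports "HOL-Probability.Probability"
begin

type_synonym 'a graph = "'a set \<times> 'a set set"

abbreviation verts :: "'a graph \<Rightarrow> 'a set" where
  "verts \<equiv> fst"

abbreviation edges :: "'a graph \<Rightarrow> 'a set set" where
  "edges \<equiv> snd"

definition pairs :: "'a set \<Rightarrow> 'a set set" where
  "pairs V = {e. e \<subseteq> V \<and> card e = 2}"

definition simple_graph :: "'a graph \<Rightarrow> bool" where
  "simple_graph G \<longleftrightarrow> finite (verts G) \<and> edges G \<subseteq> pairs (verts G)"

definition subgraph :: "'a graph \<Rightarrow> 'a graph \<Rightarrow> bool" where
  "subgraph H G \<longleftrightarrow> simple_graph H \<and> simple_graph G \<and>
     verts H \<subseteq> verts G \<and> edges H \<subseteq> edges G"

definition spanning_subgraph :: "'a graph \<Rightarrow> 'a graph \<Rightarrow> bool" where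
  "spanning_subgraph H G \<longleftrightarrow> subgraph H G \<and> verts H = verts G"

definition in_triangle :: "'a set \<Rightarrow> 'a graph \<Rightarrow> bool" where
  "in_triangle e G \<longleftrightarrow> (\<exists>x y z. distinct [x, y, z] \<and> e = {x, y} \<and>
     {x, y} \<in> edges G \<and> {y, z} \<in> edges G \<and> {x, z} \<in> edges G)"

definition bootstrap_step :: "'a graph \<Rightarrow> 'a graph \<Rightarrow> bool" where
  "bootstrap_step H H' \<longleftrightarrow> verts H' = verts H \<and>
     (\<exists>e. e \<notin> edges H \<and> edges H' = insert e (edges H) \<and> in_triangle e H')"

definition activates :: "'a graph \<Rightarrow> 'a graph \<Rightarrow> bool" where
  "activates H G \<longleftrightarrow> spanning_subgraph H G \<and> bootstrap_step\<^sup>*\<^sup>* H G"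

definition wsat_K3 :: "'a graph \<Rightarrow> nat" where
  "wsat_K3 G = (LEAST m. \<exists>H. activates H G \<and> card (edges H) = m)"

definition connected_graph :: "'a graph \<Rightarrow> bool" where
  "connected_graph G \<longleftrightarrow> verts G \<noteq> {} \<and>
     (\<forall>u\<in>verts G. \<forall>v\<in>verts G. (\<lambda>x y. {x, y} \<in> edges G)\<^sup>*\<^sup>* u v)"

definition is_cycle :: "'a graph \<Rightarrow> 'a list \<Rightarrow> bool" where
  "is_cycle G vs \<longleftrightarrow> length vs \<ge> 3 \<and> distinct vs \<and>
     (\<forall>i<length vs. {vs ! i, vs ! (Suc i mod length vs)} \<in> edges G)"

definition is_tree :: "'a graph \<Rightarrow> bool" where
  "is_tree G \<longleftrightarrow> simple_graph G \<and> connected_graph G \<and> (\<nexists>vs. is_cycle G vs)"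

definition gnp :: "nat \<Rightarrow> real \<Rightarrow> nat graph pmf" where
  "gnp n p = map_pmf (\<lambda>\<omega>. ({1..n}, {e \<in> pairs {1..n}. \<omega> e}))
     (Pi_pmf (pairs {1..n}) False (\<lambda>_. bernoulli_pmf p))"

definition whp :: "(nat \<Rightarrow> real) \<Rightarrow> (nat \<Rightarrow> nat graph \<Rightarrow> bool) \<Rightarrow> bool" where
  "whp p P \<longleftrightarrow> (\<lambda>n. measure_pmf.prob (gnp n (p n)) {G. P n G}) \<longlonglongrightarrow> 1"

text \<open>A threshold is only determined up to constant factors, so it is a predicate on functions
  \<open>q\<close>. Positivity rules out the convention \<open>x / 0 = 0\<close>.\<close>

definition is_threshold :: "(nat \<Rightarrow> nat graph \<Rightarrow> bool) \<Rightarrow> (nat \<Rightarrow> real) \<Rightarrow> bool" where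
  "is_threshold P q \<longleftrightarrow> (\<forall>\<^sub>F n in sequentially. 0 < q n) \<and>
     (\<forall>p. (\<forall>n. p n \<in> {0..1}) \<longrightarrow>
        (filterlim (\<lambda>n. p n / q n) at_top sequentially \<longrightarrow> whp p P) \<and>
        ((\<lambda>n. p n / q n) \<longlonglongrightarrow> 0 \<longrightarrow> whp p (\<lambda>n G. \<not> P n G)))"

text \<open>The equation \<open>wsat(G, K\<^sub>3) = n - 1\<close>, written without truncated subtraction.\<close>

definition is_p_K3 :: "(nat \<Rightarrow> real) \<Rightarrow> bool" where
  "is_p_K3 q \<longleftrightarrow> is_threshold (\<lambda>n G. wsat_K3 G + 1 = n) q"

end

theory Submission imports Defs "HOL-Library.Multiset" "HOL-Real_Asymp.Real_Asymp" begin

text \<open>\<^bold>\<open>Below the threshold.\<close> Suppose that a tree \<open>T\<close> activates \<open>G\<close>, and let \<open>S\<close> consist of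
  one triangle per step. Modulo 2, a family \<open>U \<subseteq> S\<close> has a boundary, and it fills a closed walk if
  its boundary is the chain of the walk. Each step adds one edge and one triangle, so the last
  triangle of \<open>U\<close> owns an edge that no other triangle of \<open>U\<close> contains, and the complex can be collapsed.
  This gives an Euler-type estimate for \<open>U\<close>. If \<open>G\<close> is locally sparse, that is, if vertex sets \<open>W\<close>
  of bounded size span at most \<open>(3 - \<delta>) |W|\<close> edges, it follows that families of bounded
  size are at most \<open>K\<close> times as large as their boundary (\<open>small_families_expand\<close>).

  The heart of the proof carries this from bounded families to all lengths: every closed walk of
  length \<open>l\<close> in \<open>G\<close> has a filling by at most \<open>2 K l\<close> triangles (\<open>linear_filling_built\<close>). This is proved by
  induction on the steps. In a tree every closed walk is filled by the empty family. A new edge can be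
  replaced by the two other sides of its triangle, which spoils the constant by a bounded
  factor. The constant is then repaired by \<open>linear_filling_improve\<close>: short walks have fillings of
  bounded size, to which the local estimate applies; and a long walk with a filling of fewer than
  \<open>D\<^sup>2\<close> triangles has, by a discrete Besicovitch inequality (\<open>rectangle_inequality\<close>), a shortcut of length
  less than \<open>D\<close> between opposite quarters. As \<open>D\<close> is only of order \<open>sqrt l\<close>, cutting along the shortcut and
  induction on \<open>l\<close> work.

  Applied to a 4-cycle this yields a filling of bounded size, whose vertex set \<open>W\<close> spans at least
  \<open>3 |W| - 7\<close> edges (\<open>square_has_dense_neighbourhood\<close>). If \<open>n p\<^sup>3 \<le> 1\<close>, four given
  vertices lie in such a set with probability \<open>O(p\<^sup>5)\<close>, whereas they form a given 4-cycle with
  probability \<open>p\<^sup>4\<close>. Hence one can choose a family of possible 4-cycles in which, with high probability,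
  some 4-cycle is present, but none inside a dense bounded set. For the smallest \<open>p\<close>, where there are too
  few 4-cycles, an isolated vertex or the number of triangles gives the claim.

  \<^bold>\<open>Above the threshold.\<close> Fix a root \<open>r\<close>, split its neighbours into a large part \<open>R1\<close> and a small part \<open>R2\<close>, and let \<open>B\<close> be the set
  of the other vertices. For \<open>p = (1 + \<epsilon>) n powr (- 1 / 3)\<close> a vertex \<open>w \<in> B\<close> has about
  \<open>n p\<^sup>2\<close> neighbours in \<open>R1\<close>, and the graph on these has average degree about
  \<open>n p\<^sup>3 = (1 + \<epsilon>)\<^sup>3 > 1\<close>. So it is supercritical and contains a large connected set, the cluster of
  \<open>w\<close>; exploring from many vertices at once makes this true for all \<open>w\<close> simultaneously
  (\<open>prb_no_component\<close>). The tree is the star at \<open>r\<close> together with one edge from each \<open>w\<close> into its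
  cluster. The star activates the edges inside \<open>R1 \<union> R2\<close>; then \<open>w\<close> acquires the edges to its cluster and
  to its neighbours in \<open>R2\<close> that see the cluster; and as the clusters are large, these
  suffice to link each vertex of \<open>B\<close> with every other vertex apart from \<open>r\<close> (\<open>linked_tree_activates\<close>). The edges are revealed in stages, so
  that the events needed in each stage are independent.

  Having an activating tree is not an increasing property, but it becomes one in conjunction with
  the property that any two vertices have a common neighbour. This settles the larger \<open>p\<close>.

  \<^bold>\<open>The threshold.\<close> When any two vertices have a common neighbour, \<open>wsat(G, K\<^sub>3) = n - 1\<close> means that there
  is an activating tree. A threshold function that is too large or too small for infinitely many \<open>n\<close> is
  refuted by testing its defining property on a sequence \<open>p\<close> chosen to be in
  conflict with one of the two halves at these \<open>n\<close>.\<close>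

section \<open>Connectivity, trees and edge counts\<close>

definition conn :: "'a set set \<Rightarrow> 'a \<Rightarrow> 'a \<Rightarrow> bool" where
  "conn E = (\<lambda>x y. {x, y} \<in> E)\<^sup>*\<^sup>*"

lemma conn_refl [simp]: "conn E x x"
  by (simp add: conn_def)

lemma conn_step: "conn E x y \<Longrightarrow> {y, z} \<in> E \<Longrightarrow> conn E x z"
  unfolding conn_def by (rule rtranclp.rtrancl_into_rtrancl)

lemma conn_induct [consumes 1, case_names base step]:
  assumes "conn E x y" "P x" "\<And>y z. conn E x y \<Longrightarrow> {y, z} \<in> E \<Longrightarrow> P y \<Longrightarrow> P z"
  shows "P y"
  using assms unfolding conn_def by (rule rtranclp_induct)

lemma conn_edge: "{x, y} \<in> E \<Longrightarrow> conn E x y"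
  using conn_step[of E x x y] by simp

lemma conn_trans: "conn E x y \<Longrightarrow> conn E y z \<Longrightarrow> conn E x z"
  unfolding conn_def by (rule rtranclp_trans)

lemma conn_sym: "conn E x y \<Longrightarrow> conn E y x"
proof (induction rule: conn_induct)
  case (step y z)
  then have "{z, y} \<in> E" by (simp add: insert_commute)
  then show ?case using step.IH by (metis conn_edge conn_trans)
qed simp

lemma conn_subst:
  assumes "conn F x y" "\<And>u v. {u, v} \<in> F \<Longrightarrow> conn E u v"
  shows "conn E x y"
  using assms(1) by (induction rule: conn_induct) (auto intro: conn_trans assms(2))

lemma conn_mono: "conn E x y \<Longrightarrow> E \<subseteq> F \<Longrightarrow> conn F x y"
  by (erule conn_subst) (auto intro: conn_edge)

lemma conn_empty: "conn {} x y \<Longrightarrow> x = y"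
  by (induction rule: conn_induct) auto

lemma connected_graph_conn:
  "connected_graph G \<longleftrightarrow> verts G \<noteq> {} \<and> (\<forall>u\<in>verts G. \<forall>v\<in>verts G. conn (edges G) u v)"
  by (simp add: connected_graph_def conn_def)

lemma conn_insert:
  assumes "conn (insert {u, v} E) x y"
  shows "conn E x y \<or> (conn E x u \<and> conn E v y) \<or> (conn E x v \<and> conn E u y)"
  using assms
proof (induction rule: conn_induct)
  case (step y z)
  show ?case
  proof (cases "{y, z} \<in> E")
    case True
    then have "conn E w z" if "conn E w y" for w using that by (rule conn_step[rotated])
    then show ?thesis using step.IH by blast
  next
    case False
    then have "(y = u \<and> z = v) \<or> (y = v \<and> z = u)"
      using step.hyps(2) by (auto simp: doubleton_eq_iff)
    then show ?thesis using step.IH by auto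
  qed
qed auto

lemma pairs_E: assumes "e \<in> pairs V" obtains u v where "e = {u, v}" "u \<noteq> v" "u \<in> V" "v \<in> V"
  using assms by (auto simp: pairs_def card_2_iff)

lemma pairs_doubleton [simp]: "{x, y} \<in> pairs V \<longleftrightarrow> x \<in> V \<and> y \<in> V \<and> x \<noteq> y"
  by (cases "x = y") (auto simp: pairs_def)

lemma finite_pairs: "finite V \<Longrightarrow> finite (pairs V)"
  by (rule finite_subset[of _ "Pow V"]) (auto simp: pairs_def)

lemma card_pairs: "finite V \<Longrightarrow> card (pairs V) = card V choose 2"
  unfolding pairs_def by (rule n_subsets)

text \<open>A new edge merges at most two components, so it costs at most one representative.\<close>
lemma separated_vertices:
  assumes "finite J" "J \<subseteq> pairs UNIV" "finite W"
  shows "\<exists>X\<subseteq>W. (\<forall>x\<in>X. \<forall>y\<in>X. conn J x y \<longrightarrow> x = y) \<and> card W \<le> card J + card X"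
  using assms(1,2)
proof (induction rule: finite_induct)
  case empty
  show ?case by (intro exI[of _ W]) (auto dest: conn_empty)
next
  case (insert e J)
  then obtain X where X: "X \<subseteq> W" "\<forall>x\<in>X. \<forall>y\<in>X. conn J x y \<longrightarrow> x = y" "card W \<le> card J + card X"
    by auto
  obtain u v where e: "e = {u, v}" using insert.prems by (auto elim: pairs_E)
  define X' where "X' = X - {x. conn J x u}"
  have fX: "finite X" using X(1) assms(3) finite_subset by blast
  have "card X \<le> card X' + 1"
  proof (cases "\<exists>x\<in>X. conn J x u")
    case True
    then obtain x where x: "x \<in> X" "conn J x u" by auto
    have "X - {x} \<subseteq> X'"
    proof
      fix y assume y: "y \<in> X - {x}"
      have "\<not> conn J y u" using x X(2) y conn_trans[OF x(2) conn_sym[of J y u]] by auto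
      then show "y \<in> X'" using y by (auto simp: X'_def)
    qed
    then have "card (X - {x}) \<le> card X'" using fX by (intro card_mono) (auto simp: X'_def)
    then show ?thesis using x fX by simp
  next
    case False
    then have "X' = X" by (auto simp: X'_def)
    then show ?thesis by simp
  qed
  moreover have "x = y" if "x \<in> X'" "y \<in> X'" "conn (insert e J) x y" for x y
    using conn_insert[OF that(3)[unfolded e]] that(1,2) X(2) conn_sym[of J u y] conn_sym[of J v y]
    unfolding X'_def by auto
  ultimately show ?case
    using X insert.hyps by (intro exI[of _ X']) (auto simp: X'_def)
qed

lemma connected_card_ge:
  assumes "finite J" "J \<subseteq> pairs UNIV" "finite W" "\<And>x y. x \<in> W \<Longrightarrow> y \<in> W \<Longrightarrow> conn J x y"
  shows "card W \<le> card J + 1"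
proof -
  obtain X where X: "X \<subseteq> W" "\<forall>x\<in>X. \<forall>y\<in>X. conn J x y \<longrightarrow> x = y" "card W \<le> card J + card X"
    using separated_vertices[OF assms(1-3)] by blast
  have "x = y" if "x \<in> X" "y \<in> X" for x y using that X(1,2) assms(4) by blast
  then have "card X \<le> 1" using X(1) assms(3) finite_subset
    by (metis card_le_Suc0_iff_eq One_nat_def)
  then show ?thesis using X(3) by simp
qed

text \<open>A path that would return to a vertex is cut back to its first visit.\<close>
lemma simple_path_exists:
  assumes "conn E x y"
  shows "\<exists>vs. vs \<noteq> [] \<and> hd vs = x \<and> last vs = y \<and> distinct vs \<and>
           (\<forall>i. Suc i < length vs \<longrightarrow> {vs ! i, vs ! Suc i} \<in> E)"
  using assms
proof (induction rule: conn_induct)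
  case base
  show ?case by (intro exI[of _ "[x]"]) auto
next
  case (step y z)
  then obtain vs where vs: "vs \<noteq> []" "hd vs = x" "last vs = y" "distinct vs"
    "\<forall>i. Suc i < length vs \<longrightarrow> {vs ! i, vs ! Suc i} \<in> E" by blast
  show ?case
  proof (cases "z \<in> set vs")
    case True
    then obtain k where k: "k < length vs" "vs ! k = z" by (auto simp: in_set_conv_nth)
    have "hd (take (Suc k) vs) = x" using vs(1,2) by (cases vs) auto
    moreover have "last (take (Suc k) vs) = z" using k by (simp add: take_Suc_conv_app_nth)
    moreover have "{take (Suc k) vs ! i, take (Suc k) vs ! Suc i} \<in> E"
      if "Suc i < length (take (Suc k) vs)" for i using that vs(5) by auto
    ultimately show ?thesis
      using vs(1,4) by (intro exI[of _ "take (Suc k) vs"]) auto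
  next
    case False
    have "{(vs @ [z]) ! i, (vs @ [z]) ! Suc i} \<in> E" if "Suc i < length (vs @ [z])" for i
    proof (cases "Suc i < length vs")
      case True
      then show ?thesis using vs(5) by (auto simp: nth_append)
    next
      case F: False
      then have "i = length vs - 1" using that by auto
      then show ?thesis using vs(1,3) step.hyps(2) by (auto simp: nth_append last_conv_nth)
    qed
    then show ?thesis
      using vs False by (intro exI[of _ "vs @ [z]"]) auto
  qed
qed

text \<open>A path joining the ends of an edge without using that edge closes up to a cycle, so in a tree
  every edge is a bridge.\<close>
lemma tree_edge_bridge:
  assumes "is_tree T" "{u, v} \<in> edges T"
  shows "\<not> conn (edges T - {{u, v}}) u v"
proof
  assume c: "conn (edges T - {{u, v}}) u v"
  have uv: "u \<noteq> v" using assms unfolding is_tree_def simple_graph_def by (metis pairs_doubleton subsetD)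
  obtain vs where vs: "vs \<noteq> []" "hd vs = u" "last vs = v" "distinct vs"
    "\<forall>i. Suc i < length vs \<longrightarrow> {vs ! i, vs ! Suc i} \<in> edges T - {{u, v}}"
    using simple_path_exists[OF c] by blast
  have len: "length vs \<ge> 3"
  proof (rule ccontr)
    assume "\<not> length vs \<ge> 3"
    then have "length vs = 1 \<or> length vs = 2"
      using vs(1) by (cases "length vs") auto
    then show False
    proof
      assume "length vs = 1"
      then show False using vs(2,3) uv by (cases vs) auto
    next
      assume "length vs = 2"
      then obtain a b where "vs = [a, b]" by (auto simp: length_Suc_conv numeral_2_eq_2)
      then show False using vs(2,3,5) by (auto dest: spec[of _ 0])
    qed
  qed
  have "is_cycle T vs" unfolding is_cycle_def
  proof (intro conjI allI impI)
    fix i assume i: "i < length vs"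
    show "{vs ! i, vs ! (Suc i mod length vs)} \<in> edges T"
    proof (cases "Suc i < length vs")
      case True
      then show ?thesis using vs(5) by auto
    next
      case False
      then have "i = length vs - 1" "Suc i = length vs" using i by auto
      then have "vs ! i = v" "vs ! (Suc i mod length vs) = u"
        using vs(1-3) by (auto simp: last_conv_nth hd_conv_nth)
      then show ?thesis using assms(2) by (simp add: insert_commute)
    qed
  qed (use len vs in auto)
  then show False using assms(1) by (auto simp: is_tree_def)
qed

text \<open>If every edge is a bridge, each edge merges two components, so one of the representatives in \<open>X\<close>
  can be dropped for each edge.\<close>
lemma forest_card_le:
  assumes "finite F" "F \<subseteq> pairs W" "finite W"
    and "\<And>u v. {u, v} \<in> F \<Longrightarrow> \<not> conn (F - {{u, v}}) u v"
  shows "\<exists>X\<subseteq>W. (\<forall>w\<in>W. \<exists>x\<in>X. conn F w x) \<and> card F + card X \<le> card W"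
  using assms(1,2,4)
proof (induction rule: finite_induct)
  case empty
  have "\<forall>w\<in>W. \<exists>x\<in>W. conn {} w x"
  proof
    fix w assume "w \<in> W"
    then show "\<exists>x\<in>W. conn {} w x" by (rule rev_bexI) simp
  qed
  then show ?case by (intro exI[of _ W]) auto
next
  case (insert e F)
  obtain u v where e: "e = {u, v}" "u \<in> W" "v \<in> W" using insert.prems(1) by (auto elim: pairs_E)
  have "\<exists>X\<subseteq>W. (\<forall>w\<in>W. \<exists>x\<in>X. conn F w x) \<and> card F + card X \<le> card W"
  proof (rule insert.IH)
    show "F \<subseteq> pairs W" using insert.prems(1) by simp
    show "\<not> conn (F - {{a, b}}) a b" if ab: "{a, b} \<in> F" for a b
    proof
      assume "conn (F - {{a, b}}) a b"
      then have "conn (insert e F - {{a, b}}) a b" by (rule conn_mono) blast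
      then show False using insert.prems(2)[of a b] ab by simp
    qed
  qed
  then obtain X where X: "X \<subseteq> W" "\<forall>w\<in>W. \<exists>x\<in>X. conn F w x" "card F + card X \<le> card W"
    by (elim exE conjE)
  have nuv: "\<not> conn F u v"
  proof -
    have "insert e F - {{u, v}} = F" using insert.hyps(2) e(1) by simp
    moreover have "{u, v} \<in> insert e F" using e(1) by simp
    ultimately show ?thesis using insert.prems(2)[of u v] by (simp only: not_False_eq_True)
  qed
  obtain x where x: "x \<in> X" "conn F u x" using X(2) e(2) by auto
  obtain y where y: "y \<in> X" "conn F v y" using X(2) e(3) by auto
  have xy: "x \<noteq> y" using nuv conn_trans[OF x(2), of v] conn_sym[OF y(2)] by blast
  have m: "conn F a b \<Longrightarrow> conn (insert e F) a b" for a b by (erule conn_mono) auto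
  have uv: "{u, v} \<in> insert e F" unfolding e(1) by (rule insertI1)
  have "conn (insert e F) x u" by (rule m, rule conn_sym, rule x(2))
  moreover have "conn (insert e F) u v" using uv by (rule conn_edge)
  moreover have "conn (insert e F) v y" by (rule m, rule y(2))
  ultimately have "conn (insert e F) x y" by (meson conn_trans)
  note cxy = this
  have ex: "\<exists>z\<in>X - {x}. conn (insert e F) w z" if w: "w \<in> W" for w
  proof -
    obtain z where z: "z \<in> X" "conn F w z" using X(2) w by blast
    show ?thesis
    proof (cases "z = x")
      case True
      then have "conn (insert e F) w y" using conn_trans[OF m[OF z(2)], of y] cxy by blast
      then show ?thesis using y(1) xy by (intro bexI[of _ y]) auto
    next
      case False
      then show ?thesis using m[OF z(2)] z(1) by (intro bexI[of _ z]) auto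
    qed
  qed
  have "finite X" using X(1) assms(3) by (rule finite_subset)
  then have "card (X - {x}) + 1 = card X" using card_Suc_Diff1[of X x] x(1) by simp
  moreover have "card (insert e F) = card F + 1" using insert.hyps by simp
  ultimately have "card (insert e F) + card (X - {x}) \<le> card W" using X(3) by linarith
  moreover have "X - {x} \<subseteq> W" using X(1) by auto
  moreover have "\<forall>w\<in>W. \<exists>z\<in>X - {x}. conn (insert e F) w z" using ex by (rule ballI)
  ultimately show ?case by (intro exI[of _ "X - {x}"] conjI)
qed

lemma tree_card_edges:
  assumes "is_tree T"
  shows "card (edges T) + 1 = card (verts T)"
proof -
  have fin: "finite (verts T)" and sub: "edges T \<subseteq> pairs (verts T)"
    and con: "connected_graph T" using assms by (auto simp: is_tree_def simple_graph_def)
  have finE: "finite (edges T)" using finite_pairs[OF fin] sub finite_subset by blast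
  obtain X where X: "X \<subseteq> verts T" "\<forall>w\<in>verts T. \<exists>x\<in>X. conn (edges T) w x"
     "card (edges T) + card X \<le> card (verts T)"
    using forest_card_le[OF finE sub fin] tree_edge_bridge[OF assms] by blast
  have "X \<noteq> {}" using X(2) con by (auto simp: connected_graph_conn)
  then have "card X \<ge> 1" using X(1) fin finite_subset by (metis One_nat_def Suc_leI card_gt_0_iff)
  moreover have "card (verts T) \<le> card (edges T) + 1"
    using con sub by (intro connected_card_ge finE fin) (auto simp: connected_graph_conn pairs_def)
  ultimately show ?thesis using X(3) by linarith
qed

text \<open>The rest of the cycle joins the ends of its first edge.\<close>
lemma cycle_edge_redundant:
  assumes "is_cycle G vs"
  defines "e \<equiv> {vs ! 0, vs ! 1}"
  shows "e \<in> edges G" "conn (edges G - {e}) (vs ! 1) (vs ! 0)"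
proof -
  note c = assms(1)[unfolded is_cycle_def]
  have len: "length vs \<ge> 3" using c by (rule conjunct1)
  have dist: "distinct vs" using c by (elim conjE)
  have ed: "{vs ! i, vs ! (Suc i mod length vs)} \<in> edges G" if "i < length vs" for i
    using conjunct2[OF conjunct2[OF c]] that by (elim allE impE)
  have "Suc 0 mod length vs = 1" using len by simp
  moreover have "0 < length vs" using len by linarith
  ultimately have "{vs ! 0, vs ! 1} \<in> edges G" using ed[of 0] by (simp only:)
  then show "e \<in> edges G" unfolding e_def .
  have l0: "0 < length vs" "1 < length vs" "2 < length vs" using len by auto
  have nth: "vs ! i = vs ! j \<longleftrightarrow> i = j" if "i < length vs" "j < length vs" for i j
    using nth_eq_iff_index_eq[OF dist that] .
  have *: "conn (edges G - {e}) (vs ! 1) (vs ! (Suc k mod length vs))" if "k < length vs" for k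
    using that
  proof (induction k)
    case 0
    have "Suc 0 mod length vs = 1" using len by simp
    then show ?case by (metis conn_refl)
  next
    case (Suc k)
    have "vs ! Suc k \<noteq> vs ! 0" using nth[OF Suc.prems(1) l0(1)] by simp
    moreover have "\<not> (vs ! Suc k = vs ! 1 \<and> vs ! (Suc (Suc k) mod length vs) = vs ! 0)"
    proof
      assume a: "vs ! Suc k = vs ! 1 \<and> vs ! (Suc (Suc k) mod length vs) = vs ! 0"
      then have "k = 0" using nth[OF Suc.prems(1) l0(2)] by simp
      then have "Suc (Suc k) mod length vs = 2" using l0(3) by simp
      then show False using a nth[OF l0(3) l0(1)] by simp
    qed
    ultimately have "{vs ! Suc k, vs ! (Suc (Suc k) mod length vs)} \<noteq> e"
      unfolding e_def doubleton_eq_iff by blast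
    then have "{vs ! Suc k, vs ! (Suc (Suc k) mod length vs)} \<in> edges G - {e}"
      using ed[OF Suc.prems] by blast
    moreover have "Suc k mod length vs = Suc k" using Suc.prems by simp
    moreover have "conn (edges G - {e}) (vs ! 1) (vs ! (Suc k mod length vs))"
      using Suc.IH Suc.prems by linarith
    ultimately show ?case by (metis conn_step)
  qed
  have "Suc (length vs - 1) = length vs" using len by linarith
  then have "Suc (length vs - 1) mod length vs = 0" "length vs - 1 < length vs" by simp_all
  then show "conn (edges G - {e}) (vs ! 1) (vs ! 0)" using *[of "length vs - 1"] by metis
qed

text \<open>Removing an edge of a cycle would leave a connected graph with too few edges.\<close>
lemma tree_by_card:
  assumes "simple_graph G" "connected_graph G" "card (edges G) + 1 \<le> card (verts G)"
  shows "is_tree G"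
  unfolding is_tree_def
proof (intro conjI assms notI)
  assume "\<exists>vs. is_cycle G vs"
  then obtain vs where vs: "is_cycle G vs" by blast
  define e where "e = {vs ! 0, vs ! 1}"
  note red = cycle_edge_redundant[OF vs, folded e_def]
  have fin: "finite (verts G)" and sub: "edges G \<subseteq> pairs (verts G)"
    using assms(1) by (auto simp: simple_graph_def)
  have finE: "finite (edges G)" using finite_pairs[OF fin] sub finite_subset by blast
  have "conn (edges G - {e}) x y" if "x \<in> verts G" "y \<in> verts G" for x y
  proof (rule conn_subst)
    show "conn (edges G) x y" using assms(2) that by (auto simp: connected_graph_conn)
    fix u v assume uv: "{u, v} \<in> edges G"
    show "conn (edges G - {e}) u v"
    proof (cases "{u, v} = e")
      case True
      then show ?thesis using red(2) conn_sym[OF red(2)] unfolding e_def by (auto simp: doubleton_eq_iff)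
    qed (use uv in \<open>auto intro: conn_edge\<close>)
  qed
  then have "card (verts G) \<le> card (edges G - {e}) + 1"
    using sub by (intro connected_card_ge fin) (auto simp: finE pairs_def)
  moreover have "card (edges G - {e}) + 1 = card (edges G)"
    using red(1) finE by (metis One_nat_def add.commute card_Suc_Diff1 plus_1_eq_Suc)
  ultimately show False using assms(3) by simp
qed

section \<open>Bootstrap percolation and weak saturation\<close>

lemma bootstrap_step_E:
  assumes "bootstrap_step H H'"
  obtains x y z where "distinct [x, y, z]" "{x, y} \<notin> edges H" "edges H' = insert {x, y} (edges H)"
    "{y, z} \<in> edges H" "{x, z} \<in> edges H" "verts H' = verts H"
  using assms unfolding bootstrap_step_def in_triangle_def by (auto simp: doubleton_eq_iff)

lemma bootstrap_step_I:
  assumes "distinct [x, y, z]" "{x, y} \<notin> F" "{y, z} \<in> F" "{x, z} \<in> F"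
  shows "bootstrap_step (V, F) (V, insert {x, y} F)"
  unfolding bootstrap_step_def in_triangle_def
  by (intro conjI exI[of _ "{x, y}"] exI[of _ x] exI[of _ y] exI[of _ z]) (use assms in auto)

lemma bootstrap_mono:
  assumes "bootstrap_step\<^sup>*\<^sup>* H G"
  shows "verts G = verts H \<and> edges H \<subseteq> edges G"
  using assms by (induction rule: rtranclp_induct) (auto simp: bootstrap_step_def)

text \<open>The other two sides of the triangle already join the ends of an added edge, so the process never
  merges components.\<close>
lemma bootstrap_conn:
  assumes "bootstrap_step\<^sup>*\<^sup>* H G" "conn (edges G) x y"
  shows "conn (edges H) x y"
  using assms
proof (induction arbitrary: x y rule: rtranclp_induct)
  case (step G G')
  show ?case
  proof (rule step.IH)
    obtain a b c where abc: "edges G' = insert {a, b} (edges G)" "{b, c} \<in> edges G" "{a, c} \<in> edges G"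
      using step.hyps(2) by (rule bootstrap_step_E)
    have ab: "conn (edges G) a b"
      using conn_trans[OF conn_edge[OF abc(3)] conn_sym[OF conn_edge[OF abc(2)]]] .
    show "conn (edges G) x y"
    proof (rule conn_subst[OF step.prems])
      fix u v assume "{u, v} \<in> edges G'"
      then show "conn (edges G) u v" using abc ab conn_sym[OF ab] conn_edge[of u v]
        by (auto simp: doubleton_eq_iff)
    qed
  qed
qed

text \<open>The process may be run until it stalls inside the host graph.\<close>
lemma bootstrap_closure:
  assumes "finite E" "T \<subseteq> E"
  obtains F where "T \<subseteq> F" "F \<subseteq> E" "bootstrap_step\<^sup>*\<^sup>* (V, T) (V, F)"
    "\<And>x y z. distinct [x, y, z] \<Longrightarrow> {x, y} \<in> E \<Longrightarrow> {y, z} \<in> F \<Longrightarrow> {x, z} \<in> F \<Longrightarrow> {x, y} \<in> F"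
proof -
  define \<F> where "\<F> = {F. T \<subseteq> F \<and> F \<subseteq> E \<and> bootstrap_step\<^sup>*\<^sup>* (V, T) (V, F)}"
  have "finite \<F>" by (rule finite_subset[of _ "Pow E"]) (auto simp: \<F>_def assms)
  moreover have "T \<in> \<F>" using assms by (auto simp: \<F>_def)
  ultimately obtain F where F: "F \<in> \<F>" "\<And>F'. F' \<in> \<F> \<Longrightarrow> F \<subseteq> F' \<Longrightarrow> F' = F"
    using finite_has_maximal2[of \<F> T] by metis
  have "{x, y} \<in> F" if "distinct [x, y, z]" "{x, y} \<in> E" "{y, z} \<in> F" "{x, z} \<in> F" for x y z
  proof (rule ccontr)
    assume n: "{x, y} \<notin> F"
    have "bootstrap_step (V, F) (V, insert {x, y} F)" by (rule bootstrap_step_I) (use that n in auto)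
    then have "insert {x, y} F \<in> \<F>" using F(1) that by (auto simp: \<F>_def)
    then show False using F(2)[of "insert {x, y} F"] n by auto
  qed
  then show thesis using F(1) that unfolding \<F>_def by blast
qed

definition tree_activates :: "'a graph \<Rightarrow> bool" where
  "tree_activates G \<longleftrightarrow> (\<exists>T. is_tree T \<and> subgraph T G \<and> activates T G)"

definition cherry_covered :: "'a graph \<Rightarrow> bool" where
  "cherry_covered G \<longleftrightarrow> (\<forall>x\<in>verts G. \<forall>y\<in>verts G. x \<noteq> y \<longrightarrow>
     (\<exists>z. {x, z} \<in> edges G \<and> {y, z} \<in> edges G))"

lemma activatesI:
  assumes "simple_graph G" "bootstrap_step\<^sup>*\<^sup>* H G"
  shows "activates H G" "simple_graph H"
proof -
  have "verts G = verts H" "edges H \<subseteq> edges G" using bootstrap_mono[OF assms(2)] by auto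
  then show "activates H G" "simple_graph H"
    using assms by (auto simp: activates_def spanning_subgraph_def subgraph_def simple_graph_def)
qed

text \<open>Having an activating tree is not monotone in the host graph, but it becomes so together with
  the condition that any two vertices have a common neighbour: then every extra edge can be added
  by a bootstrap step at the end.\<close>
lemma tree_activates_mono:
  assumes "tree_activates (V, E)" "cherry_covered (V, E)" "E \<subseteq> E'" "simple_graph (V, E')"
  shows "tree_activates (V, E') \<and> cherry_covered (V, E')"
proof
  obtain T where T: "is_tree T" "subgraph T (V, E)" "activates T (V, E)"
    using assms(1) by (auto simp: tree_activates_def)
  have VE: "verts T = V" "bootstrap_step\<^sup>*\<^sup>* T (V, E)" using T(3) by (auto simp: activates_def spanning_subgraph_def)
  have fin: "finite V" "E' \<subseteq> pairs V" using assms(4) by (auto simp: simple_graph_def)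
  then have finE: "finite E'" using finite_pairs finite_subset by blast
  obtain F where F: "E \<subseteq> F" "F \<subseteq> E'" "bootstrap_step\<^sup>*\<^sup>* (V, E) (V, F)"
    "\<And>x y z. distinct [x, y, z] \<Longrightarrow> {x, y} \<in> E' \<Longrightarrow> {y, z} \<in> F \<Longrightarrow> {x, z} \<in> F \<Longrightarrow> {x, y} \<in> F"
    using bootstrap_closure[OF finE assms(3), of V] by blast
  have "e \<in> F" if e: "e \<in> E'" for e
  proof -
    obtain x y where xy: "e = {x, y}" "x \<noteq> y" "x \<in> V" "y \<in> V" using e fin(2) by (meson pairs_E subsetD)
    obtain z where z: "{x, z} \<in> E" "{y, z} \<in> E" using assms(2) xy by (auto simp: cherry_covered_def)
    have "z \<noteq> x" "z \<noteq> y" using z assms(3) fin(2) by (metis pairs_doubleton subsetD)+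
    then show ?thesis using F(4)[of x y z] F(1) z e xy by auto
  qed
  then have "F = E'" using F by auto
  then have "bootstrap_step\<^sup>*\<^sup>* T (V, E')" using VE(2) F(3) by auto
  then have "activates T (V, E')" by (rule activatesI(1)[OF assms(4)])
  then show "tree_activates (V, E')" using T(1)
    unfolding tree_activates_def activates_def spanning_subgraph_def by blast
  show "cherry_covered (V, E')" using assms(2,3) by (fastforce simp: cherry_covered_def)
qed

lemma cherry_covered_connected:
  assumes "cherry_covered G" "verts G \<noteq> {}"
  shows "connected_graph G"
proof -
  have "conn (edges G) x y" if V: "x \<in> verts G" "y \<in> verts G" for x y
  proof (cases "x = y")
    case False
    then have "\<exists>z. {x, z} \<in> edges G \<and> {y, z} \<in> edges G"
      using assms(1) V unfolding cherry_covered_def by simp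
    then obtain z where "{x, z} \<in> edges G" "{y, z} \<in> edges G" by (elim exE conjE)
    then show ?thesis by (intro conn_trans[OF conn_edge conn_sym[OF conn_edge]])
  qed auto
  then show ?thesis using assms(2) by (auto simp: connected_graph_conn)
qed

lemma wsat_attained:
  assumes "simple_graph G"
  obtains H where "activates H G" "card (edges H) = wsat_K3 G"
proof -
  have "\<exists>m. \<exists>H. activates H G \<and> card (edges H) = m"
    using activatesI(1)[OF assms, of G] by blast
  from LeastI_ex[OF this] show thesis using that unfolding wsat_K3_def by blast
qed

lemma activating_connected:
  assumes "activates H G" "connected_graph G"
  shows "connected_graph H" "simple_graph H" "verts H = verts G" "card (verts G) \<le> card (edges H) + 1"
proof -
  have b: "bootstrap_step\<^sup>*\<^sup>* H G" and s: "simple_graph H" "verts H = verts G"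
    using assms(1) by (auto simp: activates_def spanning_subgraph_def subgraph_def)
  show c: "connected_graph H" using bootstrap_conn[OF b] assms(2) s by (auto simp: connected_graph_conn)
  show "simple_graph H" "verts H = verts G" by fact+
  have fin: "finite (verts H)" "edges H \<subseteq> pairs (verts H)" using s(1) by (auto simp: simple_graph_def)
  then have "finite (edges H)" using finite_pairs finite_subset by blast
  then have "card (verts H) \<le> card (edges H) + 1"
    using c fin by (intro connected_card_ge) (auto simp: connected_graph_conn pairs_def)
  then show "card (verts G) \<le> card (edges H) + 1" using s(2) by simp
qed

text \<open>A subgraph that activates a connected graph is connected and spanning. So it has at least
  \<open>n - 1\<close> edges, with equality exactly for trees.\<close>
lemma wsat_tree_iff:
  assumes "simple_graph G" "connected_graph G"
  shows "wsat_K3 G + 1 = card (verts G) \<longleftrightarrow> tree_activates G"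
proof
  obtain H where H: "activates H G" "card (edges H) = wsat_K3 G" using wsat_attained[OF assms(1)] .
  note aH = activating_connected[OF H(1) assms(2)]
  {
    assume "wsat_K3 G + 1 = card (verts G)"
    then have "is_tree H" using tree_by_card[of H] aH H by simp
    then show "tree_activates G" using H(1)
      unfolding tree_activates_def activates_def spanning_subgraph_def by blast
  next
    assume "tree_activates G"
    then obtain T where T: "is_tree T" "activates T G" by (auto simp: tree_activates_def)
    have "card (edges T) + 1 = card (verts G)"
      using tree_card_edges[OF T(1)] T(2) by (auto simp: activates_def spanning_subgraph_def)
    moreover have "wsat_K3 G \<le> card (edges T)" unfolding wsat_K3_def by (intro Least_le exI[of _ T] conjI T(2) refl)
    ultimately show "wsat_K3 G + 1 = card (verts G)" using aH H by simp
  }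
qed

section \<open>Fillings of closed walks by triangles\<close>

text \<open>The list holds the vertices after the start, so its length is the number of edges of the walk.\<close>
fun walk :: "'a set set \<Rightarrow> 'a \<Rightarrow> 'a list \<Rightarrow> 'a \<Rightarrow> bool" where
  "walk E u [] v \<longleftrightarrow> u = v"
| "walk E u (x # xs) v \<longleftrightarrow> {u, x} \<in> E \<and> walk E x xs v"

fun wedges :: "'a \<Rightarrow> 'a list \<Rightarrow> 'a set multiset" where
  "wedges u [] = {#}"
| "wedges u (x # xs) = add_mset {u, x} (wedges x xs)"

lemma size_wedges [simp]: "size (wedges u xs) = length xs"
  by (induction xs arbitrary: u) auto

lemma walk_append: "walk E u (xs @ ys) v \<longleftrightarrow> (\<exists>m. walk E u xs m \<and> walk E m ys v)"
  by (induction xs arbitrary: u) auto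

lemma wedges_append: "walk E u xs m \<Longrightarrow> wedges u (xs @ ys) = wedges u xs + wedges m ys"
  by (induction xs arbitrary: u) auto

lemma walk_join: "walk E u xs m \<Longrightarrow> walk E m ys v \<Longrightarrow> walk E u (xs @ ys) v"
  by (auto simp: walk_append)

lemma wedges_subset: "walk E u xs v \<Longrightarrow> set_mset (wedges u xs) \<subseteq> E"
  by (induction xs arbitrary: u) auto

lemma wedges_verts: "e \<in># wedges u xs \<Longrightarrow> \<exists>x y. e = {x, y} \<and> x \<in> set (u # xs) \<and> y \<in> set (u # xs)"
proof (induction xs arbitrary: u)
  case (Cons a xs)
  show ?case
  proof (cases "e = {u, a}")
    case True
    then show ?thesis by (intro exI[of _ u] exI[of _ a]) auto
  next
    case False
    then have "e \<in># wedges a xs" using Cons.prems by auto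
    from Cons.IH[OF this] show ?thesis by auto
  qed
qed auto

lemma walk_rev:
  assumes "walk E u xs v"
  shows "\<exists>ys. walk E v ys u \<and> wedges v ys = wedges u xs \<and> length ys = length xs"
  using assms
proof (induction xs arbitrary: u)
  case (Cons a xs)
  then obtain ys where ys: "walk E v ys a" "wedges v ys = wedges a xs" "length ys = length xs" by auto
  have "walk E v (ys @ [u]) u" using ys(1) Cons.prems by (auto simp: walk_append insert_commute)
  moreover have "wedges v (ys @ [u]) = wedges u (a # xs)"
    using wedges_append[OF ys(1), of "[u]"] ys(2) by (simp add: insert_commute)
  ultimately show ?case using ys(3) by (intro exI[of _ "ys @ [u]"]) auto
qed auto

lemma walk_split:
  assumes "walk E u xs v" "x \<in> set (u # xs)"
  shows "\<exists>p q. xs = p @ q \<and> walk E u p x \<and> walk E x q v"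
  using assms
proof (induction xs arbitrary: u)
  case (Cons a xs)
  show ?case
  proof (cases "x = u")
    case True
    then show ?thesis using Cons.prems(1) by (intro exI[of _ "[]"] exI[of _ "a # xs"]) auto
  next
    case False
    then have "x \<in> set (a # xs)" using Cons.prems by auto
    then obtain p q where "xs = p @ q" "walk E a p x" "walk E x q v"
      using Cons.IH[of a] Cons.prems by auto
    then show ?thesis using Cons.prems by (intro exI[of _ "a # p"] exI[of _ q]) auto
  qed
qed auto

text \<open>\<open>fills U M\<close> says that the mod-2 boundary of the set \<open>U\<close> of triangles is the mod-2 chain
  given by the multiset \<open>M\<close> of edges.\<close>

definition fills :: "'a set set \<Rightarrow> 'a set multiset \<Rightarrow> bool" where
  "fills U M \<longleftrightarrow> (\<forall>e. odd (card {t \<in> U. e \<in> pairs t}) \<longleftrightarrow> odd (count M e))"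

definition boundary :: "'a set set \<Rightarrow> 'a set set" where
  "boundary U = {e. odd (card {t \<in> U. e \<in> pairs t})}"

lemma fills_boundary: "fills U M \<Longrightarrow> boundary U = {e. odd (count M e)}"
  by (auto simp: fills_def boundary_def)

lemma card_boundary_le: assumes "fills U M" shows "card (boundary U) \<le> size M"
proof -
  have "boundary U \<subseteq> set_mset M"
  proof
    fix e assume "e \<in> boundary U"
    then have "odd (count M e)" unfolding fills_boundary[OF assms] by simp
    then show "e \<in> set_mset M" by (cases "count M e = 0") (auto simp: count_eq_zero_iff)
  qed
  then have "card (boundary U) \<le> card (set_mset M)" by (intro card_mono) auto
  also have "\<dots> \<le> size M"
    using size_mset_mono[OF mset_set_set_mset_msubset[of M]] by simp
  finally show ?thesis .
qed

lemma odd_card_sym_diff: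
  assumes "finite A" "finite B"
  shows "odd (card (sym_diff A B)) \<longleftrightarrow> odd (card A + card B)"
proof -
  have "card A + card B = card (sym_diff A B) + 2 * card (A \<inter> B)"
  proof -
    have "card A = card (A - B) + card (A \<inter> B)" "card B = card (B - A) + card (A \<inter> B)"
      using card_Int_Diff[of A B] card_Int_Diff[of B A] assms by (auto simp: Int_commute)
    moreover have "card (sym_diff A B) = card (A - B) + card (B - A)"
      using assms by (intro card_Un_disjoint) auto
    ultimately show ?thesis by simp
  qed
  then show ?thesis by simp
qed

lemma card_sym_diff_le: "finite A \<Longrightarrow> finite B \<Longrightarrow> card (sym_diff A B) \<le> card A + card B"
  by (rule order_trans[OF card_Un_le add_mono[OF card_mono card_mono]]) auto

lemma fills_add:
  assumes "fills U M" "fills U' M'" "finite U" "finite U'"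
  shows "fills (sym_diff U U') (M + M')"
  unfolding fills_def
proof
  fix e
  have "{t \<in> sym_diff U U'. e \<in> pairs t} = sym_diff {t \<in> U. e \<in> pairs t} {t \<in> U'. e \<in> pairs t}" by auto
  then show "odd (card {t \<in> sym_diff U U'. e \<in> pairs t}) \<longleftrightarrow> odd (count (M + M') e)"
    using odd_card_sym_diff[of "{t \<in> U. e \<in> pairs t}" "{t \<in> U'. e \<in> pairs t}"] assms
    by (simp add: fills_def)
qed

section \<open>The rectangle inequality\<close>

text \<open>Along a walk on which \<open>g \<le> s\<close>, an edge from level \<open>r\<close> to level \<open>r + 1\<close> of \<open>h\<close> is traversed an
  odd number of times exactly when the walk changes sides.\<close>

definition crossing :: "('a \<Rightarrow> nat) \<Rightarrow> ('a \<Rightarrow> nat) \<Rightarrow> nat \<Rightarrow> nat \<Rightarrow> 'a set set" where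
  "crossing h g r s = {{x, y} | x y. h x = r \<and> h y = Suc r \<and> g x \<le> s}"

lemma crossing_doubleton:
  "{x, y} \<in> crossing h g r s \<longleftrightarrow>
     (h x = r \<and> h y = Suc r \<and> g x \<le> s) \<or> (h y = r \<and> h x = Suc r \<and> g y \<le> s)"
  unfolding crossing_def by (auto simp: doubleton_eq_iff)

lemma crossing_walk_parity:
  assumes "walk E u xs v" "\<forall>x\<in>set (u # xs). g x \<le> s"
    and lip: "\<And>x y. {x, y} \<in> E \<Longrightarrow> h x \<le> Suc (h y)"
  shows "odd (size (filter_mset (\<lambda>e. e \<in> crossing h g r s) (wedges u xs))) \<longleftrightarrow> ((h u \<le> r) \<noteq> (h v \<le> r))"
  using assms(1,2)
proof (induction xs arbitrary: u)
  case (Cons x xs)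
  have l: "h u \<le> Suc (h x)" "h x \<le> Suc (h u)"
    using lip[of u x] lip[of x u] Cons.prems by (auto simp: insert_commute)
  have "{u, x} \<in> crossing h g r s \<longleftrightarrow> ((h u \<le> r) \<noteq> (h x \<le> r))"
    using l Cons.prems(2) unfolding crossing_doubleton by auto
  moreover have "odd (size (filter_mset (\<lambda>e. e \<in> crossing h g r s) (wedges x xs))) \<longleftrightarrow> ((h x \<le> r) \<noteq> (h v \<le> r))"
    using Cons by auto
  ultimately show ?case by auto
qed auto

lemma odd_sum_cong:
  fixes f g :: "'b \<Rightarrow> nat"
  assumes "\<And>x. x \<in> A \<Longrightarrow> odd (f x) \<longleftrightarrow> odd (g x)"
  shows "odd (sum f A) \<longleftrightarrow> odd (sum g A)"
  using assms by (induction A rule: infinite_finite_induct) auto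

text \<open>A triangle that meets the crossing set in an odd number of edges has exactly two vertices on
  the lower level \<open>r\<close>, and their \<open>g\<close>-values are \<open>s\<close> and \<open>s + 1\<close>; so the triangle determines
  the pair \<open>(r, s)\<close>.\<close>

definition crosses :: "('a \<Rightarrow> nat) \<Rightarrow> ('a \<Rightarrow> nat) \<Rightarrow> 'a set \<Rightarrow> nat \<Rightarrow> nat \<Rightarrow> bool" where
  "crosses h g t r s \<longleftrightarrow> (\<exists>x x' y. t = {x, x', y} \<and> h x = r \<and> h x' = r \<and> h y = Suc r \<and>
      g x = s \<and> g x' = Suc s)"

lemma crosses_unique:
  assumes "crosses h g t r s" "crosses h g t r' s'"
  shows "r = r' \<and> s = s'"
proof -
  have *: "r = Min (h ` t) \<and> s = Min (g ` {v \<in> t. h v = r})" if cr: "crosses h g t r s" for r s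
  proof -
    obtain x x' y where t: "t = {x, x', y}" "h x = r" "h x' = r" "h y = Suc r" "g x = s" "g x' = Suc s"
      using cr unfolding crosses_def by blast
    have "h ` t = {r, Suc r}" using t by auto
    moreover have "{v \<in> t. h v = r} = {x, x'}" using t by auto
    ultimately show ?thesis using t by simp
  qed
  show ?thesis using *[OF assms(1)] *[OF assms(2)] by metis
qed

lemma crosses_corner:
  assumes "h x = r" "h y = Suc r" "g x \<le> s" "{x, z} \<notin> crossing h g r s" "{y, z} \<notin> crossing h g r s"
    and "h z \<le> Suc (h x)" "h y \<le> Suc (h z)" "g z \<le> Suc (g x)"
  shows "crosses h g {x, y, z} r s"
proof -
  have "h z = r" using assms unfolding crossing_doubleton by auto
  moreover have "g z > s" using assms(2,5) \<open>h z = r\<close> unfolding crossing_doubleton by auto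
  ultimately show ?thesis using assms unfolding crosses_def
    by (intro exI[of _ x] exI[of _ z] exI[of _ y]) auto
qed

lemma pairs_triangle:
  assumes "distinct [x, y, z]"
  shows "pairs {x, y, z} = {{x, y}, {y, z}, {x, z}}"
proof
  show "pairs {x, y, z} \<subseteq> {{x, y}, {y, z}, {x, z}}"
  proof
    fix e assume "e \<in> pairs {x, y, z}"
    then obtain u v where "e = {u, v}" "u \<noteq> v" "u \<in> {x, y, z}" "v \<in> {x, y, z}" by (rule pairs_E)
    then show "e \<in> {{x, y}, {y, z}, {x, z}}" by (auto simp: insert_commute)
  qed
qed (use assms in auto)

lemma odd_crossing_triangle:
  assumes t: "card t = 3" "pairs t \<subseteq> E"
    and lh: "\<And>x y. {x, y} \<in> E \<Longrightarrow> h x \<le> Suc (h y)"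
    and lg: "\<And>x y. {x, y} \<in> E \<Longrightarrow> g x \<le> Suc (g y)"
    and odd: "odd (card (pairs t \<inter> crossing h g r s))"
  shows "crosses h g t r s"
proof -
  let ?Q = "crossing h g r s"
  obtain x y z where xyz: "t = {x, y, z}" "distinct [x, y, z]"
    using t(1) by (auto simp: card_3_iff)
  have p: "pairs t = {{x, y}, {y, z}, {x, z}}" using pairs_triangle[OF xyz(2)] xyz(1) by simp
  have ne: "{x, y} \<noteq> {y, z}" "{x, y} \<noteq> {x, z}" "{y, z} \<noteq> {x, z}" using xyz(2) by (auto simp: doubleton_eq_iff)
  have L: "h a \<le> Suc (h b)" "g a \<le> Suc (g b)" if "a \<in> t" "b \<in> t" "a \<noteq> b" for a b
    using that lh[of a b] lg[of a b] t(2) by (auto simp: subset_eq)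
  have corner: "crosses h g t r s"
    if "t = {a, b, c}" "distinct [a, b, c]" "{a, b} \<in> ?Q" "{a, c} \<notin> ?Q" "{b, c} \<notin> ?Q" for a b c
  proof -
    have mem: "a \<in> t" "b \<in> t" "c \<in> t" "a \<noteq> b" "a \<noteq> c" "b \<noteq> c" "c \<noteq> a" "c \<noteq> b" using that by auto
    from that(3) consider "h a = r" "h b = Suc r" "g a \<le> s" | "h b = r" "h a = Suc r" "g b \<le> s"
      unfolding crossing_doubleton by blast
    then show ?thesis
    proof cases
      case 1
      then show ?thesis unfolding that(1)
        by (rule crosses_corner) (use that L mem in auto)
    next
      case 2
      then have "crosses h g {b, a, c} r s"
        by (rule crosses_corner) (use that L mem in auto)
      then show ?thesis using that(1) by (simp add: insert_commute)
    qed
  qed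
  have "pairs t \<inter> ?Q = (if {x, y} \<in> ?Q then {{x, y}} else {}) \<union> (if {y, z} \<in> ?Q then {{y, z}} else {})
      \<union> (if {x, z} \<in> ?Q then {{x, z}} else {})" unfolding p by auto
  then have c: "card (pairs t \<inter> ?Q) = (if {x, y} \<in> ?Q then 1 else 0) + (if {y, z} \<in> ?Q then 1 else 0)
      + (if {x, z} \<in> ?Q then 1 else 0)" using ne by (auto split: if_splits)
  have "\<not> ({x, y} \<in> ?Q \<and> {y, z} \<in> ?Q \<and> {x, z} \<in> ?Q)" unfolding crossing_doubleton by auto
  then consider "{x, y} \<in> ?Q" "{y, z} \<notin> ?Q" "{x, z} \<notin> ?Q" | "{x, y} \<notin> ?Q" "{y, z} \<in> ?Q" "{x, z} \<notin> ?Q"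
    | "{x, y} \<notin> ?Q" "{y, z} \<notin> ?Q" "{x, z} \<in> ?Q"
    using odd unfolding c by (auto split: if_splits)
  then show ?thesis
  proof cases
    case 1 then show ?thesis using corner[of x y z] xyz by auto
  next
    case 2 then show ?thesis using corner[of y z x] xyz by (auto simp: insert_commute)
  next
    case 3 then show ?thesis using corner[of x z y] xyz by (auto simp: insert_commute)
  qed
qed

text \<open>Modulo 2, the number of edges of \<open>M\<close> in \<open>Q\<close> is the sum over \<open>t \<in> U\<close> of the number of sides of
  \<open>t\<close> in \<open>Q\<close>.\<close>
lemma odd_filling_crossing:
  assumes U: "finite U" "\<And>t. t \<in> U \<Longrightarrow> card t = 3" and f: "fills U M"
    and odd: "odd (size (filter_mset (\<lambda>e. e \<in> Q) M))"
  shows "\<exists>t\<in>U. odd (card (pairs t \<inter> Q))"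
proof (rule ccontr)
  assume "\<not> (\<exists>t\<in>U. odd (card (pairs t \<inter> Q)))"
  then have ev: "even (card (pairs t \<inter> Q))" if "t \<in> U" for t using that by auto
  define F where "F = ((\<Union>t\<in>U. pairs t) \<union> set_mset M) \<inter> Q"
  have fin: "finite (pairs t)" if "t \<in> U" for t
    using U(2)[OF that] by (intro finite_pairs) (metis card.infinite zero_neq_numeral)
  then have finF: "finite F" unfolding F_def using U(1) by auto
  have "size (filter_mset (\<lambda>e. e \<in> Q) M) = (\<Sum>e\<in>F. count M e)"
  proof -
    have "size (filter_mset (\<lambda>e. e \<in> Q) M) = (\<Sum>e\<in>set_mset M \<inter> Q. count M e)"
      unfolding size_multiset_overloaded_eq by (intro sum.cong) auto
    also have "\<dots> = (\<Sum>e\<in>F. count M e)"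
      by (intro sum.mono_neutral_left finF) (auto simp: F_def count_eq_zero_iff)
    finally show ?thesis .
  qed
  then have "odd (\<Sum>e\<in>F. card {t \<in> U. e \<in> pairs t})"
    using odd odd_sum_cong[of F "\<lambda>e. card {t \<in> U. e \<in> pairs t}" "count M"] f by (auto simp: fills_def)
  also have "(\<Sum>e\<in>F. card {t \<in> U. e \<in> pairs t}) = (\<Sum>e\<in>F. \<Sum>t\<in>U. if e \<in> pairs t then 1 else 0)"
    using U(1) by (intro sum.cong refl) (simp add: sum.If_cases Int_def)
  also have "\<dots> = (\<Sum>t\<in>U. \<Sum>e\<in>F. if e \<in> pairs t then 1 else 0)" by (rule sum.swap)
  also have "\<dots> = (\<Sum>t\<in>U. card (pairs t \<inter> Q))"
  proof (intro sum.cong refl)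
    fix t assume t: "t \<in> U"
    have "(\<Sum>e\<in>F. if e \<in> pairs t then 1 else 0) = card {e \<in> F. e \<in> pairs t}"
      using finF by (simp add: sum.If_cases Int_def)
    also have "{e \<in> F. e \<in> pairs t} = pairs t \<inter> Q" using t by (auto simp: F_def)
    finally show "(\<Sum>e\<in>F. if e \<in> pairs t then 1 else 0) = card (pairs t \<inter> Q)" .
  qed
  finally show False using dvd_sum[of U 2 "\<lambda>t. card (pairs t \<inter> Q)"] ev by blast
qed

text \<open>A combinatorial Besicovitch inequality: if a closed walk consists of four arcs, and two
  1-Lipschitz functions separate the two pairs of opposite arcs by \<open>D\<close>, then for every
  \<open>(r, s) \<in> {0..<D}\<^sup>2\<close> a filling contains a triangle that determines \<open>(r, s)\<close>.\<close>

lemma rectangle_inequality: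
  assumes U: "finite U" "\<And>t. t \<in> U \<Longrightarrow> card t = 3 \<and> pairs t \<subseteq> E"
    and w: "walk E u0 a1 u1" "walk E u1 a2 u2" "walk E u2 a3 u3" "walk E u3 a4 u0"
    and f: "fills U (wedges u0 a1 + wedges u1 a2 + wedges u2 a3 + wedges u3 a4)"
    and lh: "\<And>x y. {x, y} \<in> E \<Longrightarrow> h x \<le> Suc (h y)"
    and lg: "\<And>x y. {x, y} \<in> E \<Longrightarrow> g x \<le> Suc (g y)"
    and h0: "\<And>x. x \<in> set (u0 # a1) \<Longrightarrow> h x = 0" and hD: "\<And>x. x \<in> set (u2 # a3) \<Longrightarrow> h x = D"
    and g0: "\<And>x. x \<in> set (u1 # a2) \<Longrightarrow> g x = 0" and gD: "\<And>x. x \<in> set (u3 # a4) \<Longrightarrow> g x = D"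
  shows "D * D \<le> card U"
proof -
  have end_mem: "v \<in> set (u # xs)" if "walk E u xs v" for u xs v
    using that by (induction xs arbitrary: u) auto
  have ex: "\<exists>t\<in>U. crosses h g t r s" if rs: "r < D" "s < D" for r s
  proof -
    let ?Q = "crossing h g r s"
    let ?c = "\<lambda>M. size (filter_mset (\<lambda>e. e \<in> ?Q) M)"
    have none: "?c (wedges u xs) = 0"
      if H: "\<And>x y. x \<in> set (u # xs) \<Longrightarrow> y \<in> set (u # xs) \<Longrightarrow> {x, y} \<notin> ?Q" for u xs
    proof -
      have "filter_mset (\<lambda>e. e \<in> ?Q) (wedges u xs) = {#}"
      proof (rule multiset_eqI)
        fix e
        have "e \<notin> ?Q" if "e \<in># wedges u xs" using wedges_verts[OF that] H by auto
        then show "count (filter_mset (\<lambda>e. e \<in> ?Q) (wedges u xs)) e = count {#} e"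
          by (cases "e \<in># wedges u xs") (auto simp: not_in_iff)
      qed
      then show ?thesis by simp
    qed
    have "?c (wedges u0 a1) = 0" by (rule none) (auto simp: h0 crossing_doubleton)
    moreover have "?c (wedges u2 a3) = 0"
      using rs by (intro none) (auto simp: hD crossing_doubleton)
    moreover have "?c (wedges u3 a4) = 0"
      using rs by (intro none) (auto simp: gD crossing_doubleton)
    moreover have "odd (?c (wedges u1 a2))"
    proof -
      have "h u1 = 0" using h0 end_mem[OF w(1)] by blast
      moreover have "h u2 = D" using hD by simp
      moreover have "odd (?c (wedges u1 a2)) \<longleftrightarrow> ((h u1 \<le> r) \<noteq> (h u2 \<le> r))"
        by (rule crossing_walk_parity[OF w(2) _ lh]) (auto simp: g0)
      ultimately show ?thesis using rs by simp
    qed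
    moreover have "?c (wedges u0 a1 + wedges u1 a2 + wedges u2 a3 + wedges u3 a4)
        = ?c (wedges u0 a1) + ?c (wedges u1 a2) + ?c (wedges u2 a3) + ?c (wedges u3 a4)"
      by (simp only: filter_union_mset size_union)
    ultimately have "odd (?c (wedges u0 a1 + wedges u1 a2 + wedges u2 a3 + wedges u3 a4))" by presburger
    then obtain t where "t \<in> U" "odd (card (pairs t \<inter> ?Q))"
      using odd_filling_crossing[OF U(1) _ f] U(2) by blast
    then show ?thesis using odd_crossing_triangle[of t E h g r s] U(2) lh lg by blast
  qed
  define c where "c = (\<lambda>(r, s). SOME t. t \<in> U \<and> crosses h g t r s)"
  have c: "c (r, s) \<in> U \<and> crosses h g (c (r, s)) r s" if "r < D" "s < D" for r s
  proof -
    have "\<exists>t. t \<in> U \<and> crosses h g t r s" using ex[OF that] by blast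
    from someI_ex[OF this] show ?thesis by (simp add: c_def)
  qed
  have "inj_on c ({..<D} \<times> {..<D})"
  proof (rule inj_onI)
    fix a b assume "a \<in> {..<D} \<times> {..<D}" "b \<in> {..<D} \<times> {..<D}" "c a = c b"
    then show "a = b" using c[of "fst a" "snd a"] c[of "fst b" "snd b"]
      crosses_unique[of h g "c a" "fst a" "snd a" "fst b" "snd b"] by (cases a; cases b) auto
  qed
  moreover have "c ` ({..<D} \<times> {..<D}) \<subseteq> U" using c by auto
  ultimately have "card ({..<D} \<times> {..<D}) \<le> card U" using U(1) by (metis card_inj_on_le)
  then show ?thesis by (simp add: card_cartesian_product)
qed

section \<open>Cutting closed walks\<close>

definition near :: "'a set set \<Rightarrow> 'a set \<Rightarrow> nat \<Rightarrow> 'a set" where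
  "near E A k = {y. \<exists>x\<in>A. \<exists>xs. walk E x xs y \<and> length xs \<le> k}"

text \<open>The cap makes the distance function constant on everything that is at least \<open>D\<close> away from \<open>A\<close>, as
  the rectangle inequality demands of the opposite arc.\<close>
definition capped_dist :: "'a set set \<Rightarrow> 'a set \<Rightarrow> nat \<Rightarrow> 'a \<Rightarrow> nat" where
  "capped_dist E A D x = (LEAST k. k = D \<or> x \<in> near E A k)"

lemma capped_dist_cases: "capped_dist E A D x = D \<or> x \<in> near E A (capped_dist E A D x)"
  unfolding capped_dist_def by (rule LeastI[of _ D]) simp

lemma capped_dist_le: "k = D \<or> x \<in> near E A k \<Longrightarrow> capped_dist E A D x \<le> k"
  unfolding capped_dist_def by (rule Least_le)

lemma capped_dist_0: "x \<in> A \<Longrightarrow> capped_dist E A D x = 0"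
proof -
  assume "x \<in> A"
  then have "x \<in> near E A 0" unfolding near_def by auto
  then show ?thesis using capped_dist_le[of 0 D x E A] by simp
qed

lemma capped_dist_Lipschitz:
  assumes "{x, y} \<in> E"
  shows "capped_dist E A D x \<le> Suc (capped_dist E A D y)"
proof (cases "capped_dist E A D y = D")
  case True
  have "capped_dist E A D x \<le> D" by (rule capped_dist_le) simp
  then show ?thesis using True by simp
next
  case False
  then obtain a xs where a: "a \<in> A" "walk E a xs y" "length xs \<le> capped_dist E A D y"
    using capped_dist_cases[of E A D y] by (auto simp: near_def)
  have "walk E a (xs @ [x]) x" using a(2) assms by (auto simp: walk_append insert_commute)
  then have "x \<in> near E A (Suc (capped_dist E A D y))"
    unfolding near_def using a by (auto intro!: bexI[of _ a] exI[of _ "xs @ [x]"])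
  then show ?thesis by (intro capped_dist_le) simp
qed

lemma capped_dist_far:
  assumes "\<And>x xs. x \<in> A \<Longrightarrow> walk E x xs y \<Longrightarrow> D \<le> length xs"
  shows "capped_dist E A D y = D"
proof (rule ccontr)
  assume n: "capped_dist E A D y \<noteq> D"
  then obtain a xs where "a \<in> A" "walk E a xs y" "length xs \<le> capped_dist E A D y"
    using capped_dist_cases[of E A D y] by (auto simp: near_def)
  moreover have "capped_dist E A D y \<le> D" by (rule capped_dist_le) simp
  ultimately show False using assms[of a xs] n by simp
qed

lemma opposite_arcs_close:
  assumes U: "finite U" "\<And>t. t \<in> U \<Longrightarrow> card t = 3 \<and> pairs t \<subseteq> E" "card U < D * D"
    and w: "walk E u0 a1 u1" "walk E u1 a2 u2" "walk E u2 a3 u3" "walk E u3 a4 u0"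
    and f: "fills U (wedges u0 a1 + wedges u1 a2 + wedges u2 a3 + wedges u3 a4)"
  shows "(\<exists>x\<in>set (u0 # a1). \<exists>y\<in>set (u2 # a3). \<exists>xs. walk E x xs y \<and> length xs < D) \<or>
         (\<exists>x\<in>set (u1 # a2). \<exists>y\<in>set (u3 # a4). \<exists>xs. walk E x xs y \<and> length xs < D)"
proof (rule ccontr)
  assume n: "\<not> ?thesis"
  let ?h = "capped_dist E (set (u0 # a1)) D" and ?g = "capped_dist E (set (u1 # a2)) D"
  have "D * D \<le> card U"
  proof (rule rectangle_inequality[OF U(1,2) w f])
    fix x y assume e: "{x, y} \<in> E"
    show "?h x \<le> Suc (?h y)" by (rule capped_dist_Lipschitz[OF e])
    show "?g x \<le> Suc (?g y)" by (rule capped_dist_Lipschitz[OF e])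
  next
    fix x assume x: "x \<in> set (u0 # a1)" show "?h x = 0" by (rule capped_dist_0[OF x])
  next
    fix x assume x: "x \<in> set (u1 # a2)" show "?g x = 0" by (rule capped_dist_0[OF x])
  next
    fix y assume y: "y \<in> set (u2 # a3)"
    show "?h y = D" by (rule capped_dist_far) (use n y in \<open>meson not_le_imp_less\<close>)
  next
    fix y assume y: "y \<in> set (u3 # a4)"
    show "?g y = D" by (rule capped_dist_far) (use n y in \<open>meson not_le_imp_less\<close>)
  qed auto
  then show False using U(3) by simp
qed

text \<open>The two closed walks traverse the shortcut once in each direction, so it cancels modulo 2.\<close>
lemma cut_along_shortcut:
  assumes w: "walk E u0 a1 u1" "walk E u1 a2 u2" "walk E u2 a3 u3" "walk E u3 a4 u0"
    and x: "x \<in> set (u0 # a1)" and y: "y \<in> set (u2 # a3)" and p: "walk E x p y"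
  shows "\<exists>L1 L2. walk E x L1 x \<and> walk E x L2 x \<and>
      length L1 + length L2 = length a1 + length a2 + length a3 + length a4 + 2 * length p \<and>
      length L1 \<ge> length a2 + length p \<and> length L2 \<ge> length a4 + length p \<and>
      (\<forall>e. odd (count (wedges x L1 + wedges x L2) e) \<longleftrightarrow>
           odd (count (wedges u0 a1 + wedges u1 a2 + wedges u2 a3 + wedges u3 a4) e))"
proof -
  obtain b c where a1: "a1 = b @ c" "walk E u0 b x" "walk E x c u1" using walk_split[OF w(1) x] by blast
  obtain d f where a3: "a3 = d @ f" "walk E u2 d y" "walk E y f u3" using walk_split[OF w(3) y] by blast
  obtain q where q: "walk E y q x" "wedges y q = wedges x p" "length q = length p" using walk_rev[OF p] by blast
  define L1 where "L1 = c @ a2 @ d @ q"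
  define L2 where "L2 = p @ f @ a4 @ b"
  have m1: "wedges x L1 = wedges x c + wedges u1 a2 + wedges u2 d + wedges y q" unfolding L1_def
    by (simp add: wedges_append[OF a1(3)] wedges_append[OF w(2)] wedges_append[OF a3(2)])
  have m2: "wedges x L2 = wedges x p + wedges y f + wedges u3 a4 + wedges u0 b" unfolding L2_def
    by (simp add: wedges_append[OF p] wedges_append[OF a3(3)] wedges_append[OF w(4)])
  have m: "wedges u0 a1 = wedges u0 b + wedges x c" "wedges u2 a3 = wedges u2 d + wedges y f"
    using wedges_append[OF a1(2), of c] wedges_append[OF a3(2), of f] a1(1) a3(1) by simp_all
  have "walk E x L1 x" unfolding L1_def by (intro walk_join[OF a1(3)] walk_join[OF w(2)] walk_join[OF a3(2)] q(1))
  moreover have "walk E x L2 x" unfolding L2_def by (intro walk_join[OF p] walk_join[OF a3(3)] walk_join[OF w(4)] a1(2))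
  moreover have "length L1 + length L2 = length a1 + length a2 + length a3 + length a4 + 2 * length p"
    by (simp add: L1_def L2_def a1 a3 q(3))
  moreover have "length L1 \<ge> length a2 + length p" "length L2 \<ge> length a4 + length p"
    by (simp_all add: L1_def L2_def q(3))
  moreover have "odd (count (wedges x L1 + wedges x L2) e) \<longleftrightarrow>
           odd (count (wedges u0 a1 + wedges u1 a2 + wedges u2 a3 + wedges u3 a4) e)" for e
    unfolding m1 m2 m q(2) count_union by presburger
  ultimately show ?thesis by blast
qed

text \<open>If a closed walk has a filling with fewer than \<open>D\<^sup>2\<close> triangles, then a path of length less
  than \<open>D\<close> cuts it into two closed walks, each of length at least about a quarter.\<close>
lemma balanced_cut:
  assumes U: "finite U" "\<And>t. t \<in> U \<Longrightarrow> card t = 3 \<and> pairs t \<subseteq> E" "card U < D * D"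
    and w: "walk E u xs u" and f: "fills U (wedges u xs)"
  shows "\<exists>x d L1 L2. walk E x L1 x \<and> walk E x L2 x \<and> d < D \<and>
      length L1 + length L2 = length xs + 2 * d \<and>
      length L1 \<ge> length xs div 4 + d \<and> length L2 \<ge> length xs div 4 + d \<and>
      (\<forall>e. odd (count (wedges x L1 + wedges x L2) e) \<longleftrightarrow> odd (count (wedges u xs) e))"
proof -
  define m where "m = length xs div 4"
  have m4: "4 * m \<le> length xs" by (simp add: m_def)
  define a1 a2 a3 a4 where "a1 = take m xs" and "a2 = take m (drop m xs)" and "a3 = take m (drop (2 * m) xs)"
    and "a4 = drop (3 * m) xs"
  have xs: "xs = a1 @ a2 @ a3 @ a4"
  proof -
    have "xs = take m xs @ drop m xs" by simp
    also have "drop m xs = take m (drop m xs) @ drop (2 * m) xs"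
      using append_take_drop_id[of m "drop m xs"] by (simp add: mult_2)
    also have "drop (2 * m) xs = take m (drop (2 * m) xs) @ drop (3 * m) xs"
      using append_take_drop_id[of m "drop (2 * m) xs"] by (simp add: algebra_simps)
    finally show ?thesis by (simp add: a1_def a2_def a3_def a4_def)
  qed
  have len: "length a1 = m" "length a2 = m" "length a3 = m" "length a4 \<ge> m"
    using m4 by (auto simp: a1_def a2_def a3_def a4_def)
  obtain u1 u2 u3 where W: "walk E u a1 u1" "walk E u1 a2 u2" "walk E u2 a3 u3" "walk E u3 a4 u"
    using w unfolding xs walk_append by blast
  have M: "wedges u xs = wedges u a1 + wedges u1 a2 + wedges u2 a3 + wedges u3 a4"
    unfolding xs by (simp add: wedges_append[OF W(1)] wedges_append[OF W(2)] wedges_append[OF W(3)])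
  from opposite_arcs_close[OF U W f[unfolded M]] show ?thesis
  proof
    assume "\<exists>x\<in>set (u # a1). \<exists>y\<in>set (u2 # a3). \<exists>p. walk E x p y \<and> length p < D"
    then obtain x y p where p: "x \<in> set (u # a1)" "y \<in> set (u2 # a3)" "walk E x p y" "length p < D" by blast
    from cut_along_shortcut[OF W p(1-3)] obtain L1 L2 where L: "walk E x L1 x" "walk E x L2 x"
      "length L1 + length L2 = length a1 + length a2 + length a3 + length a4 + 2 * length p"
      "length L1 \<ge> length a2 + length p" "length L2 \<ge> length a4 + length p"
      "\<forall>e. odd (count (wedges x L1 + wedges x L2) e) \<longleftrightarrow> odd (count (wedges u xs) e)"
      unfolding M by blast
    have "length L1 + length L2 = length xs + 2 * length p" using L(3) by (simp add: xs)
    then show ?thesis using L p(4) len unfolding m_def[symmetric]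
      by (intro exI[of _ x] exI[of _ "length p"] exI[of _ L1] exI[of _ L2]) auto
  next
    assume "\<exists>x\<in>set (u1 # a2). \<exists>y\<in>set (u3 # a4). \<exists>p. walk E x p y \<and> length p < D"
    then obtain x y p where p: "x \<in> set (u1 # a2)" "y \<in> set (u3 # a4)" "walk E x p y" "length p < D" by blast
    from cut_along_shortcut[OF W(2,3,4,1) p(1-3)] obtain L1 L2 where L: "walk E x L1 x" "walk E x L2 x"
      "length L1 + length L2 = length a2 + length a3 + length a4 + length a1 + 2 * length p"
      "length L1 \<ge> length a3 + length p" "length L2 \<ge> length a1 + length p"
      "\<forall>e. odd (count (wedges x L1 + wedges x L2) e) \<longleftrightarrow> odd (count (wedges u xs) e)"
      unfolding M by (auto simp: ac_simps)
    have "length L1 + length L2 = length xs + 2 * length p" using L(3) by (simp add: xs)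
    then show ?thesis using L p(4) len unfolding m_def[symmetric]
      by (intro exI[of _ x] exI[of _ "length p"] exI[of _ L1] exI[of _ L2]) auto
  qed
qed

section \<open>The triangles of a bootstrap process\<close>

text \<open>One triangle is recorded for each step, because the argument concerns the 2-complex that these
  triangles form.\<close>

inductive built :: "'a set set \<Rightarrow> 'a set set \<Rightarrow> 'a set set \<Rightarrow> bool" for T where
  start: "built T T {}"
| add: "built T E S \<Longrightarrow> distinct [x, y, z] \<Longrightarrow> {x, y} \<notin> E \<Longrightarrow> {y, z} \<in> E \<Longrightarrow> {x, z} \<in> E \<Longrightarrow>
    built T (insert {x, y} E) (insert {x, y, z} S)"

lemma bootstrap_built:
  assumes "bootstrap_step\<^sup>*\<^sup>* H G"
  shows "\<exists>S. built (edges H) (edges G) S"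
  using assms
proof (induction rule: rtranclp_induct)
  case base
  show ?case using built.start by blast
next
  case (step G G')
  then obtain S where S: "built (edges H) (edges G) S" by blast
  obtain x y z where "distinct [x, y, z]" "{x, y} \<notin> edges G" "edges G' = insert {x, y} (edges G)"
    "{y, z} \<in> edges G" "{x, z} \<in> edges G" using step.hyps(2) by (rule bootstrap_step_E)
  then have "built (edges H) (edges G') (insert {x, y, z} S)" using built.add[OF S] by simp
  then show ?case by blast
qed

definition spanned :: "'a set set \<Rightarrow> 'a set set" where
  "spanned U = (\<Union>t\<in>U. pairs t)"

lemma spanned_simps [simp]: "spanned {} = {}" "spanned (insert t U) = pairs t \<union> spanned U"
  by (auto simp: spanned_def)

lemma spanned_mono: "U \<subseteq> U' \<Longrightarrow> spanned U \<subseteq> spanned U'"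
  by (auto simp: spanned_def)

lemma built_triangles:
  assumes "built T E S"
  shows "finite S" "\<And>t. t \<in> S \<Longrightarrow> card t = 3" "spanned S \<subseteq> E" "T \<subseteq> E" "finite T \<Longrightarrow> card S + card T = card E"
proof -
  have "finite S \<and> (\<forall>t\<in>S. card t = 3) \<and> spanned S \<subseteq> E \<and> T \<subseteq> E \<and>
     (finite T \<longrightarrow> finite E \<and> card S + card T = card E)"
    using assms
  proof (induction rule: built.induct)
    case (add E S x y z)
    have p: "pairs {x, y, z} = {{x, y}, {y, z}, {x, z}}" by (rule pairs_triangle[OF add.hyps(2)])
    have "{x, y, z} \<notin> S"
    proof
      assume "{x, y, z} \<in> S"
      then have "pairs {x, y, z} \<subseteq> E" using add.IH unfolding spanned_def by blast
      then show False using add.hyps(3) p by simp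
    qed
    then show ?case using add p by auto
  qed auto
  then show "finite S" "\<And>t. t \<in> S \<Longrightarrow> card t = 3" "spanned S \<subseteq> E" "T \<subseteq> E"
    "finite T \<Longrightarrow> card S + card T = card E" by blast+
qed

lemma finite_triangle: "card t = 3 \<Longrightarrow> finite t"
  by (metis card.infinite zero_neq_numeral)

lemma finite_spanned: "finite U \<Longrightarrow> (\<And>t. t \<in> U \<Longrightarrow> card t = 3) \<Longrightarrow> finite (spanned U)"
  unfolding spanned_def by (simp add: finite_pairs finite_triangle)

lemma boundary_subset_spanned: "boundary U \<subseteq> spanned U"
proof
  fix e assume "e \<in> boundary U"
  then have "odd (card {t \<in> U. e \<in> pairs t})" by (simp add: boundary_def)
  then have "{t \<in> U. e \<in> pairs t} \<noteq> {}" by (cases "{t \<in> U. e \<in> pairs t} = {}") simp_all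
  then show "e \<in> spanned U" by (auto simp: spanned_def)
qed

text \<open>The edge added together with the last triangle of a subfamily lies in no other triangle of it.\<close>
lemma built_boundary_nonempty:
  assumes "built T E S" "U \<subseteq> S" "U \<noteq> {}"
  shows "boundary U \<noteq> {}"
  using assms
proof (induction arbitrary: U rule: built.induct)
  case (add E S x y z)
  show ?case
  proof (cases "{x, y, z} \<in> U")
    case True
    have "{t \<in> U. {x, y} \<in> pairs t} = {{x, y, z}}"
    proof -
      have "{x, y} \<notin> pairs t" if "t \<in> S" for t
        using built_triangles(3)[OF add.hyps(1)] that add.hyps(3) unfolding spanned_def by blast
      then show ?thesis using True add.prems add.hyps(2) by auto
    qed
    then have "{x, y} \<in> boundary U" by (simp add: boundary_def)
    then show ?thesis by blast
  qed (use add in auto)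
qed auto

text \<open>The triangles can be collapsed in the reverse order of the steps: each gives up the edge that came
  with it, whose ends stay joined through its other two sides. The edges that remain at the end
  form \<open>J\<close>.\<close>
lemma built_spanning_edges:
  assumes "built T E S" "U \<subseteq> S"
  shows "\<exists>J\<subseteq>spanned U. card J + card U = card (spanned U) \<and> (\<forall>u v. {u, v} \<in> spanned U \<longrightarrow> conn J u v)"
  using assms
proof (induction arbitrary: U rule: built.induct)
  case start
  then show ?case by auto
next
  case (add E S x y z)
  show ?case
  proof (cases "{x, y, z} \<in> U")
    case False
    then show ?thesis using add by auto
  next
    case True
    define U0 where "U0 = U - {{x, y, z}}"
    have U0: "U0 \<subseteq> S" "U = insert {x, y, z} U0" "{x, y, z} \<notin> U0"
      using add.prems True by (auto simp: U0_def)
    note bt = built_triangles[OF add.hyps(1)]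
    obtain J where J: "J \<subseteq> spanned U0" "card J + card U0 = card (spanned U0)"
      "\<And>u v. {u, v} \<in> spanned U0 \<Longrightarrow> conn J u v" using add.IH[OF U0(1)] by blast
    have p: "pairs {x, y, z} = {{x, y}, {y, z}, {x, z}}" by (rule pairs_triangle[OF add.hyps(2)])
    have sub: "spanned U0 \<subseteq> E" using spanned_mono[OF U0(1)] bt(3) by blast
    have fU: "finite U0" using U0(1) bt(1) finite_subset by blast
    have fin: "finite (spanned U0)" using fU U0(1) bt(2) by (intro finite_spanned) auto
    define N where "N = {{y, z}, {x, z}} - spanned U0"
    define J' where "J' = J \<union> N"
    have sp: "spanned U = insert {x, y} (N \<union> spanned U0)" unfolding U0(2) N_def by (auto simp: p)
    have xy: "{x, y} \<notin> N \<union> spanned U0" using sub add.hyps(3-5) by (auto simp: N_def)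
    have fN: "finite N" by (simp add: N_def)
    have "card (spanned U) = 1 + (card N + card (spanned U0))"
    proof -
      have "card (N \<union> spanned U0) = card N + card (spanned U0)"
        by (intro card_Un_disjoint fN fin) (auto simp: N_def)
      then show ?thesis unfolding sp using xy fin fN by simp
    qed
    moreover have "card J' = card J + card N"
      unfolding J'_def using J(1) fin fN by (intro card_Un_disjoint) (auto simp: N_def intro: finite_subset)
    moreover have "card U = card U0 + 1" unfolding U0(2) using U0(3) fU by simp
    ultimately have "card J' + card U = card (spanned U)" using J(2) by simp
    moreover have "J' \<subseteq> spanned U" unfolding sp J'_def using J(1) by auto
    moreover have "conn J' u v" if uv: "{u, v} \<in> spanned U" for u v
    proof -
      have old: "conn J' a b" if "{a, b} \<in> spanned U0" for a b
        using J(3)[OF that] by (rule conn_mono) (simp add: J'_def)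
      have new: "conn J' a b" if "{a, b} \<in> {{y, z}, {x, z}}" for a b
        using that old[of a b] conn_edge[of a b J'] by (auto simp: J'_def N_def)
      have "conn J' x z" "conn J' z y" using new[of x z] new[of y z] conn_sym by auto
      then have "conn J' x y" by (rule conn_trans)
      then have "conn J' a b" if "{a, b} = {x, y}" for a b
        using that conn_sym[of J' x y] by (auto simp: doubleton_eq_iff)
      then show ?thesis using uv old[of u v] new[of u v] unfolding sp N_def by blast
    qed
    ultimately show ?thesis by blast
  qed
qed

text \<open>Double counting the edge-triangle incidences: an edge off the boundary lies in at least two
  triangles.\<close>
lemma incidence_count:
  assumes "finite U" "\<And>t. t \<in> U \<Longrightarrow> card t = 3"
  shows "2 * card (spanned U) \<le> 3 * card U + card (boundary U)"
proof -
  let ?d = "\<lambda>e. card {t \<in> U. e \<in> pairs t}"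
  have fin: "finite (spanned U)" using assms by (rule finite_spanned)
  have c3: "card (pairs t) = 3" if "t \<in> U" for t
    using card_pairs[OF finite_triangle[OF assms(2)[OF that]]] assms(2)[OF that]
    by (simp add: numeral_3_eq_3 binomial_Suc_Suc numeral_2_eq_2)
  have "(\<Sum>e\<in>spanned U. ?d e) = (\<Sum>e\<in>spanned U. \<Sum>t\<in>U. if e \<in> pairs t then 1 else 0)"
    using assms(1) by (intro sum.cong refl) (simp add: sum.If_cases Int_def)
  also have "\<dots> = (\<Sum>t\<in>U. \<Sum>e\<in>spanned U. if e \<in> pairs t then 1 else 0)" by (rule sum.swap)
  also have "\<dots> = (\<Sum>t\<in>U. 3)"
  proof (intro sum.cong refl)
    fix t assume t: "t \<in> U"
    have "(\<Sum>e\<in>spanned U. if e \<in> pairs t then 1 else 0) = card {e \<in> spanned U. e \<in> pairs t}"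
      using fin by (simp add: sum.If_cases Int_def)
    also have "{e \<in> spanned U. e \<in> pairs t} = pairs t" using t by (auto simp: spanned_def)
    finally show "(\<Sum>e\<in>spanned U. if e \<in> pairs t then 1 else 0) = (3::nat)" using c3[OF t] by simp
  qed
  finally have s: "(\<Sum>e\<in>spanned U. ?d e) = 3 * card U" by simp
  have "2 * card (spanned U) = (\<Sum>e\<in>spanned U. 2)" by simp
  also have "\<dots> \<le> (\<Sum>e\<in>spanned U. ?d e + (if e \<in> boundary U then 1 else 0))"
  proof (rule sum_mono)
    fix e assume "e \<in> spanned U"
    then have "{t \<in> U. e \<in> pairs t} \<noteq> {}" by (auto simp: spanned_def)
    then have "?d e \<noteq> 0" using assms(1) by simp
    moreover have "?d e \<noteq> 1" if "e \<notin> boundary U" using that by (auto simp: boundary_def)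
    ultimately show "2 \<le> ?d e + (if e \<in> boundary U then 1 else 0)" by (auto simp: le_Suc_eq)
  qed
  also have "\<dots> = 3 * card U + card (spanned U \<inter> boundary U)"
    using s fin by (simp add: sum.distrib sum.If_cases Int_def)
  also have "spanned U \<inter> boundary U = boundary U" using boundary_subset_spanned by blast
  finally show ?thesis .
qed

text \<open>An Euler-characteristic estimate. The set \<open>X\<close> represents the components of the complex spanned by
  \<open>U\<close>. The triangles of one component form a nonempty family of their own, so each component carries
  part of the boundary, and \<open>|X|\<close> is at most the size of the boundary.\<close>
lemma euler_estimate:
  assumes b: "built T E S" "U \<subseteq> S"
  obtains J X where "X \<subseteq> \<Union>U" "\<And>u v. {u, v} \<in> spanned U \<Longrightarrow> conn J u v"
    "\<And>x y. x \<in> X \<Longrightarrow> y \<in> X \<Longrightarrow> conn J x y \<Longrightarrow> x = y"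
    "\<And>x. x \<in> X \<Longrightarrow> \<exists>e\<in>boundary U. \<exists>v\<in>e. conn J x v"
    "3 * card (\<Union>U) \<le> card (spanned U) + 3 * card X + card (boundary U)"
    "card X \<le> card (boundary U)"
proof -
  note bt = built_triangles[OF b(1)]
  have fU: "finite U" using b(2) bt(1) finite_subset by blast
  have c3: "card t = 3" if "t \<in> U" for t using that b(2) bt(2) by blast
  have fin: "finite (spanned U)" using fU c3 by (rule finite_spanned)
  have fW: "finite (\<Union>U)" using fU c3 finite_triangle by blast
  obtain J where J: "J \<subseteq> spanned U" "card J + card U = card (spanned U)"
      "\<And>u v. {u, v} \<in> spanned U \<Longrightarrow> conn J u v" using built_spanning_edges[OF b] by blast
  have "finite J" using J(1) fin finite_subset by blast
  moreover have "J \<subseteq> pairs UNIV" using J(1) by (auto simp: spanned_def pairs_def)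
  ultimately obtain X where X: "X \<subseteq> \<Union>U" "\<forall>x\<in>X. \<forall>y\<in>X. conn J x y \<longrightarrow> x = y" "card (\<Union>U) \<le> card J + card X"
    using separated_vertices[of J "\<Union>U"] fW by blast
  have inside: "conn J a c" if "t \<in> U" "a \<in> t" "c \<in> t" for t a c
  proof (cases "a = c")
    case False
    then have "{a, c} \<in> spanned U" using that by (auto simp: spanned_def)
    then show ?thesis by (rule J(3))
  qed auto
  have bd: "\<exists>e\<in>boundary U. \<exists>v\<in>e. conn J x v" if x: "x \<in> X" for x
  proof -
    define Ux where "Ux = {t \<in> U. \<exists>v\<in>t. conn J x v}"
    obtain t0 where "t0 \<in> U" "x \<in> t0" using x X(1) by blast
    then have "t0 \<in> Ux" unfolding Ux_def by (auto intro: bexI[of _ x])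
    then have "Ux \<noteq> {}" by blast
    moreover have "Ux \<subseteq> S" using b(2) by (auto simp: Ux_def)
    ultimately obtain e where e: "e \<in> boundary Ux" using built_boundary_nonempty[OF b(1)] by blast
    then obtain t where t: "t \<in> Ux" "e \<in> pairs t" using boundary_subset_spanned by (auto simp: spanned_def)
    obtain v where v: "v \<in> e" using t(2) by (auto elim: pairs_E)
    have vt: "v \<in> t" using v t(2) by (auto simp: pairs_def)
    obtain w where w: "w \<in> t" "conn J x w" using t(1) by (auto simp: Ux_def)
    have xv: "conn J x v" using conn_trans[OF w(2) inside[of t w v]] t(1) w(1) vt by (auto simp: Ux_def)
    have "{t \<in> Ux. e \<in> pairs t} = {t \<in> U. e \<in> pairs t}"
      using v xv by (auto simp: Ux_def pairs_def)
    then have "e \<in> boundary U" using e by (simp add: boundary_def)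
    then show ?thesis using v xv by blast
  qed
  have "\<exists>f. \<forall>x\<in>X. f x \<in> boundary U \<and> (\<exists>v\<in>f x. conn J x v)"
    using bd by (intro bchoice) blast
  then obtain f where f: "\<And>x. x \<in> X \<Longrightarrow> f x \<in> boundary U" "\<And>x. x \<in> X \<Longrightarrow> \<exists>v\<in>f x. conn J x v" by blast
  have "inj_on f X"
  proof (rule inj_onI)
    fix x y assume xy: "x \<in> X" "y \<in> X" "f x = f y"
    obtain v where v: "v \<in> f x" "conn J x v" using f(2)[OF xy(1)] by blast
    obtain w where w: "w \<in> f x" "conn J y w" using f(2)[OF xy(2)] xy(3) by auto
    obtain t where t: "t \<in> U" "f x \<in> pairs t"
      using f(1)[OF xy(1)] boundary_subset_spanned by (auto simp: spanned_def)
    then have "conn J v w" using inside[of t v w] v w by (auto simp: pairs_def)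
    then have "conn J x y" using v w by (metis conn_sym conn_trans)
    then show "x = y" using X(2) xy by blast
  qed
  moreover have "f ` X \<subseteq> boundary U" using f(1) by blast
  moreover have fb: "finite (boundary U)" using boundary_subset_spanned fin finite_subset by blast
  ultimately have cX: "card X \<le> card (boundary U)" by (metis card_inj_on_le)
  have "2 * card (spanned U) \<le> 3 * card U + card (boundary U)" using fU c3 by (rule incidence_count)
  then have "3 * card (\<Union>U) \<le> card (spanned U) + 3 * card X + card (boundary U)"
    using J(2) X(3) by linarith
  show thesis
  proof (rule that[OF X(1) J(3)])
    show "x = y" if "x \<in> X" "y \<in> X" "conn J x y" for x y using X(2) that by blast
    show "3 * card (\<Union>U) \<le> card (spanned U) + 3 * card X + card (boundary U)" by fact
  qed (assumption | erule bd | rule cX)+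
qed

definition locally_sparse :: "real \<Rightarrow> nat \<Rightarrow> 'a set set \<Rightarrow> bool" where
  "locally_sparse \<delta> L E \<longleftrightarrow> (\<forall>W. finite W \<and> W \<noteq> {} \<and> card W \<le> L \<longrightarrow>
     real (card (E \<inter> pairs W)) \<le> (3 - \<delta>) * real (card W))"

lemma card_Union_triangles:
  assumes "finite U" "\<And>t. t \<in> U \<Longrightarrow> card t = 3"
  shows "card (\<Union>U) \<le> 3 * card U"
proof -
  have "card (\<Union>U) \<le> sum card U" by (rule card_Union_le_sum_card)
  also have "\<dots> = 3 * card U" using assms by simp
  finally show ?thesis .
qed

text \<open>With \<open>v\<close> vertices, \<open>e\<close> edges and \<open>b\<close> boundary edges, the Euler estimate gives \<open>3 v \<le> e + 4 b\<close> and
  sparsity gives \<open>e \<le> (3 - \<delta>) v\<close>, whence \<open>\<delta> v \<le> 4 b\<close>; and there are at most \<open>e \<le> 3 v\<close> triangles.\<close>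
lemma small_families_expand:
  assumes b: "built T E S" "U \<subseteq> S" and sp: "locally_sparse \<delta> (3 * N) E" and d: "0 < \<delta>" "\<delta> < 3"
    and N: "card U \<le> N"
  shows "real (card U) \<le> 12 / \<delta> * real (card (boundary U))"
proof (cases "U = {}")
  case False
  note bt = built_triangles[OF b(1)]
  have fU: "finite U" using b(2) bt(1) finite_subset by blast
  have c3: "card t = 3" if "t \<in> U" for t using that b(2) bt(2) by blast
  have fin: "finite (spanned U)" using fU c3 by (rule finite_spanned)
  have fW: "finite (\<Union>U)" using fU c3 finite_triangle by blast
  have "\<exists>X :: 'a set. 3 * card (\<Union>U) \<le> card (spanned U) + 3 * card X + card (boundary U) \<and>
    card X \<le> card (boundary U)"
    by (rule euler_estimate[OF b]) (rule exI, rule conjI, assumption, assumption)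
  then obtain X :: "'a set" where X: "3 * card (\<Union>U) \<le> card (spanned U) + 3 * card X + card (boundary U)"
    "card X \<le> card (boundary U)" by blast
  have "card (\<Union>U) \<le> 3 * N" using card_Union_triangles[OF fU c3] N by linarith
  moreover have "\<Union>U \<noteq> {}" using False c3 by (metis Sup_upper all_not_in_conv card.empty subset_empty zero_neq_numeral)
  ultimately have s: "real (card (E \<inter> pairs (\<Union>U))) \<le> (3 - \<delta>) * real (card (\<Union>U))"
    using sp fW by (simp add: locally_sparse_def)
  have "spanned U \<subseteq> E \<inter> pairs (\<Union>U)"
    using spanned_mono[OF b(2)] bt(3) by (auto simp: spanned_def pairs_def)
  then have "card (spanned U) \<le> card (E \<inter> pairs (\<Union>U))"
    using fW by (intro card_mono) (auto intro: finite_pairs)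
  then have e: "real (card (spanned U)) \<le> (3 - \<delta>) * real (card (\<Union>U))" using s by linarith
  have "real (card (\<Union>U)) * \<delta> \<le> 4 * real (card (boundary U))"
    using e X by (simp add: algebra_simps)
  then have w: "real (card (\<Union>U)) \<le> 4 * real (card (boundary U)) / \<delta>"
    using d by (simp add: field_simps)
  obtain J' :: "'a set set" where "card J' + card U = card (spanned U)" using built_spanning_edges[OF b] by blast
  then have "real (card U) \<le> real (card (spanned U))" by linarith
  also have "\<dots> \<le> (3 - \<delta>) * real (card (\<Union>U))" by (rule e)
  also have "\<dots> \<le> 3 * real (card (\<Union>U))" using d by (intro mult_right_mono) auto
  finally have "real (card U) \<le> 3 * real (card (\<Union>U))" .
  also have "\<dots> \<le> 12 / \<delta> * real (card (boundary U))" using w by simp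
  finally show ?thesis .
qed (use d in simp)

section \<open>Linear isoperimetry is preserved along the process\<close>

definition linear_filling :: "real \<Rightarrow> 'a set set \<Rightarrow> 'a set set \<Rightarrow> bool" where
  "linear_filling c E S \<longleftrightarrow> (\<forall>u xs. walk E u xs u \<longrightarrow>
     (\<exists>U\<subseteq>S. fills U (wedges u xs) \<and> real (card U) \<le> c * real (length xs)))"

text \<open>A walk crosses the cut given by \<open>P\<close> only along \<open>e\<close>.\<close>
lemma bridge_parity:
  fixes P :: "'a \<Rightarrow> bool"
  assumes "walk E u xs v" "\<And>x y. {x, y} \<in> E \<Longrightarrow> {x, y} \<noteq> e \<Longrightarrow> P x = P y" "e = {a, b}" "P a \<noteq> P b"
  shows "odd (count (wedges u xs) e) \<longleftrightarrow> P u \<noteq> P v"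
  using assms(1)
proof (induction xs arbitrary: u)
  case (Cons x xs)
  then have IH: "odd (count (wedges x xs) e) \<longleftrightarrow> P x \<noteq> P v" by auto
  show ?case
  proof (cases "{u, x} = e")
    case True
    then have "P u \<noteq> P x" using assms(3,4) by (auto simp: doubleton_eq_iff)
    then show ?thesis using IH True by auto
  next
    case False
    then have "P u = P x" using assms(2)[of u x] Cons.prems by auto
    then show ?thesis using IH False by auto
  qed
qed auto

text \<open>A closed walk in a forest traverses each edge an even number of times, so the empty family fills it.\<close>
lemma linear_filling_tree:
  assumes "\<And>a b. {a, b} \<in> T \<Longrightarrow> \<not> conn (T - {{a, b}}) a b" "T \<subseteq> pairs V" "0 \<le> c"
  shows "linear_filling c T {}"
  unfolding linear_filling_def
proof (intro allI impI)
  fix u xs assume w: "walk T u xs u"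
  have "even (count (wedges u xs) e)" for e
  proof (cases "e \<in> T")
    case False
    then have "e \<notin># wedges u xs" using wedges_subset[OF w] by blast
    then show ?thesis by (simp add: not_in_iff)
  next
    case True
    then obtain a b where e: "e = {a, b}" using assms(2) by (meson pairs_E subsetD)
    define P where "P = (\<lambda>x. conn (T - {e}) a x)"
    have "P a" by (simp add: P_def)
    moreover have "\<not> P b" using assms(1)[of a b] True e by (simp add: P_def)
    moreover have "P x = P y" if "{x, y} \<in> T" "{x, y} \<noteq> e" for x y
    proof -
      have "{x, y} \<in> T - {e}" "{y, x} \<in> T - {e}" using that by (auto simp: insert_commute)
      then show ?thesis unfolding P_def by (metis conn_step)
    qed
    ultimately show ?thesis using bridge_parity[OF w, of e P a b] e by auto
  qed
  then have "fills {} (wedges u xs)" by (simp add: fills_def)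
  then show "\<exists>U\<subseteq>{}. fills U (wedges u xs) \<and> real (card U) \<le> c * real (length xs)"
    using assms(3) by auto
qed

text \<open>Each use of the new edge is replaced by the two other sides of the triangle. After \<open>k\<close> detours the
  chain has changed by \<open>k\<close> times the boundary of the triangle.\<close>
lemma detour_walk:
  assumes "walk (insert {x, y} E) u xs v" "distinct [x, y, z]" "{y, z} \<in> E" "{x, z} \<in> E"
  shows "\<exists>ys k. walk E u ys v \<and> length ys \<le> 2 * length xs \<and> k \<le> length xs \<and>
    (\<forall>e. odd (count (wedges u xs) e) \<longleftrightarrow> odd (count (wedges u ys) e + (if e \<in> pairs {x, y, z} then k else 0)))"
  using assms(1)
proof (induction xs arbitrary: u)
  case Nil
  then show ?case by (intro exI[of _ "[]"] exI[of _ 0]) auto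
next
  case (Cons a xs)
  then obtain ys k where ys: "walk E a ys v" "length ys \<le> 2 * length xs" "k \<le> length xs"
    "\<And>e. odd (count (wedges a xs) e) \<longleftrightarrow> odd (count (wedges a ys) e + (if e \<in> pairs {x, y, z} then k else 0))"
    by fastforce
  show ?case
  proof (cases "{u, a} \<in> E")
    case True
    then show ?thesis using ys by (intro exI[of _ "a # ys"] exI[of _ k]) auto
  next
    case False
    then have ua: "{u, a} = {x, y}" using Cons.prems by auto
    have uz: "{u, z} \<in> E" "{z, a} \<in> E" using ua assms(3,4) by (auto simp: doubleton_eq_iff insert_commute)
    have d: "distinct [u, a, z]" and t: "{u, a, z} = {x, y, z}" using ua assms(2) by (auto simp: doubleton_eq_iff)
    have p: "pairs {x, y, z} = {{u, a}, {a, z}, {u, z}}" using pairs_triangle[OF d] t by simp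
    have ne: "{u, a} \<noteq> {a, z}" "{u, a} \<noteq> {u, z}" "{a, z} \<noteq> {u, z}" using d by (auto simp: doubleton_eq_iff)
    have "odd (count (wedges u (a # xs)) e) \<longleftrightarrow>
        odd (count (wedges u (z # a # ys)) e + (if e \<in> pairs {x, y, z} then Suc k else 0))" for e
    proof -
      define A B where "A = count (wedges a xs) e" and "B = count (wedges a ys) e"
      have AB: "odd A \<longleftrightarrow> odd (B + (if e \<in> {{u, a}, {a, z}, {u, z}} then k else 0))"
        using ys(4)[of e] unfolding p A_def B_def .
      have cA: "count (wedges u (a # xs)) e = (if e = {u, a} then 1 else 0) + A"
        by (simp add: A_def)
      have "{z, a} = {a, z}" by blast
      then have cB: "count (wedges u (z # a # ys)) e = (if e = {u, z} then 1 else 0) + (if e = {a, z} then 1 else 0) + B"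
        by (simp add: B_def)
      show ?thesis
      proof (cases "e \<in> {{u, a}, {a, z}, {u, z}}")
        case True
        then consider "e = {u, a}" "e \<noteq> {a, z}" "e \<noteq> {u, z}" | "e \<noteq> {u, a}" "e = {a, z}" "e \<noteq> {u, z}"
          | "e \<noteq> {u, a}" "e \<noteq> {a, z}" "e = {u, z}" using ne by (elim insertE emptyE) simp_all
        then show ?thesis using AB True unfolding p cA cB by cases simp_all
      next
        case False
        then show ?thesis using AB unfolding p cA cB by simp
      qed
    qed
    then show ?thesis using ys(1-3) uz by (intro exI[of _ "z # a # ys"] exI[of _ "Suc k"]) auto
  qed
qed

lemma fills_single_triangle: "fills {t} M \<longleftrightarrow> (\<forall>e. odd (count M e) \<longleftrightarrow> e \<in> pairs t)"
proof -
  have "card {s \<in> {t}. e \<in> pairs s} = (if e \<in> pairs t then 1 else 0)" for e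
  proof -
    have "{s \<in> {t}. e \<in> pairs s} = (if e \<in> pairs t then {t} else {})" by auto
    then show ?thesis by simp
  qed
  then have "odd (card {s \<in> {t}. e \<in> pairs s}) \<longleftrightarrow> e \<in> pairs t" for e by simp
  then show ?thesis unfolding fills_def by blast
qed

text \<open>The detours at most double the length of the walk, and the new triangle has to be added to the
  filling if their number is odd.\<close>
lemma linear_filling_step:
  assumes l: "linear_filling c E S" and t: "distinct [x, y, z]" "{y, z} \<in> E" "{x, z} \<in> E"
    and S: "finite S" and c: "0 \<le> c"
  shows "linear_filling (2 * c + 1) (insert {x, y} E) (insert {x, y, z} S)"
  unfolding linear_filling_def
proof (intro allI impI)
  fix u xs assume w: "walk (insert {x, y} E) u xs u"
  let ?t = "{x, y, z}"
  obtain ys k where ys: "walk E u ys u" "length ys \<le> 2 * length xs" "k \<le> length xs"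
    "\<And>e. odd (count (wedges u xs) e) \<longleftrightarrow> odd (count (wedges u ys) e + (if e \<in> pairs ?t then k else 0))"
    using detour_walk[OF w t] by blast
  obtain U where U: "U \<subseteq> S" "fills U (wedges u ys)" "real (card U) \<le> c * real (length ys)"
    using l ys(1) unfolding linear_filling_def by blast
  have fU: "finite U" using U(1) S finite_subset by blast
  have cU: "real (card U) \<le> 2 * c * real (length xs)"
  proof -
    have "c * real (length ys) \<le> c * real (2 * length xs)" using ys(2) c by (intro mult_left_mono) linarith+
    then show ?thesis using U(3) by simp
  qed
  show "\<exists>U\<subseteq>insert ?t S. fills U (wedges u xs) \<and> real (card U) \<le> (2 * c + 1) * real (length xs)"
  proof (cases "odd k")
    case False
    then have "fills U (wedges u xs)" using U(2) ys(4) by (auto simp: fills_def)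
    then show ?thesis using U(1) cU c by (intro exI[of _ U]) (auto simp: algebra_simps)
  next
    case True
    define N where "N = mset_set (pairs ?t)"
    have cN: "count N e = (if e \<in> pairs ?t then 1 else 0)" for e
      by (simp add: N_def count_mset_set' finite_pairs)
    have "fills {?t} N" unfolding fills_single_triangle cN by simp
    then have "fills (sym_diff U {?t}) (wedges u ys + N)" using U(2) fU by (intro fills_add) auto
    moreover have "odd (count (wedges u ys + N) e) \<longleftrightarrow> odd (count (wedges u xs) e)" for e
      using ys(4)[of e] True by (simp add: cN)
    ultimately have f: "fills (sym_diff U {?t}) (wedges u xs)" by (simp add: fills_def)
    have "card (sym_diff U {?t}) \<le> card U + 1" using card_sym_diff_le[OF fU, of "{?t}"] by simp
    moreover have "1 \<le> length xs" using True ys(3) by (cases k) auto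
    ultimately have "real (card (sym_diff U {?t})) \<le> (2 * c + 1) * real (length xs)"
      using cU by (simp add: algebra_simps)
    then show ?thesis using f U(1) by (intro exI[of _ "sym_diff U {?t}"]) auto
  qed
qed

text \<open>The extreme case is \<open>a = l / 5\<close>, where the ratio is \<open>3 / sqrt 5 > 1.3\<close>.\<close>
lemma sqrt_split_gain:
  fixes a b l :: real
  assumes "a + b = l" "l / 5 \<le> a" "l / 5 \<le> b" "0 < l"
  shows "1.3 * sqrt l \<le> sqrt a + sqrt b"
proof -
  have ab: "4 / 25 * l\<^sup>2 \<le> a * b"
  proof -
    have "0 \<le> (a - l / 5) * (b - l / 5)" using assms by (intro mult_nonneg_nonneg) auto
    also have "\<dots> = a * b - l / 5 * (a + b) + l\<^sup>2 / 25" by (simp add: algebra_simps power2_eq_square)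
    finally show ?thesis using assms(1) by (simp add: power2_eq_square field_simps)
  qed
  have "2 / 5 * l = sqrt (4 / 25 * l\<^sup>2)" using assms(4) by (simp add: real_sqrt_mult real_sqrt_divide)
  also have "\<dots> \<le> sqrt (a * b)" using ab by simp
  finally have s: "2 / 5 * l \<le> sqrt a * sqrt b" by (simp add: real_sqrt_mult)
  have "(1.3 * sqrt l)\<^sup>2 = 1.69 * l" using assms(4) by (simp add: power_mult_distrib power2_eq_square)
  also have "\<dots> \<le> a + b + 2 * (sqrt a * sqrt b)" using s assms(1,4) by simp
  also have "\<dots> = (sqrt a + sqrt b)\<^sup>2" using assms by (simp add: power2_sum)
  finally show ?thesis by (rule power2_le_imp_le) (use assms in auto)
qed

text \<open>Cutting a long closed walk along a shortcut, with an induction on the length, recovers the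
  good constant. The correction term \<open>7 * sqrt W * sqrt l\<close> pays for the
  shortcuts, because \<open>sqrt\<close> is strictly subadditive.\<close>
lemma linear_filling_improve:
  assumes l: "linear_filling W E S" and W: "W = 4 * K + 1" "1 \<le> K"
    and S: "finite S" "\<And>t. t \<in> S \<Longrightarrow> card t = 3 \<and> pairs t \<subseteq> E"
    and loc: "\<And>U. U \<subseteq> S \<Longrightarrow> card U \<le> N \<Longrightarrow> real (card U) \<le> K * real (card (boundary U))"
    and N: "800 * W * W \<le> real N"
  shows "linear_filling (2 * K) E S"
proof -
  \<comment> \<open>The factor 7 is what the shortcuts cost: two times at most \<open>sqrt W * sqrt l\<close>, against a gain of
    \<open>0.3 * B * sqrt l\<close>. The corrected bound is at least half the plain one from length
    \<open>(2 * B)\<^sup>2 = 196 * W\<close> on.\<close>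
  define B where "B = 7 * sqrt W"
  have W5: "5 \<le> W" using W by simp
  have main: "walk E u xs u \<Longrightarrow> \<exists>U\<subseteq>S. fills U (wedges u xs) \<and> real (card U) \<le> 2 * K * real (length xs) \<and>
      (196 * W \<le> real (length xs) \<longrightarrow> real (card U) \<le> 2 * K * (real (length xs) - B * sqrt (real (length xs))))"
    for u xs
  proof (induction "length xs" arbitrary: u xs rule: less_induct)
    case less
    obtain U where U: "U \<subseteq> S" "fills U (wedges u xs)" "real (card U) \<le> W * real (length xs)"
      using l less.prems unfolding linear_filling_def by blast
    define n where "n = real (length xs)"
    have n0: "0 \<le> n" by (simp add: n_def)
    show ?case
    proof (cases "n \<le> 800 * W")
      \<comment> \<open>At this length the weak bound already makes the filling small enough for the local estimate.\<close>
      case True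
      then have "W * n \<le> W * (800 * W)" using W5 by (intro mult_left_mono) auto
      also have "\<dots> = 800 * W * W" by simp
      finally have "W * n \<le> real N" using N by linarith
      then have "card U \<le> N" using U(3) by (simp add: n_def)
      then have "real (card U) \<le> K * real (card (boundary U))" using loc U(1) by blast
      also have "\<dots> \<le> K * n" using card_boundary_le[OF U(2)] W(2) by (intro mult_left_mono) (auto simp: n_def)
      finally have cU: "real (card U) \<le> K * n" .
      moreover have "K * n \<le> 2 * K * (n - B * sqrt n)" if "196 * W \<le> n"
      proof -
        have "2 * B = sqrt (196 * W)" unfolding B_def by (simp add: real_sqrt_mult)
        also have "\<dots> \<le> sqrt n" using that by simp
        finally have "2 * B * sqrt n \<le> sqrt n * sqrt n" by (intro mult_right_mono) (auto simp: n0)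
        then have "B * sqrt n \<le> n / 2" using n0 by simp
        then have "n / 2 \<le> n - B * sqrt n" by simp
        then show ?thesis using W(2) mult_left_mono[of "n / 2" "n - B * sqrt n" "2 * K"] by simp
      qed
      moreover have "K * n \<le> 2 * K * n" using W(2) n0 by simp
      ultimately have "real (card U) \<le> 2 * K * n"
          "196 * W \<le> n \<longrightarrow> real (card U) \<le> 2 * K * (n - B * sqrt n)" by linarith+
      then show ?thesis using U(1,2) unfolding n_def by blast
    next
      case False
      \<comment> \<open>Chosen as small as \<open>card U < D\<^sup>2\<close> permits.\<close>
      define D where "D = nat \<lfloor>sqrt (W * n)\<rfloor> + 1"
      have wn: "0 \<le> W * n" using W5 n0 by simp
      have "W * n < real D * real D"
      proof -
        have "sqrt (W * n) < real D" unfolding D_def using wn by (simp add: floor_less_iff) linarith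
        moreover have "0 \<le> sqrt (W * n)" using wn by simp
        ultimately have "sqrt (W * n) * sqrt (W * n) < real D * real D"
          by (intro mult_strict_mono) linarith+
        then show ?thesis using wn by simp
      qed
      then have "real (card U) < real (D * D)" using U(3) by (simp add: n_def)
      then have "card U < D * D" by linarith
      moreover have "finite U" using U(1) S(1) finite_subset by blast
      ultimately obtain x d L1 L2 where L: "walk E x L1 x" "walk E x L2 x" "d < D"
        "length L1 + length L2 = length xs + 2 * d"
        "length L1 \<ge> length xs div 4 + d" "length L2 \<ge> length xs div 4 + d"
        "\<And>e. odd (count (wedges x L1 + wedges x L2) e) \<longleftrightarrow> odd (count (wedges u xs) e)"
        using balanced_cut[OF _ _ _ less.prems U(2), of D] S(2) U(1) by blast
      have "real d \<le> sqrt (W * n)"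
      proof -
        have "d \<le> nat \<lfloor>sqrt (W * n)\<rfloor>" using L(3) by (simp add: D_def)
        then have "real d \<le> real (nat \<lfloor>sqrt (W * n)\<rfloor>)" by simp
        also have "\<dots> \<le> sqrt (W * n)" using wn by simp
        finally show ?thesis .
      qed
      then have d: "real d \<le> sqrt W * sqrt n" by (simp add: real_sqrt_mult)
      have n4: "800 * W < n" using False by simp
      have sq: "28 * sqrt W \<le> sqrt n"
      proof -
        have "28 * sqrt W = sqrt (784 * W)" by (simp add: real_sqrt_mult)
        also have "\<dots> \<le> sqrt n" using n4 W5 by simp
        finally show ?thesis .
      qed
      then have "28 * sqrt W * sqrt n \<le> sqrt n * sqrt n" by (intro mult_right_mono) (auto simp: n0)
      then have d28: "28 * real d \<le> n" using d n0 by simp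
      define l1 l2 where "l1 = real (length L1)" and "l2 = real (length L2)"
      have q: "n / 4 - 1 \<le> real (length xs div 4)" unfolding n_def by linarith
      have sum: "l1 + l2 = n + 2 * real d"
        using L(4) unfolding l1_def l2_def n_def by (metis of_nat_add of_nat_mult of_nat_numeral)
      have lower: "n / 4 - 1 + real d \<le> l1" "n / 4 - 1 + real d \<le> l2"
        using L(5,6) q unfolding l1_def l2_def by linarith+
      have big: "196 * W \<le> l1" "196 * W \<le> l2" using lower n4 W5 by auto
      have "l1 < n" "l2 < n" using sum lower d28 n4 W5 by auto
      then have sh: "length L1 < length xs" "length L2 < length xs" by (auto simp: l1_def l2_def n_def)
      obtain U1 where U1: "U1 \<subseteq> S" "fills U1 (wedges x L1)" "real (card U1) \<le> 2 * K * (l1 - B * sqrt l1)"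
        using less.hyps[OF sh(1) L(1)] big(1) unfolding l1_def by blast
      obtain U2 where U2: "U2 \<subseteq> S" "fills U2 (wedges x L2)" "real (card U2) \<le> 2 * K * (l2 - B * sqrt l2)"
        using less.hyps[OF sh(2) L(2)] big(2) unfolding l2_def by blast
      have fin: "finite U1" "finite U2" using U1(1) U2(1) S(1) finite_subset by blast+
      define U' where "U' = sym_diff U1 U2"
      have "fills U' (wedges x L1 + wedges x L2)" unfolding U'_def by (rule fills_add) fact+
      then have f: "fills U' (wedges u xs)" using L(7) by (simp add: fills_def)
      have "1.3 * sqrt n \<le> sqrt (l1 - real d) + sqrt (l2 - real d)"
        using sum lower n4 W5 by (intro sqrt_split_gain) auto
      also have "\<dots> \<le> sqrt l1 + sqrt l2" by (intro add_mono real_sqrt_le_mono) auto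
      finally have "B * (1.3 * sqrt n) \<le> B * (sqrt l1 + sqrt l2)"
        using W5 by (intro mult_left_mono) (auto simp: B_def)
      moreover have "2 * real d \<le> B * (0.3 * sqrt n)"
      proof -
        have "0 \<le> sqrt W * sqrt n" using W5 n0 by simp
        then have "2 * (sqrt W * sqrt n) \<le> 2.1 * (sqrt W * sqrt n)" by linarith
        then show ?thesis using d unfolding B_def by simp
      qed
      ultimately have "(l1 - B * sqrt l1) + (l2 - B * sqrt l2) \<le> n - B * sqrt n"
        using sum by (simp add: algebra_simps)
      then have "2 * K * ((l1 - B * sqrt l1) + (l2 - B * sqrt l2)) \<le> 2 * K * (n - B * sqrt n)"
        using W(2) by (intro mult_left_mono) auto
      moreover have "card U' \<le> card U1 + card U2" unfolding U'_def by (rule card_sym_diff_le) fact+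
      then have "real (card U') \<le> real (card U1) + real (card U2)" by linarith
      ultimately have cU': "real (card U') \<le> 2 * K * (n - B * sqrt n)"
        using U1(3) U2(3) by (simp add: distrib_left)
      have "2 * K * (n - B * sqrt n) \<le> 2 * K * n"
        using W(2) W5 n0 by (intro mult_left_mono) (auto simp: B_def)
      then have "real (card U') \<le> 2 * K * n" using cU' by linarith
      moreover have "U' \<subseteq> S" using U1(1) U2(1) by (auto simp: U'_def)
      ultimately show ?thesis using f cU' unfolding n_def by blast
    qed
  qed
  show ?thesis unfolding linear_filling_def using main by blast
qed

text \<open>Each step loses a factor of about two and regains it at once, so the constant does not
  deteriorate with the number of steps.\<close>
lemma linear_filling_built:
  assumes b: "built T E S" and T: "\<And>a b. {a, b} \<in> T \<Longrightarrow> \<not> conn (T - {{a, b}}) a b" "T \<subseteq> pairs V"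
    and K: "1 \<le> K" "800 * (4 * K + 1) * (4 * K + 1) \<le> real N"
    and loc: "\<And>U. U \<subseteq> S \<Longrightarrow> card U \<le> N \<Longrightarrow> real (card U) \<le> K * real (card (boundary U))"
  shows "linear_filling (2 * K) E S"
  using b loc
proof (induction rule: built.induct)
  case start
  show ?case using T K(1) by (intro linear_filling_tree) auto
next
  case (add E S x y z)
  have b': "built T (insert {x, y} E) (insert {x, y, z} S)" using add.hyps by (rule built.add)
  have "linear_filling (2 * K) E S" using add.IH add.prems by blast
  then have "linear_filling (2 * (2 * K) + 1) (insert {x, y} E) (insert {x, y, z} S)"
    using add.hyps built_triangles(1)[OF add.hyps(1)] K(1) by (intro linear_filling_step) auto
  then have l: "linear_filling (4 * K + 1) (insert {x, y} E) (insert {x, y, z} S)" by simp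
  show ?case
  proof (rule linear_filling_improve[OF l refl K(1) _ _ _ K(2)])
    show "finite (insert {x, y, z} S)" using built_triangles(1)[OF b'] .
    show "card t = 3 \<and> pairs t \<subseteq> insert {x, y} E" if "t \<in> insert {x, y, z} S" for t
      using built_triangles(2)[OF b' that] built_triangles(3)[OF b'] that unfolding spanned_def by blast
    show "real (card U) \<le> K * real (card (boundary U))" if "U \<subseteq> insert {x, y, z} S" "card U \<le> N" for U
      using add.prems that by blast
  qed
qed

section \<open>Activating trees force dense bounded subgraphs\<close>

text \<open>The 4-cycle has a filling \<open>U\<close> of at most \<open>8 * K\<close> triangles. Its boundary consists of the four edges
  of the cycle and is connected, so there is only one component, and the Euler estimate reads
  \<open>3 |W| \<le> e + 3 + 4\<close>.\<close>
lemma square_has_dense_neighbourhood: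
  assumes T: "is_tree T" "activates T (V, E)" and sp: "locally_sparse \<delta> (3 * N) E"
    and d: "0 < \<delta>" "\<delta> \<le> 1" and N: "800 * (48 / \<delta> + 1) * (48 / \<delta> + 1) \<le> real N"
    and sq: "distinct [a, b, c, d]" "{a, b} \<in> E" "{b, c} \<in> E" "{c, d} \<in> E" "{d, a} \<in> E"
  shows "\<exists>W\<subseteq>V. {a, b, c, d} \<subseteq> W \<and> real (card W) \<le> 288 / \<delta> \<and> 3 * card W \<le> card (E \<inter> pairs W) + 7"
proof -
  define K where "K = 12 / \<delta>"
  have K1: "1 \<le> K" using d by (simp add: K_def field_simps)
  have T': "bootstrap_step\<^sup>*\<^sup>* T (V, E)" "simple_graph (V, E)" "simple_graph T"
    using T by (auto simp: activates_def spanning_subgraph_def subgraph_def is_tree_def)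
  have EV: "E \<subseteq> pairs V" using T'(2) by (simp add: simple_graph_def)
  obtain S where S: "built (edges T) E S" using bootstrap_built[OF T'(1)] by auto
  note bt = built_triangles[OF S]
  have loc: "real (card U) \<le> K * real (card (boundary U))" if "U \<subseteq> S" "card U \<le> N" for U
    unfolding K_def by (rule small_families_expand[OF S that(1) sp]) (use d that in auto)
  have lf: "linear_filling (2 * K) E S"
  proof (rule linear_filling_built[OF S _ _ K1 _ loc])
    show "800 * (4 * K + 1) * (4 * K + 1) \<le> real N" using N by (simp add: K_def)
    show "edges T \<subseteq> pairs (verts T)" using T'(3) by (simp add: simple_graph_def)
  qed (use tree_edge_bridge[OF T(1)] in auto)
  have "walk E a [b, c, d, a] a" using sq by simp
  then obtain U where U: "U \<subseteq> S" "fills U (wedges a [b, c, d, a])" "real (card U) \<le> 2 * K * real (length [b, c, d, a])"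
    using lf unfolding linear_filling_def by blast
  define M where "M = wedges a [b, c, d, a]"
  have cM: "count M e = (if e \<in> {{a, b}, {b, c}, {c, d}, {d, a}} then 1 else 0)" for e
    using sq(1) unfolding M_def by (auto simp: doubleton_eq_iff)
  have bd: "boundary U = {{a, b}, {b, c}, {c, d}, {d, a}}"
    unfolding fills_boundary[OF U(2)[folded M_def]] cM by auto
  define W where "W = \<Union>U"
  have bs: "boundary U \<subseteq> spanned U" by (rule boundary_subset_spanned)
  have "\<exists>X :: 'a set. (\<forall>x\<in>X. \<forall>y\<in>X. x = y) \<and> 3 * card W \<le> card (spanned U) + 3 * card X + card (boundary U)"
  proof (rule euler_estimate[OF S U(1)])
    fix J X assume X: "\<And>u v. {u, v} \<in> spanned U \<Longrightarrow> conn J u v"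
      "\<And>x y. x \<in> X \<Longrightarrow> y \<in> X \<Longrightarrow> conn J x y \<Longrightarrow> x = y"
      "\<And>x. x \<in> X \<Longrightarrow> \<exists>e\<in>boundary U. \<exists>v\<in>e. conn J x v"
      "3 * card (\<Union>U) \<le> card (spanned U) + 3 * card X + card (boundary U)"
    have e: "conn J a b" "conn J b c" "conn J c d" using X(1) bs bd by auto
    have toa: "conn J x a" if x: "x \<in> X" for x
    proof -
      obtain v where v: "v \<in> {a, b, c, d}" "conn J x v" using X(3)[OF x] unfolding bd by auto
      have "conn J a c" "conn J a d" using e by (metis conn_trans)+
      then have "conn J a v" using v(1) e by auto
      then show ?thesis using v(2) by (metis conn_sym conn_trans)
    qed
    have "x = y" if xy: "x \<in> X" "y \<in> X" for x y
      using X(2)[OF xy] toa[OF xy(1)] toa[OF xy(2)] by (metis conn_sym conn_trans)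
    then show "\<exists>X :: 'a set. (\<forall>x\<in>X. \<forall>y\<in>X. x = y) \<and> 3 * card W \<le> card (spanned U) + 3 * card X + card (boundary U)"
      using X(4) unfolding W_def by blast
  qed
  then obtain X :: "'a set" where X: "\<forall>x\<in>X. \<forall>y\<in>X. x = y" "3 * card W \<le> card (spanned U) + 3 * card X + card (boundary U)"
    by blast
  have "card X \<le> 1"
  proof (cases "X = {}")
    case False
    then obtain x where "X = {x}" using X(1) by blast
    then show ?thesis by simp
  qed simp
  moreover have "card (boundary U) \<le> 4"
    using card_boundary_le[OF U(2)] by simp
  moreover have fU: "finite U" using U(1) bt(1) finite_subset by blast
  have c3: "card t = 3" if "t \<in> U" for t using that U(1) bt(2) by blast
  have fW: "finite W" unfolding W_def using fU c3 finite_triangle by blast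
  have "spanned U \<subseteq> E \<inter> pairs W"
    using spanned_mono[OF U(1)] bt(3) unfolding W_def by (auto simp: spanned_def pairs_def)
  then have "card (spanned U) \<le> card (E \<inter> pairs W)" using fW by (intro card_mono) (auto intro: finite_pairs)
  ultimately have "3 * card W \<le> card (E \<inter> pairs W) + 7" using X(2) by linarith
  moreover have "{a, b, c, d} \<subseteq> W"
    using bs unfolding bd W_def by (auto simp: spanned_def)
  moreover have "W \<subseteq> V"
  proof
    fix x assume "x \<in> W"
    then obtain t where t: "t \<in> U" "x \<in> t" by (auto simp: W_def)
    obtain y where "y \<in> t" "y \<noteq> x"
    proof -
      have "t \<noteq> {x}" using c3[OF t(1)] by auto
      then show thesis using t(2) that by blast
    qed
    then have "{x, y} \<in> pairs t" using t(2) by auto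
    then have "{x, y} \<in> spanned S" using t(1) U(1) by (auto simp: spanned_def)
    then have "{x, y} \<in> pairs V" using bt(3) EV by blast
    then show "x \<in> V" by simp
  qed
  moreover have "real (card W) \<le> 288 / \<delta>"
  proof -
    have "real (card W) \<le> 3 * real (card U)" using card_Union_triangles[OF fU c3] unfolding W_def by linarith
    also have "\<dots> \<le> 3 * (8 * K)" using U(3) by simp
    finally show ?thesis by (simp add: K_def)
  qed
  ultimately show ?thesis by blast
qed

definition triangles :: "'a set \<Rightarrow> 'a set set \<Rightarrow> 'a set set" where
  "triangles V E = {t. t \<subseteq> V \<and> card t = 3 \<and> pairs t \<subseteq> E}"

text \<open>Every step needs a triangle of its own.\<close>
lemma tree_activates_triangles:
  assumes "tree_activates (V, E)"
  shows "card E + 1 \<le> card V + card (triangles V E)"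
proof -
  obtain T where T: "is_tree T" "activates T (V, E)" using assms by (auto simp: tree_activates_def)
  have T': "bootstrap_step\<^sup>*\<^sup>* T (V, E)" "simple_graph (V, E)" "simple_graph T" "verts T = V"
    using T by (auto simp: activates_def spanning_subgraph_def subgraph_def is_tree_def)
  have fV: "finite V" "E \<subseteq> pairs V" using T'(2) by (auto simp: simple_graph_def)
  have fT: "finite (edges T)" using T'(3) by (meson finite_pairs finite_subset simple_graph_def)
  obtain S where S: "built (edges T) E S" using bootstrap_built[OF T'(1)] by auto
  note bt = built_triangles[OF S]
  have "S \<subseteq> triangles V E"
  proof
    fix t assume t: "t \<in> S"
    have p: "pairs t \<subseteq> E" using bt(3) t by (auto simp: spanned_def)
    have "x \<in> V" if x: "x \<in> t" for x
    proof -
      have "t \<noteq> {x}" using bt(2)[OF t] by auto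
      then obtain y where "y \<in> t" "y \<noteq> x" using x by blast
      then have "{x, y} \<in> E" using x p by auto
      then show ?thesis using fV(2) by auto
    qed
    then show "t \<in> triangles V E" using p bt(2)[OF t] by (auto simp: triangles_def)
  qed
  moreover have "finite (triangles V E)" using fV(1) by (auto simp: triangles_def)
  ultimately have "card S \<le> card (triangles V E)" by (intro card_mono)
  moreover have "card (edges T) + 1 = card V" using tree_card_edges[OF T(1)] T'(4) by simp
  ultimately show ?thesis using bt(5)[OF fT] by linarith
qed

section \<open>Elementary estimates\<close>

text \<open>A linear upper bound for \<open>exp\<close>, to estimate hitting probabilities from below.\<close>
lemma exp_minus_le_half:
  fixes x :: real
  assumes "0 \<le> x" "x \<le> 1"
  shows "exp (- x) \<le> 1 - x / 2"
proof -
  have "(1 - x / 2) * (1 + x) \<ge> 1"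
    using mult_left_mono[of x 1 x] assms by (simp add: algebra_simps)
  moreover have "(1 - x / 2) * (1 + x) \<le> (1 - x / 2) * exp x"
    using exp_ge_add_one_self[of x] assms by (intro mult_left_mono) auto
  ultimately have "1 \<le> (1 - x / 2) * exp x" by linarith
  then show ?thesis by (simp add: exp_minus field_simps)
qed

lemma power_le_exp:
  fixes x :: real
  assumes "0 \<le> x" "x \<le> 1" "c \<le> x * real N"
  shows "(1 - x) ^ N \<le> exp (- c)"
proof -
  have "(1 - x) ^ N \<le> exp (- x) ^ N" using exp_ge_add_one_self[of "- x"] assms by (intro power_mono) auto
  also have "\<dots> = exp (- (x * real N))" by (simp add: exp_of_nat_mult[symmetric] mult_ac)
  also have "\<dots> \<le> exp (- c)" using assms by simp
  finally show ?thesis .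
qed

lemma hit_lower_bound:
  fixes p :: real
  assumes "0 \<le> p" "p \<le> 1" "real s * p \<le> 1"
  shows "real s * p / 2 \<le> 1 - (1 - p) ^ s"
proof -
  have "(1 - p) ^ s \<le> exp (- (real s * p))" using power_le_exp[of p "real s * p" s] assms by (simp add: mult.commute)
  then show ?thesis using exp_minus_le_half[of "real s * p"] assms by simp
qed

text \<open>The left-hand side is the Chernoff bound, with tilt \<open>1 - t\<close>, for the probability that a binomial
  variable with parameters \<open>N\<close> and \<open>p\<close> is at most \<open>h\<close>.\<close>
lemma tilted_power_bound:
  fixes p t :: real
  assumes "0 \<le> p" "p \<le> 1" "0 \<le> t" "t \<le> 1 / 2"
  shows "(1 - p + p * (1 - t)) ^ N / (1 - t) ^ h \<le> exp (real h * (t + 2 * t\<^sup>2) - p * t * real N)"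
proof -
  have pt: "p * t \<le> 1" using assms mult_le_one[of p t] by simp
  have "(1 - p + p * (1 - t)) ^ N = (1 - p * t) ^ N" by (simp add: algebra_simps)
  also have "\<dots> \<le> exp (- (p * t)) ^ N"
    using exp_ge_add_one_self[of "- (p * t)"] pt by (intro power_mono) auto
  also have "\<dots> = exp (- (p * t * real N))" by (simp add: exp_of_nat_mult[symmetric] mult_ac)
  finally have 1: "(1 - p + p * (1 - t)) ^ N \<le> exp (- (p * t * real N))" .
  have l: "- t - 2 * t\<^sup>2 \<le> ln (1 - t)" using ln_one_minus_pos_lower_bound[of t] assms by simp
  have "exp (- (real h * (t + 2 * t\<^sup>2))) \<le> exp (real h * ln (1 - t))"
    using mult_left_mono[OF l, of "real h"] by (simp add: algebra_simps)
  also have "\<dots> = (1 - t) ^ h" using assms by (simp add: exp_of_nat_mult)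
  finally have 2: "exp (- (real h * (t + 2 * t\<^sup>2))) \<le> (1 - t) ^ h" .
  have "(1 - p + p * (1 - t)) ^ N / (1 - t) ^ h \<le> exp (- (p * t * real N)) / exp (- (real h * (t + 2 * t\<^sup>2)))"
    using 1 2 by (intro frac_le) auto
  also have "\<dots> = exp (real h * (t + 2 * t\<^sup>2) - p * t * real N)" by (simp add: exp_diff[symmetric])
  finally show ?thesis .
qed

lemma binomial_le_power: "n choose k \<le> n ^ k"
  by (cases "k \<le> n") (auto simp: binomial_le_pow binomial_eq_0)

lemma subset_of_card: "n \<le> card S \<Longrightarrow> \<exists>T. T \<subseteq> S \<and> card T = n"
  using obtain_subset_with_card_n by metis

section \<open>Random subsets of a finite set\<close>

text \<open>The random subset of \<open>I\<close> that contains each element independently with probability \<open>p\<close>.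
  Its events are predicates on sets, and probabilities are finite sums, so that one can pass
  freely between \<open>I\<close> and its subsets when edges are revealed in stages.\<close>

locale coin =
  fixes p :: real
  assumes p0: "0 \<le> p" and p1: "p \<le> 1"
begin

definition wt :: "'i set \<Rightarrow> 'i set \<Rightarrow> real" where
  "wt I F = p ^ card F * (1 - p) ^ card (I - F)"

definition prb :: "'i set \<Rightarrow> ('i set \<Rightarrow> bool) \<Rightarrow> real" where
  "prb I A = (\<Sum>F\<in>Pow I. wt I F * of_bool (A F))"

lemma wt_nonneg: "0 \<le> wt I F"
  using p0 p1 by (simp add: wt_def)

lemma prb_nonneg: "0 \<le> prb I A"
  unfolding prb_def by (intro sum_nonneg mult_nonneg_nonneg wt_nonneg) auto

lemma prb_mono: "(\<And>F. F \<subseteq> I \<Longrightarrow> A F \<Longrightarrow> B F) \<Longrightarrow> prb I A \<le> prb I B"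
  unfolding prb_def by (intro sum_mono mult_left_mono wt_nonneg) auto

lemma prb_cong: "(\<And>F. F \<subseteq> I \<Longrightarrow> A F = B F) \<Longrightarrow> prb I A = prb I B"
  unfolding prb_def by (intro sum.cong) auto

text \<open>The generating function of the size of the random subset.\<close>
lemma sum_wt:
  assumes "finite I"
  shows "(\<Sum>F\<in>Pow I. wt I F * z ^ card F) = (1 - p + p * z) ^ card I"
proof -
  have "(1 - p + p * z) ^ card I = (\<Prod>x\<in>I. p * z + (1 - p))" by (simp add: add.commute)
  also have "\<dots> = (\<Sum>F\<in>Pow I. (\<Prod>x\<in>F. p * z) * (\<Prod>x\<in>I - F. 1 - p))"
    by (rule prod_add[OF assms])
  also have "\<dots> = (\<Sum>F\<in>Pow I. wt I F * z ^ card F)"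
    by (intro sum.cong) (auto simp: wt_def power_mult_distrib)
  finally show ?thesis by simp
qed

lemma prb_True: "finite I \<Longrightarrow> prb I (\<lambda>_. True) = 1"
  using sum_wt[of I 1] by (simp add: prb_def)

lemma prb_le_1: "finite I \<Longrightarrow> prb I A \<le> 1"
  using prb_mono[of I A "\<lambda>_. True"] prb_True[of I] by simp

lemma prb_disj: "prb I (\<lambda>F. A F \<or> B F) \<le> prb I A + prb I B"
proof -
  have "prb I (\<lambda>F. A F \<or> B F) \<le> (\<Sum>F\<in>Pow I. wt I F * of_bool (A F) + wt I F * of_bool (B F))"
    unfolding prb_def by (intro sum_mono) (auto simp: wt_nonneg)
  then show ?thesis by (simp add: prb_def sum.distrib)
qed

lemma prb_not: assumes "finite I" shows "prb I (\<lambda>F. \<not> A F) = 1 - prb I A"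
proof -
  have "prb I A + prb I (\<lambda>F. \<not> A F) = (\<Sum>F\<in>Pow I. wt I F * of_bool (A F) + wt I F * of_bool (\<not> A F))"
    by (simp add: prb_def sum.distrib)
  also have "\<dots> = prb I (\<lambda>_. True)" unfolding prb_def by (intro sum.cong) auto
  finally show ?thesis using prb_True[OF assms] by simp
qed

lemma prb_union:
  assumes "finite X"
  shows "prb I (\<lambda>F. \<exists>x\<in>X. A x F) \<le> (\<Sum>x\<in>X. prb I (A x))"
  using assms
proof (induction X rule: finite_induct)
  case empty
  then show ?case by (simp add: prb_def)
next
  case (insert x X)
  have "prb I (\<lambda>F. \<exists>y\<in>insert x X. A y F) \<le> prb I (\<lambda>F. A x F \<or> (\<exists>y\<in>X. A y F))"
    by (intro prb_mono) auto
  also have "\<dots> \<le> prb I (A x) + prb I (\<lambda>F. \<exists>y\<in>X. A y F)" by (rule prb_disj)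
  finally show ?case using insert by simp
qed

lemma prb_union_le:
  assumes "finite X" "\<And>x. x \<in> X \<Longrightarrow> prb I (A x) \<le> b"
  shows "prb I (\<lambda>F. \<exists>x\<in>X. A x F) \<le> real (card X) * b"
  by (rule order_trans[OF prb_union[OF assms(1)] sum_bounded_above]) (rule assms(2))

text \<open>Revealing the part of the random set inside \<open>J\<close> first.\<close>
lemma prb_split:
  assumes "finite I" "J \<subseteq> I"
  shows "prb I A = (\<Sum>F\<in>Pow J. wt J F * prb (I - J) (\<lambda>F'. A (F \<union> F')))"
proof -
  have "prb I A = (\<Sum>(F, F')\<in>Pow J \<times> Pow (I - J). wt J F * (wt (I - J) F' * of_bool (A (F \<union> F'))))"
    unfolding prb_def
  proof (rule sum.reindex_bij_witness[of _ "\<lambda>(F, F'). F \<union> F'" "\<lambda>F. (F \<inter> J, F - J)"])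
    fix F assume F: "F \<in> Pow I"
    have fin: "finite F" using F assms(1) finite_subset by auto
    have "card F = card (F \<inter> J) + card (F - J)" using card_Int_Diff[OF fin, of J] .
    moreover have "card (I - F) = card (J - F \<inter> J) + card (I - J - (F - J))"
    proof -
      have "I - F = (J - F \<inter> J) \<union> (I - J - (F - J))" using F assms(2) by auto
      moreover have "card ((J - F \<inter> J) \<union> (I - J - (F - J))) = card (J - F \<inter> J) + card (I - J - (F - J))"
        using assms finite_subset[OF assms(2,1)] by (intro card_Un_disjoint) auto
      ultimately show ?thesis by simp
    qed
    moreover have "F \<inter> J \<union> (F - J) = F" by auto
    ultimately show "(case (F \<inter> J, F - J) of (F, F') \<Rightarrow> wt J F * (wt (I - J) F' * of_bool (A (F \<union> F')))) =
        wt I F * of_bool (A F)" by (simp add: wt_def power_add mult_ac)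
  qed (use assms(2) in auto)
  also have "\<dots> = (\<Sum>F\<in>Pow J. wt J F * prb (I - J) (\<lambda>F'. A (F \<union> F')))"
    by (simp add: prb_def sum.cartesian_product[symmetric] sum_distrib_left)
  finally show ?thesis .
qed

lemma prb_restrict:
  assumes "finite I" "J \<subseteq> I" "\<And>F. F \<subseteq> I \<Longrightarrow> A F = A (F \<inter> J)"
  shows "prb I A = prb J A"
proof -
  have "prb I A = (\<Sum>F\<in>Pow J. wt J F * of_bool (A F))"
    unfolding prb_split[OF assms(1,2)]
  proof (intro sum.cong refl arg_cong2[of _ _ _ _ "(*)"])
    fix F assume F: "F \<in> Pow J"
    have "A (F \<union> F') = A F" if "F' \<subseteq> I - J" for F'
    proof -
      have "A (F \<union> F') = A ((F \<union> F') \<inter> J)" by (rule assms(3)) (use F that assms(2) in auto)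
      also have "(F \<union> F') \<inter> J = F" using F that by auto
      finally show ?thesis .
    qed
    then have "prb (I - J) (\<lambda>F'. A (F \<union> F')) = prb (I - J) (\<lambda>F'. A F)" by (intro prb_cong) auto
    also have "\<dots> = of_bool (A F)" using prb_True[of "I - J"] assms(1) by (cases "A F") (auto simp: prb_def)
    finally show "prb (I - J) (\<lambda>F'. A (F \<union> F')) = of_bool (A F)" .
  qed
  then show ?thesis by (simp add: prb_def)
qed

text \<open>The law of total probability for two stages: \<open>B\<close> is decided by the part inside \<open>J\<close>, which is
  revealed first.\<close>
lemma prb_stage:
  assumes I: "finite I" "J \<subseteq> I" and d: "0 \<le> d"
    and B: "\<And>F. F \<subseteq> I \<Longrightarrow> B F = B (F \<inter> J)"
    and A: "\<And>F. F \<subseteq> J \<Longrightarrow> B F \<Longrightarrow> prb (I - J) (\<lambda>F'. A (F \<union> F')) \<le> d"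
  shows "prb I (\<lambda>F. B F \<and> A F) \<le> d"
proof -
  have fJ: "finite J" using I finite_subset by blast
  have "prb I (\<lambda>F. B F \<and> A F) = (\<Sum>F\<in>Pow J. wt J F * prb (I - J) (\<lambda>F'. B (F \<union> F') \<and> A (F \<union> F')))"
    by (rule prb_split[OF I])
  also have "\<dots> \<le> (\<Sum>F\<in>Pow J. wt J F * d)"
  proof (intro sum_mono mult_left_mono wt_nonneg)
    fix F assume F: "F \<in> Pow J"
    have BF: "B (F \<union> F') = B F" if "F' \<subseteq> I - J" for F'
    proof -
      have "B (F \<union> F') = B ((F \<union> F') \<inter> J)" by (rule B) (use F that I in auto)
      also have "(F \<union> F') \<inter> J = F" using F that by auto
      finally show ?thesis .
    qed
    show "prb (I - J) (\<lambda>F'. B (F \<union> F') \<and> A (F \<union> F')) \<le> d"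
    proof (cases "B F")
      case True
      have "prb (I - J) (\<lambda>F'. B (F \<union> F') \<and> A (F \<union> F')) \<le> prb (I - J) (\<lambda>F'. A (F \<union> F'))"
        by (intro prb_mono) auto
      also have "\<dots> \<le> d" using A True F by auto
      finally show ?thesis .
    next
      case False
      then have "prb (I - J) (\<lambda>F'. B (F \<union> F') \<and> A (F \<union> F')) = prb (I - J) (\<lambda>F'. False)"
        using BF by (intro prb_cong) auto
      then show ?thesis using d by (simp add: prb_def)
    qed
  qed
  also have "\<dots> = d" using sum_wt[OF fJ, of 1] by (simp add: sum_distrib_right[symmetric])
  finally show ?thesis .
qed

lemma prb_indep2:
  assumes I: "finite I" "J \<subseteq> I"
    and A: "\<And>F. F \<subseteq> I \<Longrightarrow> A F = A (F \<inter> J)" and B: "\<And>F. F \<subseteq> I \<Longrightarrow> B F = B (F - J)"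
  shows "prb I (\<lambda>F. A F \<and> B F) = prb I A * prb I B"
proof -
  have "prb I (\<lambda>F. A F \<and> B F) = (\<Sum>F\<in>Pow J. wt J F * prb (I - J) (\<lambda>F'. A (F \<union> F') \<and> B (F \<union> F')))"
    by (rule prb_split[OF I])
  also have "\<dots> = (\<Sum>F\<in>Pow J. wt J F * of_bool (A F) * prb (I - J) B)"
  proof (intro sum.cong refl)
    fix F assume F: "F \<in> Pow J"
    have "A (F \<union> F') = A F" "B (F \<union> F') = B F'" if F': "F' \<subseteq> I - J" for F'
    proof -
      have "A (F \<union> F') = A ((F \<union> F') \<inter> J)" by (rule A) (use F F' I in auto)
      also have "(F \<union> F') \<inter> J = F" using F F' by auto
      finally show "A (F \<union> F') = A F" .
      have "B (F \<union> F') = B ((F \<union> F') - J)" by (rule B) (use F F' I in auto)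
      also have "(F \<union> F') - J = F'" using F F' by auto
      finally show "B (F \<union> F') = B F'" .
    qed
    then have "prb (I - J) (\<lambda>F'. A (F \<union> F') \<and> B (F \<union> F')) = prb (I - J) (\<lambda>F'. A F \<and> B F')"
      by (intro prb_cong) auto
    also have "\<dots> = of_bool (A F) * prb (I - J) B" by (cases "A F") (auto simp: prb_def)
    finally show "wt J F * prb (I - J) (\<lambda>F'. A (F \<union> F') \<and> B (F \<union> F')) = wt J F * of_bool (A F) * prb (I - J) B"
      by simp
  qed
  also have "\<dots> = prb J A * prb (I - J) B" by (simp add: prb_def sum_distrib_right)
  also have "prb J A = prb I A" using prb_restrict[OF I, of A] A by simp
  also have "prb (I - J) B = prb I B"
  proof -
    have "B F = B (F \<inter> (I - J))" if "F \<subseteq> I" for F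
    proof -
      have "F \<inter> (I - J) = F - J" using that by auto
      then show ?thesis using B[OF that] by simp
    qed
    then show ?thesis using prb_restrict[OF I(1), of "I - J" B] by simp
  qed
  finally show ?thesis .
qed

lemma prb_indep_family:
  assumes I: "finite I" and X: "finite X" and J: "\<And>x. x \<in> X \<Longrightarrow> J x \<subseteq> I"
    and disj: "\<And>x y. x \<in> X \<Longrightarrow> y \<in> X \<Longrightarrow> x \<noteq> y \<Longrightarrow> J x \<inter> J y = {}"
    and A: "\<And>x F. x \<in> X \<Longrightarrow> F \<subseteq> I \<Longrightarrow> A x F = A x (F \<inter> J x)"
  shows "prb I (\<lambda>F. \<forall>x\<in>X. A x F) = (\<Prod>x\<in>X. prb I (A x))"
  using X J disj A
proof (induction X rule: finite_induct)
  case empty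
  then show ?case using prb_True[OF I] by simp
next
  case (insert x X)
  have "prb I (\<lambda>F. \<forall>y\<in>insert x X. A y F) = prb I (\<lambda>F. A x F \<and> (\<forall>y\<in>X. A y F))"
    by (intro prb_cong) auto
  also have "\<dots> = prb I (A x) * prb I (\<lambda>F. \<forall>y\<in>X. A y F)"
  proof (rule prb_indep2[OF I, of "J x"])
    show "J x \<subseteq> I" using insert.prems(1) by auto
    show "A x F = A x (F \<inter> J x)" if "F \<subseteq> I" for F using insert.prems(3) that by blast
    show "(\<forall>y\<in>X. A y F) = (\<forall>y\<in>X. A y (F - J x))" if F: "F \<subseteq> I" for F
    proof (intro ball_cong refl)
      fix y assume y: "y \<in> X"
      then have "J x \<inter> J y = {}" using insert.prems(2)[of x y] insert.hyps(2) by auto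
      then have "F \<inter> J y = (F - J x) \<inter> J y" by auto
      then show "A y F = A y (F - J x)" using insert.prems(3)[of y F] insert.prems(3)[of y "F - J x"] y F by auto
    qed
  qed
  also have "prb I (\<lambda>F. \<forall>y\<in>X. A y F) = (\<Prod>y\<in>X. prb I (A y))"
    using insert.prems by (intro insert.IH) auto
  finally show ?case using insert.hyps by simp
qed

lemma prb_all_fail:
  assumes I: "finite I" and X: "finite X" and J: "\<And>x. x \<in> X \<Longrightarrow> J x \<subseteq> I"
    and disj: "\<And>x y. x \<in> X \<Longrightarrow> y \<in> X \<Longrightarrow> x \<noteq> y \<Longrightarrow> J x \<inter> J y = {}"
    and A: "\<And>x F. x \<in> X \<Longrightarrow> F \<subseteq> I \<Longrightarrow> A x F = A x (F \<inter> J x)"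
    and q: "\<And>x. x \<in> X \<Longrightarrow> q \<le> prb I (A x)"
  shows "prb I (\<lambda>F. \<forall>x\<in>X. \<not> A x F) \<le> (1 - q) ^ card X"
proof -
  have "prb I (\<lambda>F. \<forall>x\<in>X. \<not> A x F) = (\<Prod>x\<in>X. prb I (\<lambda>F. \<not> A x F))"
    by (rule prb_indep_family[OF I X J disj]) (use A in auto)
  also have "\<dots> \<le> (\<Prod>x\<in>X. 1 - q)"
  proof (intro prod_mono conjI prb_nonneg)
    fix x assume "x \<in> X"
    then show "prb I (\<lambda>F. \<not> A x F) \<le> 1 - q" using prb_not[OF I, of "A x"] q by simp
  qed
  finally show ?thesis by simp
qed

lemma prb_supset: assumes "finite I" "S \<subseteq> I" shows "prb I (\<lambda>F. S \<subseteq> F) = p ^ card S"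
proof -
  have "prb I (\<lambda>F. S \<subseteq> F) = prb S (\<lambda>F. S \<subseteq> F)" by (rule prb_restrict[OF assms]) auto
  also have "\<dots> = (\<Sum>F\<in>{S}. wt S F * of_bool (S \<subseteq> F))"
    unfolding prb_def using finite_subset[OF assms(2,1)] by (intro sum.mono_neutral_right) auto
  finally show ?thesis by (simp add: wt_def)
qed

lemma prb_avoid: assumes "finite I" "S \<subseteq> I" shows "prb I (\<lambda>F. F \<inter> S = {}) = (1 - p) ^ card S"
proof -
  have "prb I (\<lambda>F. F \<inter> S = {}) = prb S (\<lambda>F. F \<inter> S = {})" by (rule prb_restrict[OF assms]) auto
  also have "\<dots> = (\<Sum>F\<in>{{}}. wt S F * of_bool (F \<inter> S = {}))"
    unfolding prb_def using finite_subset[OF assms(2,1)] by (intro sum.mono_neutral_right) auto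
  finally show ?thesis by (simp add: wt_def)
qed

lemma prb_mem: assumes "finite I" "e \<in> I" shows "prb I (\<lambda>F. e \<in> F) = p"
  using prb_supset[of I "{e}"] assms by simp

lemma prb_hit: assumes "finite I" "S \<subseteq> I" shows "prb I (\<lambda>F. F \<inter> S \<noteq> {}) = 1 - (1 - p) ^ card S"
  using prb_not[OF assms(1), of "\<lambda>F. F \<inter> S = {}"] prb_avoid[OF assms] by simp

text \<open>The lower tail of the binomial distribution, by exponential tilting.\<close>
lemma prb_card_le:
  assumes "finite I" "S \<subseteq> I" "0 < z" "z \<le> 1"
  shows "prb I (\<lambda>F. card (F \<inter> S) \<le> k) \<le> (1 - p + p * z) ^ card S / z ^ k"
proof -
  have fS: "finite S" using assms finite_subset by blast
  have "prb I (\<lambda>F. card (F \<inter> S) \<le> k) = prb S (\<lambda>F. card (F \<inter> S) \<le> k)"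
    by (rule prb_restrict[OF assms(1,2)]) (simp add: Int_assoc)
  also have "\<dots> \<le> (\<Sum>F\<in>Pow S. wt S F * z ^ card F / z ^ k)"
    unfolding prb_def
  proof (intro sum_mono)
    fix F assume "F \<in> Pow S"
    then have "F \<inter> S = F" by auto
    moreover have "1 \<le> z ^ card F / z ^ k" if "card F \<le> k"
      using power_decreasing[OF that, of z] assms(3,4) by simp
    ultimately show "wt S F * of_bool (card (F \<inter> S) \<le> k) \<le> wt S F * z ^ card F / z ^ k"
      using wt_nonneg[of S F] mult_left_mono[of 1 "z ^ card F / z ^ k" "wt S F"] assms(3) by auto
  qed
  also have "\<dots> = (1 - p + p * z) ^ card S / z ^ k"
    using sum_wt[OF fS, of z] by (simp add: sum_divide_distrib[symmetric])
  finally show ?thesis .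
qed

lemma prb_card_ge:
  assumes "finite I" "S \<subseteq> I" "1 \<le> z"
  shows "prb I (\<lambda>F. k \<le> card (F \<inter> S)) \<le> (1 - p + p * z) ^ card S / z ^ k"
proof -
  have fS: "finite S" using assms finite_subset by blast
  have "prb I (\<lambda>F. k \<le> card (F \<inter> S)) = prb S (\<lambda>F. k \<le> card (F \<inter> S))"
    by (rule prb_restrict[OF assms(1,2)]) (simp add: Int_assoc)
  also have "\<dots> \<le> (\<Sum>F\<in>Pow S. wt S F * z ^ card F / z ^ k)"
    unfolding prb_def
  proof (intro sum_mono)
    fix F assume "F \<in> Pow S"
    then have "F \<inter> S = F" by auto
    moreover have "1 \<le> z ^ card F / z ^ k" if "k \<le> card F"
      using power_increasing[OF that, of z] assms(3) by simp
    ultimately show "wt S F * of_bool (k \<le> card (F \<inter> S)) \<le> wt S F * z ^ card F / z ^ k"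
      using wt_nonneg[of S F] mult_left_mono[of 1 "z ^ card F / z ^ k" "wt S F"] assms(3) by auto
  qed
  also have "\<dots> = (1 - p + p * z) ^ card S / z ^ k"
    using sum_wt[OF fS, of z] by (simp add: sum_divide_distrib[symmetric])
  finally show ?thesis .
qed

lemma prob_gnp:
  "measure_pmf.prob (gnp n p) {G. P G} = prb (pairs {1..n}) (\<lambda>F. P ({1..n}, F))"
proof -
  let ?I = "pairs {1..n}"
  let ?M = "Pi_pmf ?I False (\<lambda>_. bernoulli_pmf p)"
  have fI: "finite ?I" by (simp add: finite_pairs)
  have single: "measure_pmf.prob ?M {\<omega>. {e \<in> ?I. \<omega> e} = F} = wt ?I F" if F: "F \<subseteq> ?I" for F
  proof -
    have fF: "finite F" using F fI finite_subset by blast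
    have "{\<omega>. {e \<in> ?I. \<omega> e} = F} = Pi ?I (\<lambda>e. {e \<in> F})" using F by (auto simp: Pi_def)
    then have "measure_pmf.prob ?M {\<omega>. {e \<in> ?I. \<omega> e} = F} = (\<Prod>e\<in>?I. measure_pmf.prob (bernoulli_pmf p) {e \<in> F})"
      using measure_Pi_pmf_Pi[OF fI] by simp
    also have "\<dots> = (\<Prod>e\<in>?I. if e \<in> F then p else 1 - p)"
      using p0 p1 by (intro prod.cong) (auto simp: measure_pmf_single)
    also have "\<dots> = (\<Prod>e\<in>F. p) * (\<Prod>e\<in>?I - F. 1 - p)"
    proof -
      have "?I \<inter> {e. e \<in> F} = F" "?I \<inter> - {e. e \<in> F} = ?I - F" using F by auto
      then show ?thesis using fI by (simp add: prod.If_cases)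
    qed
    finally show ?thesis by (simp add: wt_def)
  qed
  have "measure_pmf.prob (gnp n p) {G. P G} = measure_pmf.prob ?M {\<omega>. P ({1..n}, {e \<in> ?I. \<omega> e})}"
    by (simp add: gnp_def vimage_def)
  also have "{\<omega>. P ({1..n}, {e \<in> ?I. \<omega> e})} = (\<Union>F\<in>{F \<in> Pow ?I. P ({1..n}, F)}. {\<omega>. {e \<in> ?I. \<omega> e} = F})"
    by auto
  also have "measure_pmf.prob ?M \<dots> = (\<Sum>F\<in>{F \<in> Pow ?I. P ({1..n}, F)}. measure_pmf.prob ?M {\<omega>. {e \<in> ?I. \<omega> e} = F})"
    using fI by (intro measure_pmf.finite_measure_finite_Union) (auto simp: disjoint_family_on_def)
  also have "\<dots> = (\<Sum>F\<in>{F \<in> Pow ?I. P ({1..n}, F)}. wt ?I F)"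
    using single by (intro sum.cong) auto
  also have "\<dots> = prb ?I (\<lambda>F. P ({1..n}, F))"
    unfolding prb_def using fI by (intro sum.mono_neutral_cong_left) auto
  finally show ?thesis .
qed

end

section \<open>Below the threshold\<close>

definition spokes :: "'a set \<Rightarrow> 'a set \<Rightarrow> 'a set set" where
  "spokes A W = {{x, a} | x a. x \<in> A \<and> a \<in> W}"

lemma spokes_disjoint:
  assumes "A \<inter> A' = {} \<or> W \<inter> W' = {}" "A \<inter> W' = {}"
  shows "spokes A W \<inter> spokes A' W' = {}"
proof (rule ccontr)
  assume "spokes A W \<inter> spokes A' W' \<noteq> {}"
  then obtain x a y b where "{x, a} = {y, b}" "x \<in> A" "a \<in> W" "y \<in> A'" "b \<in> W'"
    by (auto simp: spokes_def)
  then show False using assms by (auto simp: doubleton_eq_iff)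
qed

context coin begin

lemma prb_markov:
  assumes I: "finite I" and X: "finite X" and x: "0 < x"
  shows "prb I (\<lambda>F. x \<le> real (card {t \<in> X. A t F})) \<le> (\<Sum>t\<in>X. prb I (A t)) / x"
proof -
  have "x * prb I (\<lambda>F. x \<le> real (card {t \<in> X. A t F})) \<le> (\<Sum>F\<in>Pow I. wt I F * real (card {t \<in> X. A t F}))"
    unfolding prb_def sum_distrib_left
  proof (intro sum_mono)
    fix F
    have "wt I F * (x * of_bool (x \<le> real (card {t \<in> X. A t F}))) \<le> wt I F * real (card {t \<in> X. A t F})"
      by (intro mult_left_mono wt_nonneg) auto
    then show "x * (wt I F * of_bool (x \<le> real (card {t \<in> X. A t F}))) \<le> wt I F * real (card {t \<in> X. A t F})"
      by (simp add: mult_ac)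
  qed
  also have "\<dots> = (\<Sum>F\<in>Pow I. \<Sum>t\<in>X. wt I F * of_bool (A t F))"
    using X by (intro sum.cong refl) (simp add: sum_distrib_left[symmetric] of_bool_def sum.If_cases Int_def)
  also have "\<dots> = (\<Sum>t\<in>X. prb I (A t))" unfolding prb_def by (rule sum.swap)
  finally show ?thesis using x by (simp add: field_simps)
qed

text \<open>First moment bound for dense vertex sets containing a given set.\<close>
lemma prb_dense_set:
  assumes V: "finite V" "card V = n" and W0: "W0 \<subseteq> V" "card W0 = w0" "w0 \<le> v"
  shows "prb (pairs V) (\<lambda>F. \<exists>W\<subseteq>V. W0 \<subseteq> W \<and> card W = v \<and> k \<le> card (F \<inter> pairs W))
    \<le> real n ^ (v - w0) * 2 ^ (v * v) * p ^ k"
proof -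
  let ?I = "pairs V"
  let ?WW = "{W. W \<subseteq> V \<and> W0 \<subseteq> W \<and> card W = v}"
  let ?SS = "\<lambda>W. {S. S \<subseteq> pairs W \<and> card S = k}"
  have fI: "finite ?I" by (rule finite_pairs[OF V(1)])
  have fW0: "finite W0" using W0(1) V(1) finite_subset by blast
  have fWW: "finite ?WW" using V(1) by simp
  have one: "prb ?I (\<lambda>F. k \<le> card (F \<inter> pairs W)) \<le> 2 ^ (v * v) * p ^ k" if W: "W \<in> ?WW" for W
  proof -
    have fW: "finite W" using W V(1) finite_subset by blast
    have PW: "pairs W \<subseteq> ?I" using W by (auto simp: pairs_def)
    have fSS: "finite (?SS W)" using finite_pairs[OF fW] by simp
    have "prb ?I (\<lambda>F. k \<le> card (F \<inter> pairs W)) \<le> prb ?I (\<lambda>F. \<exists>S\<in>?SS W. S \<subseteq> F)"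
    proof (rule prb_mono)
      fix F assume "k \<le> card (F \<inter> pairs W)"
      then obtain S where "S \<subseteq> F \<inter> pairs W" "card S = k" by (meson obtain_subset_with_card_n)
      then show "\<exists>S\<in>?SS W. S \<subseteq> F" by blast
    qed
    also have "\<dots> \<le> real (card (?SS W)) * p ^ k"
    proof (rule prb_union_le[OF fSS])
      fix S assume S: "S \<in> ?SS W"
      then have "prb ?I (\<lambda>F. S \<subseteq> F) = p ^ card S" using PW by (intro prb_supset[OF fI]) auto
      then show "prb ?I (\<lambda>F. S \<subseteq> F) \<le> p ^ k" using S by simp
    qed
    also have "\<dots> \<le> 2 ^ (v * v) * p ^ k"
    proof (rule mult_right_mono)
      have "card (?SS W) \<le> card (Pow (pairs W))" using finite_pairs[OF fW] by (intro card_mono) auto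
      also have "\<dots> = 2 ^ (v choose 2)" using card_pairs[OF fW] W by (simp add: card_Pow finite_pairs[OF fW])
      also have "\<dots> \<le> 2 ^ (v * v)"
        by (intro power_increasing) (auto simp: choose_two intro: order_trans[OF div_le_dividend])
      finally have "real (card (?SS W)) \<le> real (2 ^ (v * v))" by (rule of_nat_mono)
      then show "real (card (?SS W)) \<le> 2 ^ (v * v)" by simp
    qed (use p0 in simp)
    finally show ?thesis .
  qed
  have "prb ?I (\<lambda>F. \<exists>W\<subseteq>V. W0 \<subseteq> W \<and> card W = v \<and> k \<le> card (F \<inter> pairs W))
      \<le> prb ?I (\<lambda>F. \<exists>W\<in>?WW. k \<le> card (F \<inter> pairs W))" by (intro prb_mono) auto
  also have "\<dots> \<le> real (card ?WW) * (2 ^ (v * v) * p ^ k)" by (rule prb_union_le[OF fWW one])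
  also have "\<dots> \<le> real n ^ (v - w0) * (2 ^ (v * v) * p ^ k)"
  proof (rule mult_right_mono)
    have "inj_on (\<lambda>W. W - W0) ?WW" by (intro inj_onI) auto
    moreover have "(\<lambda>W. W - W0) ` ?WW \<subseteq> {U. U \<subseteq> V \<and> card U = v - w0}"
      using W0 fW0 by (auto simp: card_Diff_subset)
    ultimately have "card ?WW \<le> card {U. U \<subseteq> V \<and> card U = v - w0}"
      using V(1) by (intro card_inj_on_le) auto
    also have "\<dots> = n choose (v - w0)" using n_subsets[OF V(1)] V(2) by simp
    also have "\<dots> \<le> n ^ (v - w0)" by (rule binomial_le_power)
    finally show "real (card ?WW) \<le> real n ^ (v - w0)" by (metis of_nat_mono of_nat_power)
  qed (use p0 in simp)
  finally show ?thesis by (simp add: mult.assoc)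
qed

lemma prb_common_neighbour:
  assumes V: "finite V" and W: "W \<subseteq> V" and xy: "x \<in> V" "y \<in> V" "x \<noteq> y" "x \<notin> W" "y \<notin> W"
  shows "1 - (1 - p\<^sup>2) ^ card W \<le> prb (pairs V) (\<lambda>F. \<exists>a\<in>W. {x, a} \<in> F \<and> {y, a} \<in> F)"
proof -
  let ?I = "pairs V"
  have fI: "finite ?I" by (rule finite_pairs[OF V])
  have fW: "finite W" using W V finite_subset by blast
  let ?J = "\<lambda>a. {{x, a}, {y, a}}"
  have "prb ?I (\<lambda>F. \<forall>a\<in>W. \<not> ?J a \<subseteq> F) \<le> (1 - p\<^sup>2) ^ card W"
  proof (rule prb_all_fail[OF fI fW, where J = ?J])
    fix a assume a: "a \<in> W"
    show "?J a \<subseteq> ?I" using a W xy by auto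
    then have "prb ?I (\<lambda>F. ?J a \<subseteq> F) = p ^ card (?J a)" by (rule prb_supset[OF fI])
    moreover have "card (?J a) = 2" using a xy by (auto simp: card_2_iff doubleton_eq_iff)
    ultimately show "p\<^sup>2 \<le> prb ?I (\<lambda>F. ?J a \<subseteq> F)" by simp
    fix b assume "b \<in> W" "a \<noteq> b"
    then show "?J a \<inter> ?J b = {}" using a xy by (auto simp: doubleton_eq_iff)
  qed auto
  moreover have "prb ?I (\<lambda>F. \<exists>a\<in>W. {x, a} \<in> F \<and> {y, a} \<in> F) = 1 - prb ?I (\<lambda>F. \<not> (\<exists>a\<in>W. {x, a} \<in> F \<and> {y, a} \<in> F))"
    using prb_not[OF fI, of "\<lambda>F. \<not> (\<exists>a\<in>W. {x, a} \<in> F \<and> {y, a} \<in> F)"] by simp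
  ultimately show ?thesis by simp
qed

text \<open>Very sparse case: an isolated vertex rules out a spanning tree. For \<open>k\<close> vertices
  that span no edge, the events of having no neighbour outside are independent.\<close>
lemma prb_tree_very_sparse:
  assumes n: "2 \<le> n" and k: "k \<le> n"
  shows "prb (pairs {1..n}) (\<lambda>F. tree_activates ({1..n}, F)) \<le> real k ^ 2 * p + (1 - (1 - p) ^ n) ^ k"
proof -
  let ?V = "{1..n}" and ?A = "{1..k}"
  let ?I = "pairs ?V"
  have fI: "finite ?I" by (simp add: finite_pairs)
  define star where "star a = (\<lambda>v. {a, v}) ` (?V - ?A)" for a
  have sub: "star a \<subseteq> ?I" if "a \<in> ?A" for a using that k by (auto simp: star_def)
  have isol: "\<exists>v. {a, v} \<in> F" if T: "tree_activates (?V, F)" "a \<in> ?A" for F a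
  proof -
    obtain T where T': "is_tree T" "activates T (?V, F)" using T by (auto simp: tree_activates_def)
    then have b: "edges T \<subseteq> F" "verts T = ?V"
      using bootstrap_mono[of T "(?V, F)"] by (auto simp: activates_def spanning_subgraph_def)
    define c where "c = (if a = 1 then 2 else 1 :: nat)"
    have c: "c \<in> ?V" "c \<noteq> a" "a \<in> ?V" using n that k by (auto simp: c_def)
    then have "conn (edges T) c a" using T'(1) b(2) by (auto simp: is_tree_def connected_graph_conn)
    then have "c \<noteq> a \<longrightarrow> (\<exists>v. {a, v} \<in> edges T)"
    proof (induction rule: conn_induct)
      case (step y z)
      then have "{z, y} \<in> edges T" by (simp add: insert_commute)
      then show ?case by blast
    qed simp
    then show ?thesis using c b by blast
  qed
  have "prb ?I (\<lambda>F. tree_activates (?V, F)) \<le>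
      prb ?I (\<lambda>F. (\<exists>e\<in>pairs ?A. e \<in> F) \<or> (\<forall>a\<in>?A. \<not> F \<inter> star a = {}))"
  proof (rule prb_mono)
    fix F assume F: "F \<subseteq> ?I" "tree_activates (?V, F)"
    show "(\<exists>e\<in>pairs ?A. e \<in> F) \<or> (\<forall>a\<in>?A. \<not> F \<inter> star a = {})"
    proof (rule disjCI)
      assume n: "\<not> (\<forall>a\<in>?A. \<not> F \<inter> star a = {})"
      then obtain a where a: "a \<in> ?A" "F \<inter> star a = {}" by blast
      obtain v where v: "{a, v} \<in> F" using isol[OF F(2) a(1)] by blast
      then have "{a, v} \<in> ?I" using F(1) by blast
      then have "v \<in> ?V" "v \<noteq> a" by auto
      then have "v \<in> ?A" using v a(2) by (auto simp: star_def)
      then have "{a, v} \<in> pairs ?A" using a(1) \<open>v \<noteq> a\<close> by simp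
      then show "\<exists>e\<in>pairs ?A. e \<in> F" using v by blast
    qed
  qed
  also have "\<dots> \<le> prb ?I (\<lambda>F. \<exists>e\<in>pairs ?A. e \<in> F) + prb ?I (\<lambda>F. \<forall>a\<in>?A. \<not> F \<inter> star a = {})"
    by (rule prb_disj)
  also have "prb ?I (\<lambda>F. \<exists>e\<in>pairs ?A. e \<in> F) \<le> real (card (pairs ?A)) * p"
  proof (rule prb_union_le)
    fix e assume "e \<in> pairs ?A"
    then have "e \<in> ?I" using k by (auto simp: pairs_def)
    then show "prb ?I (\<lambda>F. e \<in> F) \<le> p" using prb_mem[OF fI] by simp
  qed (simp add: finite_pairs)
  also have "real (card (pairs ?A)) * p \<le> real k ^ 2 * p"
  proof (rule mult_right_mono[OF _ p0])
    have "card (pairs ?A) \<le> k ^ 2" using card_pairs[of ?A] binomial_le_power[of k 2] by simp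
    then show "real (card (pairs ?A)) \<le> real k ^ 2" by (metis of_nat_mono of_nat_power)
  qed
  also have "prb ?I (\<lambda>F. \<forall>a\<in>?A. \<not> F \<inter> star a = {}) \<le> (1 - (1 - p) ^ n) ^ card ?A"
  proof (rule prb_all_fail[OF fI, where J = star])
    fix a assume a: "a \<in> ?A"
    show "star a \<subseteq> ?I" by (rule sub[OF a])
    have "card (star a) \<le> card (?V - ?A)" unfolding star_def by (rule card_image_le) simp
    also have "\<dots> \<le> n" using card_mono[of ?V "?V - ?A"] by simp
    finally have "card (star a) \<le> n" .
    then have "(1 - p) ^ n \<le> (1 - p) ^ card (star a)" using p0 p1 by (intro power_decreasing) auto
    then show "(1 - p) ^ n \<le> prb ?I (\<lambda>F. F \<inter> star a = {})" using prb_avoid[OF fI sub[OF a]] by simp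
    fix b assume "b \<in> ?A" "a \<noteq> b"
    then show "star a \<inter> star b = {}" using a by (auto simp: star_def doubleton_eq_iff)
  qed auto
  finally show ?thesis by simp
qed

text \<open>Intermediate case: there are fewer triangles than edges outside a tree, because the expected
  number of triangles is smaller than that of edges by a factor of order \<open>n * p\<^sup>2\<close>.\<close>
lemma prb_tree_few_triangles:
  assumes n: "2 \<le> n" and np: "8 \<le> real n * p"
  shows "prb (pairs {1..n}) (\<lambda>F. tree_activates ({1..n}, F)) \<le>
    exp (- 3 / 5 * (real n - 1)) + 4 / 3 * (real n * p\<^sup>2)"
proof -
  let ?V = "{1..n}"
  let ?I = "pairs ?V"
  let ?T = "{t. t \<subseteq> ?V \<and> card t = 3}"
  have fI: "finite ?I" by (simp add: finite_pairs)
  have fT: "finite ?T" by simp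
  have p_pos: "0 < p" using np n p0 by (cases "p = 0") auto
  define N where "N = card ?I"
  have N: "real N = real n * (real n - 1) / 2"
  proof -
    have "N = n * (n - 1) div 2" unfolding N_def using card_pairs[of ?V] by (simp add: choose_two)
    moreover have "even (n * (n - 1))" by (cases "even n") auto
    ultimately have "real N = real (n * (n - 1)) / 2" by (simp add: real_of_nat_div)
    then show ?thesis using n by (simp add: of_nat_diff)
  qed
  \<comment> \<open>A quarter of the expected number of edges. Then \<open>2 * x\<close> edges are very likely, while at most
    \<open>n - 1 \<le> x\<close> of them belong to the tree.\<close>
  define x where "x = real n * (real n - 1) * p / 8"
  have x: "0 < x" "real n - 1 \<le> x"
  proof -
    show "0 < x" using n p_pos by (simp add: x_def)
    have "(real n - 1) * 8 \<le> (real n - 1) * (real n * p)" using n np by (intro mult_left_mono) auto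
    then show "real n - 1 \<le> x" by (simp add: x_def mult_ac)
  qed
  have Np: "real N * p = 4 * x" by (simp add: N x_def)
  define k where "k = nat \<lfloor>2 * x\<rfloor>"
  have k: "real k \<le> 2 * x" "2 * x < real k + 1" using x by (auto simp: k_def)
  have "prb ?I (\<lambda>F. tree_activates (?V, F)) \<le>
      prb ?I (\<lambda>F. card (F \<inter> ?I) \<le> k \<or> x \<le> real (card {t \<in> ?T. pairs t \<subseteq> F}))"
  proof (rule prb_mono)
    fix F assume F: "F \<subseteq> ?I" "tree_activates (?V, F)"
    have "card F + 1 \<le> n + card (triangles ?V F)" using tree_activates_triangles[OF F(2)] by simp
    then have "real (card F) + 1 \<le> real n + real (card (triangles ?V F))" by linarith
    moreover have "triangles ?V F = {t \<in> ?T. pairs t \<subseteq> F}" by (auto simp: triangles_def)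
    ultimately have c: "real (card F) + 1 \<le> real n + real (card {t \<in> ?T. pairs t \<subseteq> F})" by simp
    show "card (F \<inter> ?I) \<le> k \<or> x \<le> real (card {t \<in> ?T. pairs t \<subseteq> F})"
    proof (rule disjCI)
      assume "\<not> x \<le> real (card {t \<in> ?T. pairs t \<subseteq> F})"
      then have "real (card F) < 2 * x" using c x by linarith
      then have "card F \<le> k" using k(2) by linarith
      moreover have "F \<inter> ?I = F" using F(1) by auto
      ultimately show "card (F \<inter> ?I) \<le> k" by simp
    qed
  qed
  also have "\<dots> \<le> prb ?I (\<lambda>F. card (F \<inter> ?I) \<le> k) + prb ?I (\<lambda>F. x \<le> real (card {t \<in> ?T. pairs t \<subseteq> F}))"
    by (rule prb_disj)
  also have "prb ?I (\<lambda>F. card (F \<inter> ?I) \<le> k) \<le> exp (- 3 / 5 * (real n - 1))"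
  proof -
    have "prb ?I (\<lambda>F. card (F \<inter> ?I) \<le> k) \<le> (1 - p + p * (1/2)) ^ N / (1/2) ^ k"
      unfolding N_def by (rule prb_card_le[OF fI]) auto
    also have "\<dots> \<le> exp (- (p / 2)) ^ N * 2 ^ k"
    proof -
      have "1 - p + p * (1/2) \<le> exp (- (p / 2))" using exp_ge_add_one_self[of "- (p / 2)"] by simp
      then have "(1 - p + p * (1/2)) ^ N \<le> exp (- (p / 2)) ^ N" using p1 p0 by (intro power_mono) auto
      then show ?thesis by (simp add: power_divide mult_right_mono)
    qed
    also have "exp (- (p / 2)) ^ N = exp (- (2 * x))"
      using Np by (simp add: exp_of_nat_mult[symmetric] mult_ac)
    also have "(2 :: real) ^ k = exp (ln 2 * real k)" by (simp add: exp_of_nat2_mult)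
    also have "\<dots> \<le> exp (7 / 10 * (2 * x))"
    proof -
      have "ln 2 \<le> (7 / 10 :: real)" using ln2_le_25_over_36 by simp
      then have "ln 2 * real k \<le> 7 / 10 * (2 * x)" using k(1) by (intro mult_mono) auto
      then show ?thesis by simp
    qed
    finally have "prb ?I (\<lambda>F. card (F \<inter> ?I) \<le> k) \<le> exp (- (2 * x)) * exp (7 / 10 * (2 * x))" by simp
    also have "\<dots> = exp (- 3 / 5 * x)" by (simp add: exp_add[symmetric])
    also have "\<dots> \<le> exp (- 3 / 5 * (real n - 1))" using x(2) by simp
    finally show ?thesis .
  qed
  also have "prb ?I (\<lambda>F. x \<le> real (card {t \<in> ?T. pairs t \<subseteq> F})) \<le> 4 / 3 * (real n * p\<^sup>2)"
  proof -
    have "prb ?I (\<lambda>F. x \<le> real (card {t \<in> ?T. pairs t \<subseteq> F})) \<le> (\<Sum>t\<in>?T. prb ?I (\<lambda>F. pairs t \<subseteq> F)) / x"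
      by (rule prb_markov[OF fI fT x(1)])
    also have "(\<Sum>t\<in>?T. prb ?I (\<lambda>F. pairs t \<subseteq> F)) = (\<Sum>t\<in>?T. p ^ 3)"
    proof (rule sum.cong[OF refl])
      fix t assume t: "t \<in> ?T"
      have ft: "finite t" using t finite_subset by blast
      have "card (pairs t) = 3" using card_pairs[OF ft] t by (simp add: choose_two)
      moreover have "pairs t \<subseteq> ?I" using t by (auto simp: pairs_def)
      ultimately show "prb ?I (\<lambda>F. pairs t \<subseteq> F) = p ^ 3" using prb_supset[OF fI] by simp
    qed
    also have "\<dots> = real (n choose 3) * p ^ 3" using n_subsets[of ?V 3] by simp
    also have "\<dots> \<le> real n * (real n - 1) * real n / 6 * p ^ 3"
    proof (rule mult_right_mono)
      have "(n choose 3) * 6 \<le> n * (n - 1) * n"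
      proof -
        have "3 * (n choose 3) = n * ((n - 1) choose 2)" using times_binomial_minus1_eq[of 3 n] by simp
        moreover have "2 * ((n - 1) choose 2) \<le> (n - 1) * (n - 2)"
        proof -
          have "n - 1 - 1 = n - 2" by simp
          then show ?thesis unfolding choose_two by simp
        qed
        then have "n * (2 * ((n - 1) choose 2)) \<le> n * ((n - 1) * (n - 2))" by (rule mult_le_mono2)
        ultimately have "6 * (n choose 3) \<le> n * ((n - 1) * (n - 2))" by linarith
        also have "\<dots> \<le> n * ((n - 1) * n)" by (intro mult_le_mono2) simp
        finally show ?thesis by (simp add: mult_ac)
      qed
      then have "real ((n choose 3) * 6) \<le> real (n * (n - 1) * n)" by (rule of_nat_mono)
      then show "real (n choose 3) \<le> real n * (real n - 1) * real n / 6" using n by (simp add: of_nat_diff)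
    qed (use p0 in simp)
    also have "real n * (real n - 1) * real n / 6 * p ^ 3 / x = 4 / 3 * (real n * p\<^sup>2)"
      using n p_pos by (simp add: x_def field_simps power2_eq_square power3_eq_cube)
    finally show ?thesis using x(1) by (simp add: divide_right_mono)
  qed
  finally show ?thesis by simp
qed

text \<open>Union bound over the vertex sets that violate local sparsity. Those of size \<open>v\<close> contribute about
  \<open>n\<close> to the power \<open>v * (1 - (1/3 + \<epsilon>) * (3 - 3 * \<epsilon>))\<close>, which is negative.\<close>
lemma prb_not_locally_sparse:
  assumes n: "1 \<le> n" and e: "0 < \<epsilon>" "\<epsilon> \<le> 1 / 3" and p: "p \<le> real n powr (- 1 / 3 - \<epsilon>)"
  shows "prb (pairs {1..n}) (\<lambda>F. \<not> locally_sparse (3 * \<epsilon>) L F) \<le> real L * 2 ^ (L * L) * real n powr (- \<epsilon>)"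
proof -
  let ?V = "{1..n}"
  let ?I = "pairs ?V"
  define k where "k v = nat \<lfloor>(3 - 3 * \<epsilon>) * real v\<rfloor> + 1" for v
  define E where "E v F \<longleftrightarrow> (\<exists>W\<subseteq>?V. {} \<subseteq> W \<and> card W = v \<and> k v \<le> card (F \<inter> pairs W))" for v F
  have "prb ?I (\<lambda>F. \<not> locally_sparse (3 * \<epsilon>) L F) \<le> prb ?I (\<lambda>F. \<exists>v\<in>{1..L}. E v F)"
  proof (rule prb_mono)
    fix F assume F: "F \<subseteq> ?I" "\<not> locally_sparse (3 * \<epsilon>) L F"
    then obtain W where W: "finite W" "W \<noteq> {}" "card W \<le> L"
      "(3 - 3 * \<epsilon>) * real (card W) < real (card (F \<inter> pairs W))" by (auto simp: locally_sparse_def not_le)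
    define W' where "W' = W \<inter> ?V"
    have FW: "F \<inter> pairs W = F \<inter> pairs W'" using F(1) by (auto simp: W'_def pairs_def)
    have cW: "card W' \<le> card W" unfolding W'_def using W(1) by (intro card_mono) auto
    have "(3 - 3 * \<epsilon>) * real (card W') \<le> (3 - 3 * \<epsilon>) * real (card W)" using cW e by (intro mult_left_mono) auto
    then have lt: "(3 - 3 * \<epsilon>) * real (card W') < real (card (F \<inter> pairs W'))" using W(4) FW by simp
    have "k (card W') \<le> card (F \<inter> pairs W')"
    proof -
      have "0 \<le> (3 - 3 * \<epsilon>) * real (card W')" using e by simp
      then have "real (nat \<lfloor>(3 - 3 * \<epsilon>) * real (card W')\<rfloor>) \<le> (3 - 3 * \<epsilon>) * real (card W')" by simp
      then show ?thesis using lt unfolding k_def by linarith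
    qed
    moreover have "W' \<noteq> {}"
    proof
      assume "W' = {}"
      then have "pairs W' = {}" by (auto simp: pairs_def)
      then show False using lt \<open>W' = {}\<close> by simp
    qed
    then have "card W' \<in> {1..L}" using cW W(1,3) by (auto simp: W'_def Suc_le_eq card_gt_0_iff)
    ultimately show "\<exists>v\<in>{1..L}. E v F" unfolding E_def
      by (intro bexI[of _ "card W'"] exI[of _ W']) (auto simp: W'_def)
  qed
  also have "\<dots> \<le> real (card {1..L}) * (2 ^ (L * L) * real n powr (- \<epsilon>))"
  proof (rule prb_union_le)
    fix v assume v: "v \<in> {1..L}"
    have "prb ?I (E v) \<le> real n ^ (v - 0) * 2 ^ (v * v) * p ^ k v"
      unfolding E_def by (rule prb_dense_set) auto
    also have "\<dots> = 2 ^ (v * v) * (real n ^ v * p ^ k v)" by simp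
    also have "\<dots> \<le> 2 ^ (L * L) * real n powr (- \<epsilon>)"
    proof (rule mult_mono)
      show "(2 :: real) ^ (v * v) \<le> 2 ^ (L * L)" using v by (intro power_increasing mult_le_mono) auto
      define q where "q = real n powr (- 1 / 3 - \<epsilon>)"
      have q: "0 < q" "q \<le> 1" using n e powr_mono[of "- 1 / 3 - \<epsilon>" 0 "real n"] by (auto simp: q_def)
      have "p ^ k v \<le> q ^ k v" using p p0 by (intro power_mono) (auto simp: q_def)
      also have "\<dots> = q powr real (k v)" using q by (simp add: powr_realpow)
      also have "\<dots> \<le> q powr ((3 - 3 * \<epsilon>) * real v)"
      proof (rule powr_mono')
        show "(3 - 3 * \<epsilon>) * real v \<le> real (k v)" unfolding k_def by linarith
      qed (use q in auto)
      also have "\<dots> = real n powr ((- 1 / 3 - \<epsilon>) * ((3 - 3 * \<epsilon>) * real v))" by (simp add: q_def powr_powr)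
      finally have "real n ^ v * p ^ k v \<le> real n powr real v * real n powr ((- 1 / 3 - \<epsilon>) * ((3 - 3 * \<epsilon>) * real v))"
        using n by (intro mult_mono) (auto simp: powr_realpow p0)
      also have "\<dots> = real n powr (real v * (1 + (- 1 / 3 - \<epsilon>) * (3 - 3 * \<epsilon>)))"
        by (simp add: powr_add[symmetric] algebra_simps)
      also have "\<dots> \<le> real n powr (- \<epsilon>)"
      proof (rule powr_mono)
        have "1 + (- 1 / 3 - \<epsilon>) * (3 - 3 * \<epsilon>) = - 2 * \<epsilon> + 3 * \<epsilon> * \<epsilon>" by (simp add: algebra_simps)
        also have "\<dots> \<le> - \<epsilon>" using mult_left_mono[of "3 * \<epsilon>" 1 \<epsilon>] e by simp
        finally have "real v * (1 + (- 1 / 3 - \<epsilon>) * (3 - 3 * \<epsilon>)) \<le> real v * - \<epsilon>" by (intro mult_left_mono) auto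
        also have "\<dots> \<le> - \<epsilon>" using v e by simp
        finally show "real v * (1 + (- 1 / 3 - \<epsilon>) * (3 - 3 * \<epsilon>)) \<le> - \<epsilon>" .
      qed (use n in auto)
      finally show "real n ^ v * p ^ k v \<le> real n powr (- \<epsilon>)" .
    qed (use p0 in auto)
    finally show "prb ?I (E v) \<le> 2 ^ (L * L) * real n powr (- \<epsilon>)" .
  qed auto
  finally show ?thesis by (simp add: mult.assoc)
qed

text \<open>Main case. The probes are the possible 4-cycles formed by a root pair \<open>(j, k + j)\<close> with a
  common neighbour in \<open>W1\<close> and one in \<open>W2\<close>. The expected number of probes present is
  \<open>k * (m * p\<^sup>2)\<^sup>2\<close>, and the expected number of those whose vertices lie in a dense bounded set is smaller
  by a factor of order \<open>p\<close>. The root pairs use disjoint sets of edges, so they are independent.\<close>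
lemma prb_tree_main_case:
  assumes n: "1 \<le> n" and e: "0 < \<epsilon>" "\<epsilon> \<le> 1 / 3" and p: "p \<le> real n powr (- 1 / 3 - \<epsilon>)"
    and km: "2 * k + 2 * m \<le> n" and mp: "real m * p\<^sup>2 \<le> 1"
    and N: "800 * (16 / \<epsilon> + 1) * (16 / \<epsilon> + 1) \<le> real N" and L: "96 / \<epsilon> < real L + 1"
  shows "prb (pairs {1..n}) (\<lambda>F. tree_activates ({1..n}, F)) \<le>
     real (3 * N) * 2 ^ (3 * N * (3 * N)) * real n powr (- \<epsilon>)
     + real k * (real m * p\<^sup>2)\<^sup>2 * p * (real L * 2 ^ (L * L))
     + (1 - (real m * p\<^sup>2 / 2)\<^sup>2) ^ k"
proof -
  let ?V = "{1..n}"
  let ?I = "pairs ?V"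
  have fI: "finite ?I" by (simp add: finite_pairs)
  define W1 W2 where "W1 = {2 * k + 1..2 * k + m}" and "W2 = {2 * k + m + 1..2 * k + 2 * m}"
  define R where "R = {1..k} \<times> W1 \<times> W2"
  define A2 where "A2 = (\<lambda>(j, a, b) F. \<exists>v\<in>{4..L}. \<exists>W\<subseteq>?V. {j, k + j, a, b} \<subseteq> W \<and> card W = v \<and> 3 * v - 7 \<le> card (F \<inter> pairs W))"
  define C where "C W j F \<longleftrightarrow> (\<exists>a\<in>W. {j, a} \<in> F \<and> {k + j, a} \<in> F)" for W j F
  have dist: "distinct [j, a, k + j, b]" "{j, k + j, a, b} \<subseteq> ?V" "card {j, k + j, a, b} = 4"
    if "j \<in> {1..k}" "a \<in> W1" "b \<in> W2" for j a b
    using that km by (auto simp: W1_def W2_def)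
  have fR: "finite R" "card R = k * (m * m)" by (auto simp: R_def W1_def W2_def card_cartesian_product)
  have "prb ?I (\<lambda>F. tree_activates (?V, F)) \<le>
     prb ?I (\<lambda>F. (\<not> locally_sparse (3 * \<epsilon>) (3 * N) F \<or> (\<exists>r\<in>R. A2 r F)) \<or> (\<forall>j\<in>{1..k}. \<not> (C W1 j F \<and> C W2 j F)))"
  proof (rule prb_mono)
    fix F assume F: "F \<subseteq> ?I" "tree_activates (?V, F)"
    obtain T where T: "is_tree T" "activates T (?V, F)" using F(2) by (auto simp: tree_activates_def)
    show "(\<not> locally_sparse (3 * \<epsilon>) (3 * N) F \<or> (\<exists>r\<in>R. A2 r F)) \<or> (\<forall>j\<in>{1..k}. \<not> (C W1 j F \<and> C W2 j F))"
    proof (rule disjCI)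
      assume "\<not> (\<forall>j\<in>{1..k}. \<not> (C W1 j F \<and> C W2 j F))"
      then obtain j a b where j: "j \<in> {1..k}" "a \<in> W1" "b \<in> W2"
        "{j, a} \<in> F" "{k + j, a} \<in> F" "{j, b} \<in> F" "{k + j, b} \<in> F" by (auto simp: C_def)
      note d = dist[OF j(1-3)]
      show "\<not> locally_sparse (3 * \<epsilon>) (3 * N) F \<or> (\<exists>r\<in>R. A2 r F)"
      proof (cases "locally_sparse (3 * \<epsilon>) (3 * N) F")
        case sp: True
        have "\<exists>W\<subseteq>?V. {j, a, k + j, b} \<subseteq> W \<and> real (card W) \<le> 288 / (3 * \<epsilon>) \<and> 3 * card W \<le> card (F \<inter> pairs W) + 7"
          by (rule square_has_dense_neighbourhood[OF T sp _ _ _ d(1)])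
            (use e N j in \<open>auto simp: insert_commute\<close>)
        then obtain W where W: "W \<subseteq> ?V" "{j, a, k + j, b} \<subseteq> W" "real (card W) \<le> 96 / \<epsilon>"
          "3 * card W \<le> card (F \<inter> pairs W) + 7" by auto
        have "card W \<le> L" using W(3) L by linarith
        moreover have "4 \<le> card W"
        proof -
          have "{j, k + j, a, b} \<subseteq> W" using W(2) by auto
          then have "card {j, k + j, a, b} \<le> card W" using W(1) by (intro card_mono) (auto intro: finite_subset)
          then show ?thesis using d(3) by simp
        qed
        ultimately have "A2 (j, a, b) F" unfolding A2_def using W
          by (auto intro!: bexI[of _ "card W"] exI[of _ W])
        moreover have "(j, a, b) \<in> R" using j by (simp add: R_def)
        ultimately have "\<exists>r\<in>R. A2 r F" by (rule bexI)
        then show ?thesis ..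
      qed simp
    qed
  qed
  also have "\<dots> \<le> (prb ?I (\<lambda>F. \<not> locally_sparse (3 * \<epsilon>) (3 * N) F) + prb ?I (\<lambda>F. \<exists>r\<in>R. A2 r F))
      + prb ?I (\<lambda>F. \<forall>j\<in>{1..k}. \<not> (C W1 j F \<and> C W2 j F))"
    by (rule order_trans[OF prb_disj]) (intro add_mono prb_disj order_refl)
  also have "prb ?I (\<lambda>F. \<not> locally_sparse (3 * \<epsilon>) (3 * N) F) \<le> real (3 * N) * 2 ^ (3 * N * (3 * N)) * real n powr (- \<epsilon>)"
    by (rule prb_not_locally_sparse[OF n e p])
  also have "prb ?I (\<lambda>F. \<exists>r\<in>R. A2 r F) \<le> real (card R) * (real L * (2 ^ (L * L) * p ^ 5))"
  proof (rule prb_union_le[OF fR(1)])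
    fix r assume "r \<in> R"
    then obtain j a b where r: "r = (j, a, b)" "j \<in> {1..k}" "a \<in> W1" "b \<in> W2" by (auto simp: R_def)
    note d = dist[OF r(2-4)]
    have "prb ?I (A2 r) \<le> real (card {4..L}) * (2 ^ (L * L) * p ^ 5)"
      unfolding A2_def r(1) prod.case
    proof (rule prb_union_le)
      fix v assume v: "v \<in> {4..L}"
      have "prb ?I (\<lambda>F. \<exists>W\<subseteq>?V. {j, k + j, a, b} \<subseteq> W \<and> card W = v \<and> 3 * v - 7 \<le> card (F \<inter> pairs W))
          \<le> real n ^ (v - 4) * 2 ^ (v * v) * p ^ (3 * v - 7)"
        by (rule prb_dense_set) (use d v in auto)
      also have "\<dots> = 2 ^ (v * v) * (real n ^ (v - 4) * p ^ (3 * v - 7))" by simp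
      also have "\<dots> \<le> 2 ^ (L * L) * p ^ 5"
      proof (rule mult_mono)
        show "(2 :: real) ^ (v * v) \<le> 2 ^ (L * L)" using v by (intro power_increasing mult_le_mono) auto
        have np3: "real n * p ^ 3 \<le> 1"
        proof -
          have "p \<le> real n powr (- 1 / 3)" using p powr_mono[of "- 1 / 3 - \<epsilon>" "- 1 / 3" "real n"] n e by simp
          then have "p ^ 3 \<le> (real n powr (- 1 / 3)) ^ 3" using p0 by (intro power_mono) auto
          also have "\<dots> = real n powr (- 1)"
          proof -
            have "real n powr (- 1) = real n powr (- 1 / 3 + - 1 / 3 + - 1 / 3)" by simp
            also have "\<dots> = (real n powr (- 1 / 3)) ^ 3" by (simp only: powr_add power3_eq_cube)
            finally show ?thesis ..
          qed
          also have "\<dots> = 1 / real n" using n by (simp add: powr_minus_divide)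
          finally show ?thesis using n by (simp add: field_simps)
        qed
        obtain w where w: "v = w + 4" using v by (metis atLeastAtMost_iff le_add_diff_inverse2)
        have "real n ^ (v - 4) * p ^ (3 * v - 7) = (real n * p ^ 3) ^ w * p ^ 5"
        proof -
          have "3 * v - 7 = 3 * w + 5" using w by simp
          then show ?thesis using w by (simp add: power_mult_distrib power_mult power_add)
        qed
        also have "\<dots> \<le> 1 * p ^ 5" using np3 p0 by (intro mult_right_mono power_le_one) auto
        finally show "real n ^ (v - 4) * p ^ (3 * v - 7) \<le> p ^ 5" by simp
      qed (use p0 in auto)
      finally show "prb ?I (\<lambda>F. \<exists>W\<subseteq>?V. {j, k + j, a, b} \<subseteq> W \<and> card W = v \<and> 3 * v - 7 \<le> card (F \<inter> pairs W))
        \<le> 2 ^ (L * L) * p ^ 5" .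
    qed auto
    also have "\<dots> \<le> real L * (2 ^ (L * L) * p ^ 5)" using p0 by (intro mult_right_mono) auto
    finally show "prb ?I (A2 r) \<le> real L * (2 ^ (L * L) * p ^ 5)" .
  qed
  also have "real (card R) * (real L * (2 ^ (L * L) * p ^ 5)) = real k * (real m * p\<^sup>2)\<^sup>2 * p * (real L * 2 ^ (L * L))"
    unfolding fR(2) by (simp add: power2_eq_square eval_nat_numeral mult_ac)
  also have "prb ?I (\<lambda>F. \<forall>j\<in>{1..k}. \<not> (C W1 j F \<and> C W2 j F)) \<le> (1 - (real m * p\<^sup>2 / 2)\<^sup>2) ^ card {1..k}"
  proof (rule prb_all_fail[OF fI, where J = "\<lambda>j. spokes {j, k + j} (W1 \<union> W2)"])
    fix j assume j: "j \<in> {1..k}"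
    let ?J = "\<lambda>j W. spokes {j, k + j} W"
    show "?J j (W1 \<union> W2) \<subseteq> ?I"
      using j km by (auto simp: spokes_def W1_def W2_def)
    have W: "j \<notin> W1 \<union> W2" "k + j \<notin> W1 \<union> W2" "W1 \<subseteq> ?V" "W2 \<subseteq> ?V" "j \<in> ?V" "k + j \<in> ?V" "j \<noteq> k + j" "W1 \<inter> W2 = {}"
      using j km by (auto simp: W1_def W2_def)
    have dep: "C W j F = C W j (F \<inter> J)" if "?J j W \<subseteq> J" for F J W
      using that unfolding C_def spokes_def by blast
    have "prb ?I (\<lambda>F. C W1 j F \<and> C W2 j F) = prb ?I (C W1 j) * prb ?I (C W2 j)"
    proof (rule prb_indep2[OF fI, of "?J j W1"])
      show "?J j W1 \<subseteq> ?I" using W by (auto simp: spokes_def)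
      show "C W1 j F = C W1 j (F \<inter> ?J j W1)" for F by (rule dep) simp
      show "C W2 j F = C W2 j (F - ?J j W1)" for F
      proof -
        have "?J j W1 \<inter> ?J j W2 = {}" by (rule spokes_disjoint) (use W in auto)
        then have "?J j W2 \<subseteq> - ?J j W1" by blast
        then show ?thesis using dep[of W2 "- ?J j W1" F] by (simp add: Diff_eq)
      qed
    qed
    moreover have "real m * p\<^sup>2 / 2 \<le> prb ?I (C W j)" if "W = W1 \<or> W = W2" for W
    proof -
      have cW: "card W = m" using that by (auto simp: W1_def W2_def)
      have "(1 - p\<^sup>2) ^ m \<le> exp (- (real m * p\<^sup>2))"
        using p0 p1 by (intro power_le_exp) (auto simp: power_le_one)
      also have "\<dots> \<le> 1 - real m * p\<^sup>2 / 2" using exp_minus_le_half[OF _ mp] by simp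
      finally have "real m * p\<^sup>2 / 2 \<le> 1 - (1 - p\<^sup>2) ^ card W" using cW by simp
      also have "\<dots> \<le> prb ?I (C W j)" unfolding C_def
        by (rule prb_common_neighbour) (use W that in auto)
      finally show ?thesis .
    qed
    then have "(real m * p\<^sup>2 / 2) * (real m * p\<^sup>2 / 2) \<le> prb ?I (C W1 j) * prb ?I (C W2 j)"
      by (intro mult_mono prb_nonneg) auto
    ultimately show "(real m * p\<^sup>2 / 2)\<^sup>2 \<le> prb ?I (\<lambda>F. C W1 j F \<and> C W2 j F)" by (simp add: power2_eq_square)
    show "(C W1 j F \<and> C W2 j F) = (C W1 j (F \<inter> (?J j (W1 \<union> W2))) \<and> C W2 j (F \<inter> (?J j (W1 \<union> W2))))" for F
    proof -
      have "?J j W1 \<subseteq> ?J j (W1 \<union> W2)" "?J j W2 \<subseteq> ?J j (W1 \<union> W2)" by (auto simp: spokes_def)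
      then show ?thesis using dep[of W1 "?J j (W1 \<union> W2)" F] dep[of W2 "?J j (W1 \<union> W2)" F] by blast
    qed
    fix i assume "i \<in> {1..k}" "j \<noteq> i"
    then show "?J j (W1 \<union> W2) \<inter> ?J i (W1 \<union> W2) = {}"
      using j by (intro spokes_disjoint) (auto simp: W1_def W2_def)
  qed auto
  finally show ?thesis by simp
qed

end

text \<open>The three ranges of \<open>p\<close> together give a bound that does not depend on \<open>p\<close>.\<close>
lemma prob_tree_activates_tendsto:
  fixes \<epsilon> :: real
  assumes e: "0 < \<epsilon>" "\<epsilon> \<le> 1 / 3"
  shows "\<exists>b. b \<longlonglongrightarrow> 0 \<and> (\<forall>\<^sub>F n in sequentially. \<forall>p. 0 \<le> p \<longrightarrow> p \<le> 1 \<longrightarrow> p < real n powr (- 1 / 3 - \<epsilon>) \<longrightarrow>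
    measure_pmf.prob (gnp n p) {G. tree_activates G} \<le> b n)"
proof -
  have pw: "x powr a * x powr b = x powr c" if "a + b = c" for x a b c :: real
    using that by (auto simp: powr_add)
  obtain N :: nat where N: "800 * (16 / \<epsilon> + 1) * (16 / \<epsilon> + 1) \<le> real N" using real_arch_simple by blast
  obtain L :: nat where "96 / \<epsilon> \<le> real L" using real_arch_simple by blast
  then have L: "96 / \<epsilon> < real L + 1" by linarith
  define K1 K2 where "K1 = real (3 * N) * 2 ^ (3 * N * (3 * N))" and "K2 = real L * 2 ^ (L * L)"
  \<comment> \<open>The ranges are \<open>n * p \<le> 8\<close>, then \<open>p\<close> up to the power \<open>-3/5\<close> of \<open>n\<close>, and the rest. In the first,
    \<open>exp (-16)\<close> bounds the probability of being isolated from below.\<close>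
  define a where "a n = nat \<lfloor>real n powr (1 / 3)\<rfloor>" for n
  define b1 where "b1 n = 8 * real n powr (- 1 / 3) + (1 - exp (- 16)) ^ a n" for n
  define b2 where "b2 n = exp (- 3 / 5 * (real n - 1)) + 4 / 3 * real n powr (- 1 / 5)" for n
  define b3 where "b3 n = K1 * real n powr (- \<epsilon>) + K2 * real n powr (- 1 / 6) + exp (- (real n powr (1 / 6) - 1) / 4)" for n
  define b where "b n = b1 n + b2 n + b3 n" for n
  have "(\<lambda>n. (1 - exp (- 16)) ^ a n :: real) \<longlonglongrightarrow> 0"
  proof -
    have "filterlim a at_top sequentially" unfolding a_def by real_asymp
    moreover have "(\<lambda>k. (1 - exp (- 16)) ^ k :: real) \<longlonglongrightarrow> 0" by (rule LIMSEQ_power_zero) simp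
    ultimately show ?thesis by (rule filterlim_compose[rotated])
  qed
  moreover have "(\<lambda>n. 8 * real n powr (- 1 / 3)) \<longlonglongrightarrow> 0" by real_asymp
  ultimately have "b1 \<longlonglongrightarrow> 0 + 0" unfolding b1_def by (intro tendsto_add)
  moreover have "b2 \<longlonglongrightarrow> 0" unfolding b2_def by real_asymp
  moreover have "b3 \<longlonglongrightarrow> 0"
  proof -
    have "(\<lambda>n. real n powr (- \<epsilon>)) \<longlonglongrightarrow> 0" using e by real_asymp
    moreover have "(\<lambda>n. real n powr (- 1 / 6)) \<longlonglongrightarrow> 0" by real_asymp
    moreover have "(\<lambda>n. exp (- (real n powr (1 / 6) - 1) / 4)) \<longlonglongrightarrow> 0" by real_asymp
    ultimately have "b3 \<longlonglongrightarrow> 0 + 0 + 0"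
      unfolding b3_def by (intro tendsto_add tendsto_mult_right_zero)
    then show ?thesis by simp
  qed
  ultimately have "b \<longlonglongrightarrow> 0 + 0 + 0 + 0" unfolding b_def by (intro tendsto_add) auto
  then have lim: "b \<longlonglongrightarrow> 0" by simp
  have "\<forall>\<^sub>F n in sequentially. 4 * real n powr (3 / 10) \<le> real n / 4" by real_asymp
  moreover have "\<forall>\<^sub>F n in sequentially. 256 * real n powr (7 / 10) \<le> real n / 4" by real_asymp
  moreover have "\<forall>\<^sub>F n in sequentially. (16 :: nat) \<le> n" by (rule eventually_ge_at_top)
  ultimately have "\<forall>\<^sub>F n in sequentially. \<forall>p. 0 \<le> p \<longrightarrow> p \<le> 1 \<longrightarrow> p < real n powr (- 1 / 3 - \<epsilon>) \<longrightarrow>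
    measure_pmf.prob (gnp n p) {G. tree_activates G} \<le> b n"
  proof eventually_elim
    case (elim n)
    show ?case
    proof (intro allI impI)
      fix p :: real assume p: "0 \<le> p" "p \<le> 1" "p < real n powr (- 1 / 3 - \<epsilon>)"
      interpret coin p by unfold_locales (use p in auto)
      have n16: "16 \<le> real n" using elim(3) by simp
      have pos: "0 \<le> b1 n" "0 \<le> b2 n" "0 \<le> b3 n"
        unfolding b1_def b2_def b3_def K1_def K2_def by (auto intro!: add_nonneg_nonneg)
      let ?P = "prb (pairs {1..n}) (\<lambda>F. tree_activates ({1..n}, F))"
      have "?P \<le> b1 n \<or> ?P \<le> b2 n \<or> ?P \<le> b3 n"
      proof (cases "real n * p \<le> 8")
        case True
        have a: "real (a n) \<le> real n powr (1 / 3)" unfolding a_def by simp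
        also have "\<dots> \<le> real n powr 1" using n16 by (intro powr_mono) auto
        finally have an: "a n \<le> n" using n16 by simp
        have "?P \<le> real (a n) ^ 2 * p + (1 - (1 - p) ^ n) ^ a n"
          by (rule prb_tree_very_sparse) (use elim(3) an in auto)
        also have "real (a n) ^ 2 * p \<le> 8 * real n powr (- 1 / 3)"
        proof -
          have "real (a n) ^ 2 \<le> (real n powr (1 / 3)) ^ 2" using a by (intro power_mono) auto
          also have "\<dots> = real n powr (1 / 3 + 1 / 3)" by (simp only: powr_add power2_eq_square)
          finally have "real (a n) ^ 2 * p \<le> real n powr (2 / 3) * (8 / real n)"
            using True n16 p by (intro mult_mono) (auto simp: field_simps)
          also have "\<dots> = 8 * (real n powr (2 / 3) * real n powr (- 1))" using n16 by (simp add: powr_minus_divide)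
          also have "real n powr (2 / 3) * real n powr (- 1) = real n powr (- 1 / 3)" by (rule pw) simp
          finally show ?thesis .
        qed
        also have "(1 - (1 - p) ^ n) ^ a n \<le> (1 - exp (- 16)) ^ a n"
        proof (rule power_mono)
          have "p \<le> 8 / real n" using True n16 by (simp add: field_simps)
          moreover have "8 / real n \<le> 8 / 16" using n16 by (intro divide_left_mono) auto
          ultimately have ph: "p \<le> 1 / 2" by simp
          have "exp (- (2 * p)) \<le> 1 - p" using exp_minus_le_half[of "2 * p"] p ph by simp
          then have "exp (- (2 * p)) ^ n \<le> (1 - p) ^ n" by (intro power_mono) auto
          moreover have "exp (- 16) \<le> exp (- (2 * p)) ^ n" using True by (simp add: exp_of_nat_mult[symmetric] mult.commute)
          ultimately show "1 - (1 - p) ^ n \<le> 1 - exp (- 16)" by linarith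
          show "0 \<le> 1 - (1 - p) ^ n" using p by (simp add: power_le_one)
        qed
        finally show ?thesis unfolding b1_def by simp
      next
        case np: False
        show ?thesis
        proof (cases "p \<le> real n powr (- 3 / 5)")
          case True
          have "?P \<le> exp (- 3 / 5 * (real n - 1)) + 4 / 3 * (real n * p\<^sup>2)"
            by (rule prb_tree_few_triangles) (use elim(3) np in auto)
          moreover have "real n * p\<^sup>2 \<le> real n powr (- 1 / 5)"
          proof -
            have "p\<^sup>2 \<le> (real n powr (- 3 / 5))\<^sup>2" using True p by (intro power_mono) auto
            also have "\<dots> = real n powr (- 3 / 5 + - 3 / 5)" by (simp only: powr_add power2_eq_square)
            finally have "real n * p\<^sup>2 \<le> real n powr 1 * real n powr (- 6 / 5)"
              using n16 by (intro mult_mono) auto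
            also have "\<dots> = real n powr (- 1 / 5)" by (rule pw) simp
            finally show ?thesis .
          qed
          ultimately have "?P \<le> b2 n" unfolding b2_def by linarith
          then show ?thesis by blast
        next
          case False
          then have pl: "real n powr (- 3 / 5) \<le> p" by simp
          have "0 < real n powr (- 3 / 5)" using n16 by simp
          then have p_pos: "0 < p" using pl by linarith
          \<comment> \<open>The expected number \<open>\<mu>\<close> of common neighbours of a root pair in a leaf set is kept at most 1.\<close>
          define M where "M = min (real n / 8) (1 / p\<^sup>2)"
          have p2: "p\<^sup>2 \<le> 1" using p by (simp add: power_le_one)
          have M1: "1 \<le> M" using n16 p2 p_pos by (simp add: M_def)
          define m where "m = nat \<lfloor>M\<rfloor>"
          have m: "real m \<le> M" "M / 2 \<le> real m"
          proof -
            have "1 \<le> \<lfloor>M\<rfloor>" using M1 by simp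
            then have f: "real m = real_of_int \<lfloor>M\<rfloor>" "1 \<le> real_of_int \<lfloor>M\<rfloor>" unfolding m_def by simp_all
            show "real m \<le> M" using f by linarith
            have "M < real_of_int \<lfloor>M\<rfloor> + 1" by linarith
            then show "M / 2 \<le> real m" using f by linarith
          qed
          define \<mu> where "\<mu> = real m * p\<^sup>2"
          have mu1: "\<mu> \<le> 1"
          proof -
            have "\<mu> \<le> (1 / p\<^sup>2) * p\<^sup>2" unfolding \<mu>_def using m(1) by (intro mult_right_mono) (auto simp: M_def)
            then show ?thesis using p_pos by simp
          qed
          have mu_pos: "0 < \<mu>" using m M1 p_pos by (simp add: \<mu>_def)
          \<comment> \<open>The expected number \<open>k * \<mu>\<^sup>2\<close> of probes present is about \<open>s\<close>. It tends to infinity, but \<open>s * p\<close>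
            tends to 0.\<close>
          define s where "s = p powr (- 1 / 2)"
          have s1: "1 \<le> s" using p p_pos powr_mono'[of "- 1 / 2" 0 p] by (simp add: s_def)
          define k where "k = nat \<lfloor>s / \<mu>\<^sup>2\<rfloor>"
          have k: "real k \<le> s / \<mu>\<^sup>2" "s / \<mu>\<^sup>2 < real k + 1"
          proof -
            have "0 \<le> s / \<mu>\<^sup>2" using s1 by simp
            then have f: "real k = real_of_int \<lfloor>s / \<mu>\<^sup>2\<rfloor>" unfolding k_def by simp
            show "real k \<le> s / \<mu>\<^sup>2" unfolding f by linarith
            show "s / \<mu>\<^sup>2 < real k + 1" unfolding f by linarith
          qed
          have kmu: "real k * \<mu>\<^sup>2 \<le> s" "s - 1 \<le> real k * \<mu>\<^sup>2"
          proof -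
            show "real k * \<mu>\<^sup>2 \<le> s" using k(1) mu_pos by (simp add: field_simps)
            have "s < (real k + 1) * \<mu>\<^sup>2" using k(2) mu_pos by (simp add: field_simps)
            moreover have "\<mu>\<^sup>2 \<le> 1" using mu1 mu_pos by (simp add: power_le_one)
            ultimately show "s - 1 \<le> real k * \<mu>\<^sup>2" by (simp add: algebra_simps)
          qed
          have s_n: "s \<le> real n powr (3 / 10)"
          proof -
            have "p powr (- 1 / 2) \<le> (real n powr (- 3 / 5)) powr (- 1 / 2)"
              using pl n16 by (intro powr_mono2') auto
            then show ?thesis by (simp add: s_def powr_powr)
          qed
          have k_n: "real k \<le> real n / 4"
          proof (cases "real n / 8 \<le> 1 / p\<^sup>2")
            case False
            then have "1 / p\<^sup>2 / 2 \<le> real m" using m(2) by (simp add: M_def)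
            then have "1 / 2 \<le> \<mu>" using p_pos by (simp add: \<mu>_def field_simps)
            then have "(1 / 2)\<^sup>2 \<le> \<mu>\<^sup>2" by (intro power_mono) auto
            then have "s / \<mu>\<^sup>2 \<le> s / (1 / 2)\<^sup>2" using s1 mu_pos by (intro divide_left_mono) auto
            then have "real k \<le> 4 * s" using k(1) by (simp add: power2_eq_square)
            then show ?thesis using s_n elim(1) by linarith
          next
            case True
            then have "real n / 16 \<le> real m" using m(2) by (simp add: M_def)
            then have mu: "real n * p\<^sup>2 / 16 \<le> \<mu>" unfolding \<mu>_def using mult_right_mono[of "real n / 16" "real m" "p\<^sup>2"] by simp
            have "real n powr (- 1 / 5) \<le> real n * p\<^sup>2"
            proof -
              have "(real n powr (- 3 / 5))\<^sup>2 \<le> p\<^sup>2" using pl by (intro power_mono) auto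
              moreover have "(real n powr (- 3 / 5))\<^sup>2 = real n powr (- 3 / 5 + - 3 / 5)"
                by (simp only: powr_add power2_eq_square)
              ultimately have "real n powr 1 * real n powr (- 6 / 5) \<le> real n * p\<^sup>2" using n16 by (intro mult_mono) auto
              moreover have "real n powr 1 * real n powr (- 6 / 5) = real n powr (- 1 / 5)" by (rule pw) simp
              ultimately show ?thesis by linarith
            qed
            then have "real n powr (- 1 / 5) / 16 \<le> \<mu>" using mu by linarith
            then have "(real n powr (- 1 / 5) / 16)\<^sup>2 \<le> \<mu>\<^sup>2" by (intro power_mono) auto
            then have "s / \<mu>\<^sup>2 \<le> real n powr (3 / 10) / (real n powr (- 1 / 5) / 16)\<^sup>2"
              using s_n s1 n16 mu_pos by (intro frac_le) auto
            also have "\<dots> = 256 * (real n powr (3 / 10) / (real n powr (- 1 / 5) * real n powr (- 1 / 5)))"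
              by (simp add: power2_eq_square)
            also have "real n powr (- 1 / 5) * real n powr (- 1 / 5) = real n powr (- 2 / 5)" by (rule pw) simp
            also have "real n powr (3 / 10) / real n powr (- 2 / 5) = real n powr (3 / 10 - (- 2 / 5))"
              by (rule powr_diff[symmetric])
            also have "(3 / 10 - (- 2 / 5) :: real) = 7 / 10" by simp
            finally show ?thesis using k(1) elim(2) by linarith
          qed
          have "real m \<le> real n / 8" using m(1) by (simp add: M_def)
          then have "real (2 * k + 2 * m) \<le> real n" using k_n by simp
          then have km: "2 * k + 2 * m \<le> n" by linarith
          have "?P \<le> K1 * real n powr (- \<epsilon>) + real k * \<mu>\<^sup>2 * p * K2 + (1 - (\<mu> / 2)\<^sup>2) ^ k"
            using prb_tree_main_case[OF _ e less_imp_le[OF p(3)] km mu1[unfolded \<mu>_def] N L] elim(3)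
            unfolding K1_def K2_def \<mu>_def by simp
          also have "real k * \<mu>\<^sup>2 * p * K2 \<le> K2 * real n powr (- 1 / 6)"
          proof -
            have "real k * \<mu>\<^sup>2 * p \<le> s * p" using kmu(1) p by (intro mult_right_mono) auto
            also have "s * p = p powr (- 1 / 2) * p powr 1" using p_pos by (simp add: s_def)
            also have "\<dots> = p powr (1 / 2)" by (rule pw) simp
            also have "\<dots> \<le> (real n powr (- 1 / 3)) powr (1 / 2)"
            proof (rule powr_mono2)
              have "real n powr (- 1 / 3 - \<epsilon>) \<le> real n powr (- 1 / 3)" using n16 e by (intro powr_mono) auto
              then show "p \<le> real n powr (- 1 / 3)" using p(3) by linarith
            qed (use p in auto)
            also have "\<dots> = real n powr (- 1 / 6)" by (simp add: powr_powr)
            finally have "real k * \<mu>\<^sup>2 * p * K2 \<le> real n powr (- 1 / 6) * K2"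
              by (intro mult_right_mono) (auto simp: K2_def)
            then show ?thesis by (simp add: mult.commute)
          qed
          also have "(1 - (\<mu> / 2)\<^sup>2) ^ k \<le> exp (- (real n powr (1 / 6) - 1) / 4)"
          proof -
            have "(1 - (\<mu> / 2)\<^sup>2) ^ k \<le> exp (- (real k * \<mu>\<^sup>2 / 4))"
            proof (rule power_le_exp)
              show "(\<mu> / 2)\<^sup>2 \<le> 1" using mu1 mu_pos by (intro power_le_one) auto
              show "real k * \<mu>\<^sup>2 / 4 \<le> (\<mu> / 2)\<^sup>2 * real k" by (simp add: power_divide)
            qed simp
            also have "\<dots> = exp (- (real k * \<mu>\<^sup>2) / 4)" by simp
            also have "\<dots> \<le> exp (- (real n powr (1 / 6) - 1) / 4)"
            proof -
              have "real n powr (- 1 / 3 - \<epsilon>) \<le> real n powr (- 1 / 3)" using n16 e by (intro powr_mono) auto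
              then have "p \<le> real n powr (- 1 / 3)" using p(3) by linarith
              then have "(real n powr (- 1 / 3)) powr (- 1 / 2) \<le> s"
                unfolding s_def using p_pos by (intro powr_mono2') auto
              then have "real n powr (1 / 6) \<le> s" by (simp add: powr_powr)
              then show ?thesis using kmu(2) by simp
            qed
            finally show ?thesis .
          qed
          finally have "?P \<le> b3 n" unfolding b3_def by simp
          then show ?thesis by blast
        qed
      qed
      then have "?P \<le> b n" using pos unfolding b_def by linarith
      then show "measure_pmf.prob (gnp n p) {G. tree_activates G} \<le> b n" by (simp add: prob_gnp)
    qed
  qed
  then show ?thesis using lim by blast
qed

section \<open>A structure that forces an activating tree\<close>

text \<open>The neighbours of the root \<open>r\<close> are split into \<open>R1\<close> and \<open>R2\<close>; \<open>B\<close> are the remaining vertices.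
  Each \<open>w \<in> B\<close> has a connected set \<open>C w\<close> of neighbours in \<open>R1\<close>.\<close>

definition cluster :: "'a set set \<Rightarrow> 'a set \<Rightarrow> 'a \<Rightarrow> 'a set \<Rightarrow> bool" where
  "cluster E R w C \<longleftrightarrow> C \<subseteq> R \<and> (\<forall>c\<in>C. {w, c} \<in> E) \<and> (\<forall>x\<in>C. \<forall>y\<in>C. conn (E \<inter> pairs C) x y)"

definition shadow :: "'a set set \<Rightarrow> 'a set \<Rightarrow> ('a \<Rightarrow> 'a set) \<Rightarrow> 'a \<Rightarrow> 'a set" where
  "shadow E R2 C w = {x \<in> R2. \<exists>c\<in>C w. {x, c} \<in> E}"

text \<open>A contact of \<open>a\<close> is a vertex of \<open>R2\<close> whose edge to \<open>a\<close> is activated early: by the root if \<open>a\<close> is one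
  of its neighbours, and by the cluster of \<open>a\<close> if \<open>a \<in> B\<close>.\<close>
definition contacts :: "'a set set \<Rightarrow> 'a set \<Rightarrow> 'a set \<Rightarrow> ('a \<Rightarrow> 'a set) \<Rightarrow> 'a \<Rightarrow> 'a set" where
  "contacts E R2 B C a = {x \<in> R2. {a, x} \<in> E \<and> (a \<in> B \<longrightarrow> x \<in> shadow E R2 C a)}"

text \<open>The triangles on \<open>w\<close>, \<open>a\<close>, \<open>x\<close> and on \<open>w\<close>, \<open>b\<close>, \<open>y\<close> activate the edges from \<open>w\<close> to \<open>a\<close> and \<open>b\<close>, and then the
  triangle on \<open>a\<close>, \<open>b\<close>, \<open>w\<close> activates the edge between \<open>a\<close> and \<open>b\<close>.\<close>
definition linked :: "'a set set \<Rightarrow> 'a set \<Rightarrow> 'a set \<Rightarrow> ('a \<Rightarrow> 'a set) \<Rightarrow> 'a \<Rightarrow> 'a \<Rightarrow> bool" where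
  "linked E R2 B C a b \<longleftrightarrow> (\<exists>w\<in>B. {w, a} \<in> E \<and> {w, b} \<in> E \<and>
      (\<exists>x\<in>contacts E R2 B C a \<inter> shadow E R2 C w. {w, x} \<in> E) \<and>
      (\<exists>y\<in>contacts E R2 B C b \<inter> shadow E R2 C w. {w, y} \<in> E))"

text \<open>The tree consists of the star at \<open>r\<close> and one edge from each \<open>w \<in> B\<close> into \<open>C w\<close>. It activates
  in turn the edges inside \<open>R1 \<union> R2\<close>, from \<open>w\<close> to \<open>C w\<close>, from \<open>w\<close> to its shadow, and, along linking
  triangles, all the others.\<close>
lemma linked_tree_activates:
  assumes V: "finite V" "V = insert r (R1 \<union> R2 \<union> B)" "r \<notin> R1 \<union> R2 \<union> B" "(R1 \<union> R2) \<inter> B = {}" "B \<noteq> {}"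
    and E: "E \<subseteq> pairs V" "\<And>x. x \<in> V \<Longrightarrow> {r, x} \<in> E \<longleftrightarrow> x \<in> R1 \<union> R2"
    and C: "\<And>w. w \<in> B \<Longrightarrow> cluster E R1 w (C w) \<and> C w \<noteq> {}"
    and L: "\<And>a b. a \<in> R1 \<union> R2 \<union> B \<Longrightarrow> b \<in> B \<Longrightarrow> a \<noteq> b \<Longrightarrow> linked E R2 B C a b"
  shows "tree_activates (V, E) \<and> cherry_covered (V, E)"
proof
  let ?R = "R1 \<union> R2"
  define c where "c w = (SOME x. x \<in> C w)" for w
  have c: "c w \<in> C w" "c w \<in> ?R" "{w, c w} \<in> E" if "w \<in> B" for w
  proof -
    show "c w \<in> C w" unfolding c_def using C[OF that] by (simp add: some_in_eq)
    then show "c w \<in> ?R" "{w, c w} \<in> E" using C[OF that] by (auto simp: cluster_def)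
  qed
  define T where "T = (\<lambda>x. {r, x}) ` ?R \<union> (\<lambda>w. {w, c w}) ` B"
  have TE: "T \<subseteq> E" unfolding T_def using E(2) c V(2) by auto
  have fin: "finite ?R" "finite B" using V(1,2) by auto
  have sG: "simple_graph (V, E)" using V(1) E(1) by (simp add: simple_graph_def)
  have cr: "conn T r x" if "x \<in> V" for x
  proof -
    have R: "conn T r y" if "y \<in> ?R" for y using that by (intro conn_edge) (auto simp: T_def)
    moreover have "conn T r w" if w: "w \<in> B" for w
    proof -
      have "conn T r (c w)" by (rule R) (rule c(2)[OF w])
      moreover have "{c w, w} \<in> T" using w by (auto simp: T_def insert_commute)
      ultimately show ?thesis by (rule conn_step)
    qed
    ultimately show ?thesis using that V(2) by auto
  qed
  have "connected_graph (V, T)"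
    unfolding connected_graph_conn using cr V(2) by (auto intro: conn_trans[OF conn_sym[OF cr] cr])
  moreover have "card T + 1 \<le> card V"
  proof -
    have "card T \<le> card ?R + card B"
      unfolding T_def by (rule order_trans[OF card_Un_le add_mono[OF card_image_le card_image_le]]) (use fin in auto)
    moreover have "card V = card ?R + card B + 1"
      using V fin by (simp add: card_Un_disjoint)
    ultimately show ?thesis by simp
  qed
  moreover have sT: "simple_graph (V, T)" using TE E(1) V(1) by (auto simp: simple_graph_def)
  ultimately have tree: "is_tree (V, T)" by (intro tree_by_card) auto
  obtain F where F: "T \<subseteq> F" "F \<subseteq> E" "bootstrap_step\<^sup>*\<^sup>* (V, T) (V, F)"
    and clo: "\<And>x y z. distinct [x, y, z] \<Longrightarrow> {x, y} \<in> E \<Longrightarrow> {y, z} \<in> F \<Longrightarrow> {x, z} \<in> F \<Longrightarrow> {x, y} \<in> F"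
    using bootstrap_closure[OF finite_subset[OF E(1) finite_pairs[OF V(1)]] TE, of V] by blast
  have ne: "x \<noteq> y" if "{x, y} \<in> E" for x y
    using subsetD[OF E(1) that] by simp
  have tri: "{x, y} \<in> F" if "{x, y} \<in> E" "{x, z} \<in> F" "{y, z} \<in> F" for x y z
  proof (rule clo[of x y z])
    show "distinct [x, y, z]" using ne[OF that(1)] ne[of x z] ne[of y z] that F(2) by auto
  qed (use that in auto)
  have s1: "{r, x} \<in> F" "{x, r} \<in> F" if "x \<in> ?R" for x
    using that F(1) by (auto simp: T_def insert_commute)
  have s2: "{x, y} \<in> F" if "x \<in> ?R" "y \<in> ?R" "{x, y} \<in> E" for x y
    using tri[OF that(3) s1(2)[OF that(1)] s1(2)[OF that(2)]] .
  have s3: "{w, y} \<in> F" if w: "w \<in> B" and y: "y \<in> C w" for w y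
  proof -
    have cl: "cluster E R1 w (C w)" using C w by blast
    have "conn (E \<inter> pairs (C w)) (c w) y" using cl c(1)[OF w] y by (auto simp: cluster_def)
    then have "y \<in> C w \<longrightarrow> {w, y} \<in> F"
    proof (induction rule: conn_induct)
      case base
      then show ?case using w F(1) by (auto simp: T_def)
    next
      case (step y z)
      then have yz: "y \<in> C w" "z \<in> C w" "{y, z} \<in> E" by auto
      then have "{y, z} \<in> F" using cl by (intro s2) (auto simp: cluster_def)
      moreover have "{w, y} \<in> F" using step.IH yz by blast
      moreover have "{w, z} \<in> E" using cl yz by (auto simp: cluster_def)
      ultimately show ?case using tri[of w z y] by (auto simp: insert_commute)
    qed
    then show ?thesis using y by blast
  qed
  have s4: "{w, x} \<in> F" if w: "w \<in> B" and x: "x \<in> shadow E R2 C w" "{w, x} \<in> E" for w x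
  proof -
    obtain d where d: "d \<in> C w" "{x, d} \<in> E" "x \<in> R2" using x(1) by (auto simp: shadow_def)
    have "d \<in> ?R" using C[OF w] d(1) by (auto simp: cluster_def)
    then have "{x, d} \<in> F" using d by (intro s2) auto
    then show ?thesis using tri[OF x(2) s3[OF w d(1)]] by blast
  qed
  have s5: "{a, x} \<in> F" if a: "a \<in> ?R \<union> B" and x: "x \<in> contacts E R2 B C a" for a x
  proof (cases "a \<in> B")
    case True
    then show ?thesis using s4[OF True] x by (auto simp: contacts_def)
  next
    case False
    then show ?thesis using s2[of a x] a x by (auto simp: contacts_def)
  qed
  have s6: "{w, a} \<in> F" if "w \<in> B" "a \<in> ?R \<union> B" "{w, a} \<in> E"
    "x \<in> contacts E R2 B C a \<inter> shadow E R2 C w" "{w, x} \<in> E" for w a x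
    using tri[of w a x] s4[of w x] s5[of a x] that by auto
  have s7: "{a, b} \<in> F" if ab: "a \<in> ?R \<union> B" "b \<in> B" "{a, b} \<in> E" for a b
  proof -
    obtain w x y where w: "w \<in> B" "{w, a} \<in> E" "{w, b} \<in> E"
      "x \<in> contacts E R2 B C a \<inter> shadow E R2 C w" "{w, x} \<in> E"
      "y \<in> contacts E R2 B C b \<inter> shadow E R2 C w" "{w, y} \<in> E"
      using L[OF ab(1,2) ne[OF ab(3)]] unfolding linked_def by blast
    have "{w, a} \<in> F" "{w, b} \<in> F" using s6[OF w(1) ab(1) w(2,4,5)] s6[OF w(1) _ w(3,6,7)] ab(2) by auto
    then show ?thesis using tri[OF ab(3), of w] by (auto simp: insert_commute)
  qed
  have "E \<subseteq> F"
  proof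
    fix e assume e: "e \<in> E"
    then obtain u v where uv: "e = {u, v}" "u \<noteq> v" "u \<in> V" "v \<in> V" using E(1) by (meson pairs_E subsetD)
    consider "u = r" | "v = r" | "u \<in> ?R" "v \<in> ?R" | "u \<in> ?R \<union> B" "v \<in> B" | "u \<in> B" "v \<in> ?R \<union> B"
      using uv V(2) by blast
    then show "e \<in> F"
    proof cases
      case 1 then show ?thesis using s1 E(2) uv e by auto
    next
      case 2
      then have eq: "e = {r, u}" using uv(1) by (simp add: insert_commute)
      then have "u \<in> ?R" using E(2)[OF uv(3)] e by simp
      then show ?thesis unfolding eq by (rule s1)
    next
      case 3 then show ?thesis using s2 uv e by auto
    next
      case 4 then show ?thesis using s7 uv e by auto
    next
      case 5
      then have eq: "e = {v, u}" using uv(1) by (simp add: insert_commute)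
      then show ?thesis using s7[of v u] 5 e by simp
    qed
  qed
  then have "bootstrap_step\<^sup>*\<^sup>* (V, T) (V, E)" using F by auto
  then have "activates (V, T) (V, E)" by (rule activatesI(1)[OF sG])
  then show "tree_activates (V, E)" using tree
    unfolding tree_activates_def activates_def spanning_subgraph_def by blast
  have contact: "\<exists>x\<in>?R. {a, x} \<in> E" if a: "a \<in> ?R \<union> B" for a
  proof -
    have "contacts E R2 B C a \<noteq> {}"
    proof (cases "a \<in> B")
      case True
      then have "linked E R2 B C (c a) a" using c[OF True] V(4) by (intro L) auto
      then show ?thesis by (auto simp: linked_def)
    next
      case False
      obtain b where b: "b \<in> B" using V(5) by blast
      then have "linked E R2 B C a b" using False a by (intro L) auto
      then show ?thesis by (auto simp: linked_def)
    qed
    then show ?thesis by (auto simp: contacts_def)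
  qed
  have cov: "\<exists>z. {x, z} \<in> E \<and> {y, z} \<in> E" if xy: "x \<in> V" "y \<in> V" "x \<noteq> y" for x y
  proof -
    have rR: "{z, r} \<in> E" "{r, z} \<in> E" if "z \<in> ?R" for z using E(2)[of z] that V(2) by (auto simp: insert_commute)
    consider "x = r" "y \<in> ?R \<union> B" | "y = r" "x \<in> ?R \<union> B" | "x \<in> ?R" "y \<in> ?R" | "x \<in> ?R \<union> B" "y \<in> B"
      | "x \<in> B" "y \<in> ?R \<union> B" using xy V(2) by blast
    then show ?thesis
    proof cases
      case 1 then show ?thesis using contact[OF 1(2)] rR by blast
    next
      case 2 then show ?thesis using contact[OF 2(2)] rR by blast
    next
      case 3 then show ?thesis using rR by blast
    next
      case 4 then show ?thesis using L[OF 4 xy(3)] by (auto simp: linked_def insert_commute)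
    next
      case 5 then show ?thesis using L[OF 5(2,1)] xy(3) by (auto simp: linked_def insert_commute)
    qed
  qed
  then show "cherry_covered (V, E)" by (simp add: cherry_covered_def)
qed

section \<open>Exploring clusters in a supercritical random graph\<close>

definition reach :: "'a set \<Rightarrow> 'a set \<Rightarrow> 'a set set \<Rightarrow> 'a set" where
  "reach A K F = {y. \<exists>a\<in>A. conn (F \<inter> pairs K) a y}"

lemma reach_subset: "A \<subseteq> K \<Longrightarrow> reach A K F \<subseteq> K"
proof
  fix y assume A: "A \<subseteq> K" and "y \<in> reach A K F"
  then obtain a where a: "a \<in> A" "conn (F \<inter> pairs K) a y" by (auto simp: reach_def)
  show "y \<in> K" using a(2)
  proof (induction rule: conn_induct)
    case base then show ?case using A a(1) by blast
  qed auto
qed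

lemma reach_superset: "A \<subseteq> reach A K F"
proof
  fix x assume "x \<in> A"
  then show "x \<in> reach A K F" unfolding reach_def by (auto intro: bexI[of _ x])
qed

lemma reach_cong: "F \<inter> pairs K = F' \<inter> pairs K \<Longrightarrow> reach A K F = reach A K F'"
  by (simp add: reach_def)

context coin begin

text \<open>Exploration vertex by vertex. A step replaces an active vertex by its unexplored neighbours. As
  long as at least \<open>M\<close> vertices are unexplored, \<open>z\<close> to the power of the number of active
  vertices is a supermartingale, and this power is 1 when the exploration dies out.\<close>
lemma prb_small_reach:
  assumes "finite K" "A \<subseteq> K" "0 \<le> z" "z \<le> 1" "(1 - p + p * z) ^ M \<le> z" "M + S \<le> card K"
  shows "prb (pairs K) (\<lambda>F. card (reach A K F) < S) \<le> z ^ card A"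
  using assms(1,2,6)
proof (induction S arbitrary: A K)
  case 0
  then show ?case using assms(3) by (simp add: prb_def)
next
  case (Suc S)
  have fA: "finite A" using Suc.prems finite_subset by blast
  have fI: "finite (pairs K)" using Suc.prems(1) by (rule finite_pairs)
  show ?case
  proof (cases "A = {} \<or> Suc S \<le> card A")
    case True
    then show ?thesis
    proof
      assume "A = {}"
      then show ?thesis using prb_le_1[OF fI] by simp
    next
      assume c: "Suc S \<le> card A"
      have "\<not> card (reach A K F) < Suc S" for F
      proof -
        have "card A \<le> card (reach A K F)"
          using reach_superset reach_subset[OF Suc.prems(2)] Suc.prems(1) by (meson card_mono finite_subset)
        then show ?thesis using c by simp
      qed
      then show ?thesis using assms(3) by (simp add: prb_def)
    qed
  next
    case False
    then obtain a where a: "a \<in> A" by blast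
    define U where "U = K - A"
    define J where "J = (\<lambda>u. {a, u}) ` U"
    define K' where "K' = K - {a}"
    have aK: "a \<in> K" using a Suc.prems(2) by blast
    have JI: "J \<subseteq> pairs K" using a aK by (auto simp: J_def U_def)
    have fJ: "finite J" using JI fI finite_subset by blast
    have injJ: "inj_on (\<lambda>u. {a, u}) U" by (auto simp: inj_on_def doubleton_eq_iff)
    have cJ: "card J = card U" unfolding J_def by (rule card_image[OF injJ])
    have MU: "M \<le> card U"
    proof -
      have "card U = card K - card A" unfolding U_def using fA Suc.prems(2) by (rule card_Diff_subset)
      then show ?thesis using False Suc.prems(3) by linarith
    qed
    have K'I: "pairs K' \<subseteq> pairs K - J" by (auto simp: K'_def J_def pairs_def)
    have step: "prb (pairs K - J) (\<lambda>F'. card (reach A K (F \<union> F')) < Suc S) \<le> z ^ (card A - 1) * z ^ card F"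
      if F: "F \<in> Pow J" for F
    proof -
      define N where "N = {u \<in> U. {a, u} \<in> F}"
      define A' where "A' = (A - {a}) \<union> N"
      have FN: "F = (\<lambda>u. {a, u}) ` N" using F by (auto simp: N_def J_def)
      have "card F = card N" unfolding FN
        by (rule card_image) (rule inj_on_subset[OF injJ], auto simp: N_def)
      moreover have "card A' = card (A - {a}) + card N"
        unfolding A'_def using fA Suc.prems(1) by (intro card_Un_disjoint) (auto simp: N_def U_def)
      ultimately have cA': "card A' = card A - 1 + card F" using a fA by simp
      have A'K: "A' \<subseteq> K'" using Suc.prems(2) a by (auto simp: A'_def K'_def N_def U_def)
      have "prb (pairs K - J) (\<lambda>F'. card (reach A K (F \<union> F')) < Suc S)
          \<le> prb (pairs K - J) (\<lambda>F'. card (reach A' K' F') < S)"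
      proof (rule prb_mono)
        fix F' assume F': "F' \<subseteq> pairs K - J" "card (reach A K (F \<union> F')) < Suc S"
        have m: "conn ((F \<union> F') \<inter> pairs K) x y" if "conn (F' \<inter> pairs K') x y" for x y
          using that by (rule conn_mono) (auto simp: K'_def pairs_def)
        have start: "\<exists>a'\<in>A. conn ((F \<union> F') \<inter> pairs K) a' x" if "x \<in> A'" for x
        proof (cases "x \<in> A - {a}")
          case True
          then show ?thesis by (intro bexI[of _ x]) auto
        next
          case False
          then have ax: "{a, x} \<in> F" using that by (auto simp: A'_def N_def)
          have "F \<subseteq> pairs K" using F JI by blast
          then have "{a, x} \<in> (F \<union> F') \<inter> pairs K" using ax by blast
          then have "conn ((F \<union> F') \<inter> pairs K) a x" by (rule conn_edge)
          then show ?thesis using a by (rule bexI)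
        qed
        have "insert a (reach A' K' F') \<subseteq> reach A K (F \<union> F')"
        proof
          fix y assume "y \<in> insert a (reach A' K' F')"
          then show "y \<in> reach A K (F \<union> F')"
          proof
            assume "y = a"
            then show ?thesis using subsetD[OF reach_superset a] by simp
          next
            assume "y \<in> reach A' K' F'"
            then obtain x where x: "x \<in> A'" "conn (F' \<inter> pairs K') x y" by (auto simp: reach_def)
            obtain a' where a': "a' \<in> A" "conn ((F \<union> F') \<inter> pairs K) a' x" using start[OF x(1)] by (elim bexE)
            have "conn ((F \<union> F') \<inter> pairs K) a' y" by (rule conn_trans[OF a'(2) m[OF x(2)]])
            then show ?thesis unfolding reach_def using a'(1) by (intro CollectI bexI[of _ a'])
          qed
        qed
        moreover have "finite (reach A K (F \<union> F'))"
          using reach_subset[OF Suc.prems(2)] Suc.prems(1) finite_subset by blast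
        ultimately have "card (insert a (reach A' K' F')) \<le> card (reach A K (F \<union> F'))" by (rule card_mono[rotated])
        moreover have "a \<notin> reach A' K' F'" "finite (reach A' K' F')"
          using reach_subset[OF A'K, of F'] Suc.prems(1) by (auto simp: K'_def intro: finite_subset)
        ultimately show "card (reach A' K' F') < S" using F'(2) by simp
      qed
      also have "\<dots> = prb (pairs K') (\<lambda>F'. card (reach A' K' F') < S)"
      proof (rule prb_restrict)
        show "(card (reach A' K' F') < S) = (card (reach A' K' (F' \<inter> pairs K')) < S)" for F'
          using reach_cong[of F' K' "F' \<inter> pairs K'" A'] by simp
      qed (use fI K'I in auto)
      also have "\<dots> \<le> z ^ card A'"
        using Suc.prems A'K aK by (intro Suc.IH) (auto simp: K'_def)
      finally show ?thesis by (simp add: cA' power_add)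
    qed
    have "prb (pairs K) (\<lambda>F. card (reach A K F) < Suc S) =
       (\<Sum>F\<in>Pow J. wt J F * prb (pairs K - J) (\<lambda>F'. card (reach A K (F \<union> F')) < Suc S))"
      by (rule prb_split[OF fI JI])
    also have "\<dots> \<le> (\<Sum>F\<in>Pow J. wt J F * (z ^ (card A - 1) * z ^ card F))"
      by (intro sum_mono mult_left_mono step wt_nonneg)
    also have "\<dots> = z ^ (card A - 1) * (\<Sum>F\<in>Pow J. wt J F * z ^ card F)"
      by (simp add: sum_distrib_left mult_ac)
    also have "\<dots> = z ^ (card A - 1) * (1 - p + p * z) ^ card U"
      by (simp add: sum_wt[OF fJ] cJ)
    also have "\<dots> \<le> z ^ (card A - 1) * z"
    proof (rule mult_left_mono)
      have b: "0 \<le> 1 - p + p * z" "1 - p + p * z \<le> 1"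
        using p0 p1 assms(3,4) mult_left_mono[of z 1 p] by auto
      have "(1 - p + p * z) ^ card U \<le> (1 - p + p * z) ^ M" using MU b by (intro power_decreasing) auto
      then show "(1 - p + p * z) ^ card U \<le> z" using assms(5) by linarith
    qed (use assms(3) in simp)
    also have "\<dots> = z ^ card A"
    proof -
      have "card A \<noteq> 0" using a fA by auto
      then obtain k where "card A = Suc k" using not0_implies_Suc by blast
      then show ?thesis by simp
    qed
    finally show ?thesis .
  qed
qed

lemma reach_connected:
  assumes "x \<in> reach {a} K F" "y \<in> reach {a} K F"
  shows "conn (F \<inter> pairs (reach {a} K F)) x y"
proof -
  have *: "conn (F \<inter> pairs (reach {a} K F)) a y" if y: "y \<in> reach {a} K F" for y
  proof -
    have "conn (F \<inter> pairs K) a y" using y by (simp add: reach_def)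
    then have "conn (F \<inter> pairs K) a y \<and> conn (F \<inter> pairs (reach {a} K F)) a y"
    proof (induction rule: conn_induct)
      case (step y z)
      have "conn (F \<inter> pairs K) a z" using step.hyps by (rule conn_step)
      moreover have "y \<in> reach {a} K F" "z \<in> reach {a} K F"
        using step.hyps(1) calculation by (auto simp: reach_def)
      then have "{y, z} \<in> F \<inter> pairs (reach {a} K F)" using step.hyps(2) by auto
      then have "conn (F \<inter> pairs (reach {a} K F)) a z" by (rule conn_step[OF conjunct2[OF step.IH]])
      with calculation show ?case by (rule conjI)
    qed auto
    then show ?thesis by (rule conjunct2)
  qed
  show ?thesis by (rule conn_trans[OF conn_sym[OF *[OF assms(1)]] *[OF assms(2)]])
qed

text \<open>Exploring from \<open>k\<close> vertices at once makes the failure probability exponentially small in \<open>k\<close>. If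
  the exploration finds \<open>k * s\<close> vertices, they lie in at most \<open>k\<close> components, so one of these is large.\<close>
lemma prb_no_component:
  assumes K: "finite K" and z: "0 \<le> z" "z \<le> 1" "(1 - p + p * z) ^ M \<le> z" and S: "M + k * s \<le> card K" "0 < k" "0 < s"
  shows "prb (pairs K) (\<lambda>F. \<not> (\<exists>C\<subseteq>K. s \<le> card C \<and> (\<forall>x\<in>C. \<forall>y\<in>C. conn (F \<inter> pairs C) x y))) \<le> z ^ k"
proof -
  have "k \<le> k * s" using S(3) by simp
  then have "k \<le> card K" using S(1) by linarith
  then obtain A where A: "A \<subseteq> K" "card A = k" by (meson obtain_subset_with_card_n)
  have "prb (pairs K) (\<lambda>F. \<not> (\<exists>C\<subseteq>K. s \<le> card C \<and> (\<forall>x\<in>C. \<forall>y\<in>C. conn (F \<inter> pairs C) x y)))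
     \<le> prb (pairs K) (\<lambda>F. card (reach A K F) < k * s)"
  proof (rule prb_mono)
    fix F assume n: "\<not> (\<exists>C\<subseteq>K. s \<le> card C \<and> (\<forall>x\<in>C. \<forall>y\<in>C. conn (F \<inter> pairs C) x y))"
    have small: "card (reach {a} K F) \<le> s - 1" if "a \<in> A" for a
    proof -
      have "reach {a} K F \<subseteq> K" using that A by (intro reach_subset) auto
      moreover have "\<forall>x\<in>reach {a} K F. \<forall>y\<in>reach {a} K F. conn (F \<inter> pairs (reach {a} K F)) x y"
        by (intro ballI reach_connected)
      ultimately have "\<not> s \<le> card (reach {a} K F)" using n by blast
      then show ?thesis by linarith
    qed
    have fA: "finite A" using A K finite_subset by blast
    have "reach A K F = (\<Union>a\<in>A. reach {a} K F)" by (auto simp: reach_def)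
    then have "card (reach A K F) \<le> (\<Sum>a\<in>A. card (reach {a} K F))" using card_UN_le[OF fA] by metis
    also have "\<dots> \<le> card A * (s - 1)" using sum_bounded_above[of A "\<lambda>a. card (reach {a} K F)" "s - 1"] small by simp
    also have "\<dots> < k * s" using A(2) S(2,3) by simp
    finally show "card (reach A K F) < k * s" .
  qed
  also have "\<dots> \<le> z ^ card A" by (rule prb_small_reach) (use assms A in auto)
  finally show ?thesis by (simp add: A(2))
qed

end

section \<open>Building the structure in a random graph\<close>

text \<open>This event occurs in two roles. A vertex \<open>x \<in> R2\<close> is a contact of \<open>a\<close> in the shadow of \<open>w\<close> if it is
  adjacent to \<open>a\<close> and to vertices of the clusters concerned; and \<open>w \<in> B\<close> links \<open>a\<close> and \<open>b\<close> if it is adjacent to both and to a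
  contact of each.\<close>
definition hub :: "'a set set \<Rightarrow> 'a \<Rightarrow> 'a set \<Rightarrow> 'a set \<Rightarrow> 'a set \<Rightarrow> bool" where
  "hub F w Q Y1 Y2 \<longleftrightarrow> (\<forall>v\<in>Q. {w, v} \<in> F) \<and> (\<exists>x\<in>Y1. {w, x} \<in> F) \<and> (\<exists>y\<in>Y2. {w, y} \<in> F)"

lemma hub_local: "Q \<union> Y1 \<union> Y2 \<subseteq> Z \<Longrightarrow> hub F w Q Y1 Y2 = hub (F \<inter> spokes {w} Z) w Q Y1 Y2"
  unfolding hub_def spokes_def by blast

context coin begin

text \<open>The second stage is formulated with a full random subset of \<open>I\<close> whose part inside \<open>J\<close> is
  overwritten by the revealed one. So estimates for random subsets of \<open>I\<close> apply again after conditioning.\<close>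
lemma prb_stage_merge:
  assumes I: "finite I" "J \<subseteq> I" and d: "0 \<le> d"
    and B: "\<And>F. F \<subseteq> I \<Longrightarrow> B F = B (F \<inter> J)"
    and A: "\<And>F. F \<subseteq> J \<Longrightarrow> B F \<Longrightarrow> prb I (\<lambda>F'. A (F \<union> (F' - J))) \<le> d"
  shows "prb I (\<lambda>F. B F \<and> A F) \<le> d"
proof (rule prb_stage[where B = B and A = A, OF I d B])
  fix F assume F: "F \<subseteq> J" "B F"
  have "prb (I - J) (\<lambda>F'. A (F \<union> F')) = prb (I - J) (\<lambda>F'. A (F \<union> (F' - J)))"
  proof (rule prb_cong)
    fix F' assume "F' \<subseteq> I - J"
    then have "F' - J = F'" by blast
    then show "A (F \<union> F') = A (F \<union> (F' - J))" by simp
  qed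
  also have "\<dots> = prb I (\<lambda>F'. A (F \<union> (F' - J)))"
  proof (rule prb_restrict[symmetric])
    fix F' assume "F' \<subseteq> I"
    then have "F' - J = (F' \<inter> (I - J)) - J" by blast
    then show "A (F \<union> (F' - J)) = A (F \<union> ((F' \<inter> (I - J)) - J))" by (rule arg_cong)
  qed (use I in auto)
  also have "\<dots> \<le> d" by (rule A[OF F])
  finally show "prb (I - J) (\<lambda>F'. A (F \<union> F')) \<le> d" .
qed auto

lemma prb_hub:
  assumes V: "finite V" "w \<in> V" and S: "Q \<union> Y1 \<union> Y2 \<subseteq> V - {w}"
    and disj: "Q \<inter> Y1 = {}" "Q \<inter> Y2 = {}" "Y1 \<inter> Y2 = {}" and g: "card Y1 = g" "card Y2 = g"
  shows "prb (pairs V) (\<lambda>F. hub F w Q Y1 Y2) = p ^ card Q * (1 - (1 - p) ^ g)\<^sup>2"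
proof -
  let ?I = "pairs V"
  let ?s = "\<lambda>S. (\<lambda>v. {w, v}) ` S"
  have fI: "finite ?I" by (rule finite_pairs[OF V(1)])
  have sub: "?s S \<subseteq> ?I" if "S \<subseteq> V - {w}" for S using that V(2) by auto
  have card: "card (?s S) = card S" for S
    by (rule card_image) (auto simp: inj_on_def doubleton_eq_iff)
  have dj: "?s S \<inter> ?s S' = {}" if "S \<inter> S' = {}" for S S' using that by (auto simp: doubleton_eq_iff)
  have cut: "(F - ?s S) \<inter> ?s S' = F \<inter> ?s S'" if "S \<inter> S' = {}" for S S' F
  proof -
    have "(F - D) \<inter> D' = F \<inter> D'" if "D \<inter> D' = {}" for D D' using that by blast
    then show ?thesis using dj[OF that] by simp
  qed
  have S': "Q \<subseteq> V - {w}" "Y1 \<subseteq> V - {w}" "Y2 \<subseteq> V - {w}" using S by auto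
  have e: "(\<exists>y\<in>Y. {w, y} \<in> F) \<longleftrightarrow> F \<inter> ?s Y \<noteq> {}" for Y F by blast
  have "prb ?I (\<lambda>F. hub F w Q Y1 Y2) = prb ?I (\<lambda>F. ?s Q \<subseteq> F \<and> (F \<inter> ?s Y1 \<noteq> {} \<and> F \<inter> ?s Y2 \<noteq> {}))"
    unfolding hub_def e by (intro prb_cong) auto
  also have "\<dots> = prb ?I (\<lambda>F. ?s Q \<subseteq> F) * prb ?I (\<lambda>F. F \<inter> ?s Y1 \<noteq> {} \<and> F \<inter> ?s Y2 \<noteq> {})"
  proof (rule prb_indep2[OF fI sub[OF S'(1)]])
    show "(F \<inter> ?s Y1 \<noteq> {} \<and> F \<inter> ?s Y2 \<noteq> {}) = ((F - ?s Q) \<inter> ?s Y1 \<noteq> {} \<and> (F - ?s Q) \<inter> ?s Y2 \<noteq> {})" for F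
      unfolding cut[OF disj(1)] cut[OF disj(2)] ..
  qed auto
  also have "prb ?I (\<lambda>F. F \<inter> ?s Y1 \<noteq> {} \<and> F \<inter> ?s Y2 \<noteq> {}) = prb ?I (\<lambda>F. F \<inter> ?s Y1 \<noteq> {}) * prb ?I (\<lambda>F. F \<inter> ?s Y2 \<noteq> {})"
  proof (rule prb_indep2[OF fI sub[OF S'(2)]])
    show "(F \<inter> ?s Y2 \<noteq> {}) = ((F - ?s Y1) \<inter> ?s Y2 \<noteq> {})" for F
      unfolding cut[OF disj(3)] ..
  qed auto
  finally show ?thesis
    by (simp add: prb_supset[OF fI sub[OF S'(1)]] prb_hit[OF fI sub[OF S'(2)]] prb_hit[OF fI sub[OF S'(3)]]
      card g power2_eq_square)
qed

lemma prb_no_hub: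
  assumes V: "finite V" "W \<subseteq> V"
    and S: "\<And>w. w \<in> W \<Longrightarrow> Q \<union> Y1 w \<union> Y2 w \<subseteq> V - W"
    and disj: "\<And>w. w \<in> W \<Longrightarrow> Q \<inter> Y1 w = {} \<and> Q \<inter> Y2 w = {} \<and> Y1 w \<inter> Y2 w = {}"
    and g: "\<And>w. w \<in> W \<Longrightarrow> card (Y1 w) = g \<and> card (Y2 w) = g"
  shows "prb (pairs V) (\<lambda>F. \<forall>w\<in>W. \<not> hub F w Q (Y1 w) (Y2 w)) \<le> (1 - p ^ card Q * (1 - (1 - p) ^ g)\<^sup>2) ^ card W"
proof (rule prb_all_fail[where J = "\<lambda>w. spokes {w} (V - W)"])
  show "finite (pairs V)" by (rule finite_pairs[OF V(1)])
  show "finite W" using V finite_subset by blast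
  fix w assume w: "w \<in> W"
  show "spokes {w} (V - W) \<subseteq> pairs V" using w V by (auto simp: spokes_def)
  show "hub F w Q (Y1 w) (Y2 w) = hub (F \<inter> spokes {w} (V - W)) w Q (Y1 w) (Y2 w)" for F
    by (rule hub_local[OF S[OF w]])
  show "p ^ card Q * (1 - (1 - p) ^ g)\<^sup>2 \<le> prb (pairs V) (\<lambda>F. hub F w Q (Y1 w) (Y2 w))"
  proof -
    have "Q \<union> Y1 w \<union> Y2 w \<subseteq> V - {w}" using S[OF w] w by blast
    then have "prb (pairs V) (\<lambda>F. hub F w Q (Y1 w) (Y2 w)) = p ^ card Q * (1 - (1 - p) ^ g)\<^sup>2"
      using w V(2) disj[OF w] g[OF w] by (intro prb_hub[OF V(1)]) auto
    then show ?thesis by simp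
  qed
  fix w' assume "w' \<in> W" "w \<noteq> w'"
  then show "spokes {w} (V - W) \<inter> spokes {w'} (V - W) = {}" using w by (intro spokes_disjoint) auto
qed

text \<open>Union bound over the sets of \<open>|X| - t\<close> vertices that could consist of failures only.\<close>
lemma prb_few_hubs:
  assumes V: "finite V" "X \<subseteq> V" and S: "Q \<union> Y1 \<union> Y2 \<subseteq> V - X"
    and disj: "Q \<inter> Y1 = {}" "Q \<inter> Y2 = {}" "Y1 \<inter> Y2 = {}" and g: "card Y1 = g" "card Y2 = g"
    and t: "t \<le> card X"
  shows "prb (pairs V) (\<lambda>F. card {x \<in> X. hub F x Q Y1 Y2} < t) \<le>
    real (card X) ^ t * (1 - p ^ card Q * (1 - (1 - p) ^ g)\<^sup>2) ^ (card X - t)"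
proof -
  have fX: "finite X" using V finite_subset by blast
  let ?ZZ = "{Z. Z \<subseteq> X \<and> card Z = card X - t}"
  have "prb (pairs V) (\<lambda>F. card {x \<in> X. hub F x Q Y1 Y2} < t) \<le>
      prb (pairs V) (\<lambda>F. \<exists>Z\<in>?ZZ. \<forall>x\<in>Z. \<not> hub F x Q Y1 Y2)"
  proof (rule prb_mono)
    fix F assume c: "card {x \<in> X. hub F x Q Y1 Y2} < t"
    have "card X = card {x \<in> X. hub F x Q Y1 Y2} + card {x \<in> X. \<not> hub F x Q Y1 Y2}"
    proof -
      have "X = {x \<in> X. hub F x Q Y1 Y2} \<union> {x \<in> X. \<not> hub F x Q Y1 Y2}" by blast
      moreover have "card ({x \<in> X. hub F x Q Y1 Y2} \<union> {x \<in> X. \<not> hub F x Q Y1 Y2}) =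
          card {x \<in> X. hub F x Q Y1 Y2} + card {x \<in> X. \<not> hub F x Q Y1 Y2}"
        using fX by (intro card_Un_disjoint) auto
      ultimately show ?thesis by simp
    qed
    then have "card X - t \<le> card {x \<in> X. \<not> hub F x Q Y1 Y2}" using c by linarith
    then obtain Z where "Z \<subseteq> {x \<in> X. \<not> hub F x Q Y1 Y2}" "card Z = card X - t"
      by (auto dest!: subset_of_card)
    then show "\<exists>Z\<in>?ZZ. \<forall>x\<in>Z. \<not> hub F x Q Y1 Y2" by (intro bexI[of _ Z]) auto
  qed
  also have "\<dots> \<le> real (card ?ZZ) * (1 - p ^ card Q * (1 - (1 - p) ^ g)\<^sup>2) ^ (card X - t)"
  proof (rule prb_union_le)
    fix Z assume Z: "Z \<in> ?ZZ"
    have "prb (pairs V) (\<lambda>F. \<forall>x\<in>Z. \<not> hub F x Q Y1 Y2) \<le> (1 - p ^ card Q * (1 - (1 - p) ^ g)\<^sup>2) ^ card Z"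
      by (rule prb_no_hub) (use V Z S disj g in auto)
    then show "prb (pairs V) (\<lambda>F. \<forall>x\<in>Z. \<not> hub F x Q Y1 Y2) \<le> (1 - p ^ card Q * (1 - (1 - p) ^ g)\<^sup>2) ^ (card X - t)"
      using Z by simp
  qed (use fX in simp)
  also have "\<dots> \<le> real (card X) ^ t * (1 - p ^ card Q * (1 - (1 - p) ^ g)\<^sup>2) ^ (card X - t)"
  proof (rule mult_right_mono)
    have "card ?ZZ = card X choose t" using n_subsets[OF fX] t by (simp add: binomial_symmetric[symmetric])
    then have "card ?ZZ \<le> card X ^ t" using binomial_le_power by simp
    then show "real (card ?ZZ) \<le> real (card X) ^ t" by (metis of_nat_mono of_nat_power)
    have "p ^ card Q * (1 - (1 - p) ^ g)\<^sup>2 \<le> 1"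
      using p0 p1 by (intro mult_le_one power_le_one) (auto simp: power_le_one)
    then show "0 \<le> (1 - p ^ card Q * (1 - (1 - p) ^ g)\<^sup>2) ^ (card X - t)" by simp
  qed
  finally show ?thesis .
qed

end

text \<open>These edges decide the clusters, and also the degrees from \<open>R1\<close> into \<open>B\<close>.\<close>

definition stage1 :: "'a set \<Rightarrow> 'a set \<Rightarrow> 'a set \<Rightarrow> 'a set set" where
  "stage1 V R1 R2 = {e \<in> pairs V. e \<inter> R2 = {} \<and> e \<inter> R1 \<noteq> {}}"

text \<open>For given \<open>a\<close> and \<open>b\<close>, these edges decide their contacts and all shadows.\<close>
definition stage2 :: "'a set \<Rightarrow> 'a set \<Rightarrow> 'a set \<Rightarrow> 'a \<Rightarrow> 'a \<Rightarrow> 'a set set" where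
  "stage2 V R1 R2 a b = {e \<in> pairs V. e \<inter> R2 \<noteq> {} \<and> e \<subseteq> R1 \<union> R2 \<union> {a, b}}"

text \<open>The situation after the first stage: \<open>F1\<close> is the revealed part of the edge set, and \<open>C w\<close> is a
  cluster found in it.\<close>
locale split_coin = coin +
  fixes V R1 R2 B :: "'a set" and C :: "'a \<Rightarrow> 'a set" and F1 :: "'a set set" and s :: nat
  assumes V: "finite V" "V = R1 \<union> R2 \<union> B" and disj: "R1 \<inter> R2 = {}" "R1 \<inter> B = {}" "R2 \<inter> B = {}"
    and C: "\<And>w. w \<in> B \<Longrightarrow> C w \<subseteq> R1 \<and> 2 * s + 1 \<le> card (C w)"
    and F1: "F1 \<subseteq> stage1 V R1 R2"
begin

abbreviation merged :: "'a set set \<Rightarrow> 'a set set" where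
  "merged F \<equiv> F1 \<union> (F - stage1 V R1 R2)"

lemma fin: "finite R1" "finite R2" "finite B" "finite (pairs V)"
  using V by (auto intro: finite_pairs)

lemma merged_fresh: "e \<inter> R2 \<noteq> {} \<or> e \<inter> R1 = {} \<Longrightarrow> e \<in> merged F \<longleftrightarrow> e \<in> F"
  using F1 by (auto simp: stage1_def)

lemma prb_few_contacts:
  assumes a: "a \<in> V" "w \<in> B" "a \<noteq> w" and t: "t + 1 \<le> card R2"
  shows "prb (pairs V) (\<lambda>F. card (contacts (merged F) R2 B C a \<inter> shadow (merged F) R2 C w) < t) \<le>
    real (card R2) ^ t * (1 - p * (1 - (1 - p) ^ s)\<^sup>2) ^ (card R2 - 1 - t)"
proof -
  define X where "X = R2 - {a}"
  have cX: "card R2 - 1 \<le> card X" "card X \<le> card R2" unfolding X_def using fin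
    by (auto simp: card_Diff_singleton_if intro: card_mono)
  \<comment> \<open>Two disjoint sets of \<open>s\<close> cluster vertices, \<open>C1\<close> for the shadow of \<open>a\<close> and \<open>C2\<close> for that of \<open>w\<close>,
    make the two requirements on \<open>x\<close> independent. This is why clusters of size \<open>2 * s + 1\<close> are asked
    for: the clusters may coincide, and \<open>a\<close> may belong to \<open>C w\<close>.\<close>
  define C0 where "C0 = (if a \<in> B then C a else C w - {a})"
  have Cw: "C w \<subseteq> R1" "2 * s + 1 \<le> card (C w)" "finite (C w)" using C[OF a(2)] fin(1) finite_subset by auto
  have C0: "s \<le> card C0" "C0 \<subseteq> R1" "a \<notin> C0"
  proof -
    show "s \<le> card C0"
      using C[of a] Cw by (auto simp: C0_def card_Diff_singleton_if)
    show "C0 \<subseteq> R1" "a \<notin> C0" using C[of a] Cw disj by (auto simp: C0_def)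
  qed
  obtain C1 where C1: "C1 \<subseteq> C0" "card C1 = s" using C0(1) by (auto dest!: subset_of_card)
  have fC1: "finite C1" by (rule finite_subset[OF order_trans[OF C1(1) C0(2)] fin(1)])
  have "s \<le> card (C w - insert a C1)"
  proof -
    have "card (C w) - card (insert a C1) \<le> card (C w - insert a C1)" using fC1 by (intro diff_card_le_card_Diff) auto
    moreover have "card (insert a C1) \<le> s + 1" using C1(2) fC1 by (simp add: card_insert_if)
    ultimately show ?thesis using Cw(2) by linarith
  qed
  then obtain C2 where C2: "C2 \<subseteq> C w - insert a C1" "card C2 = s" by (auto dest!: subset_of_card)
  have "prb (pairs V) (\<lambda>F. card (contacts (merged F) R2 B C a \<inter> shadow (merged F) R2 C w) < t)
     \<le> prb (pairs V) (\<lambda>F. card {x \<in> X. hub F x {a} C1 C2} < t)"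
  proof (rule prb_mono)
    fix F assume c: "card (contacts (merged F) R2 B C a \<inter> shadow (merged F) R2 C w) < t"
    have "{x \<in> X. hub F x {a} C1 C2} \<subseteq> contacts (merged F) R2 B C a \<inter> shadow (merged F) R2 C w"
    proof
      fix x assume x: "x \<in> {x \<in> X. hub F x {a} C1 C2}"
      then have xR: "x \<in> R2" by (auto simp: X_def)
      have m: "{x, v} \<in> merged F \<longleftrightarrow> {x, v} \<in> F" for v by (rule merged_fresh) (use xR in auto)
      obtain c1 c2 where c: "{x, a} \<in> F" "c1 \<in> C1" "{x, c1} \<in> F" "c2 \<in> C2" "{x, c2} \<in> F"
        using x by (auto simp: hub_def)
      have ax: "{a, x} \<in> merged F" using c(1) m[of a] by (simp add: insert_commute)
      have sw: "x \<in> shadow (merged F) R2 C w" unfolding shadow_def using xR c(4,5) C2(1) m[of c2] by blast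
      have sa: "x \<in> shadow (merged F) R2 C a" if "a \<in> B"
        unfolding shadow_def using xR c(2,3) C1(1) m[of c1] that by (auto simp: C0_def)
      show "x \<in> contacts (merged F) R2 B C a \<inter> shadow (merged F) R2 C w"
        using xR ax sw sa by (auto simp: contacts_def)
    qed
    moreover have "finite (contacts (merged F) R2 B C a \<inter> shadow (merged F) R2 C w)"
      by (rule finite_subset[OF _ fin(2)]) (auto simp: contacts_def)
    ultimately show "card {x \<in> X. hub F x {a} C1 C2} < t" using c card_mono by (meson le_less_trans)
  qed
  also have "\<dots> \<le> real (card X) ^ t * (1 - p ^ card {a} * (1 - (1 - p) ^ s)\<^sup>2) ^ (card X - t)"
  proof (rule prb_few_hubs[OF V(1)])
    show "X \<subseteq> V" using V(2) by (auto simp: X_def)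
    show "{a} \<union> C1 \<union> C2 \<subseteq> V - X" using a C1 C0(2) C2(1) Cw(1) V(2) disj by (auto simp: X_def)
    show "t \<le> card X" using t cX by linarith
  qed (use C1 C2 C0 in auto)
  also have "\<dots> \<le> real (card R2) ^ t * (1 - p * (1 - (1 - p) ^ s)\<^sup>2) ^ (card R2 - 1 - t)"
  proof (rule mult_mono)
    have le: "p * (1 - (1 - p) ^ s)\<^sup>2 \<le> 1" "0 \<le> p * (1 - (1 - p) ^ s)\<^sup>2"
      using p0 p1 by (auto intro!: mult_le_one power_le_one simp: power_le_one)
    show "(1 - p ^ card {a} * (1 - (1 - p) ^ s)\<^sup>2) ^ (card X - t) \<le> (1 - p * (1 - (1 - p) ^ s)\<^sup>2) ^ (card R2 - 1 - t)"
      using le cX by (auto intro!: power_decreasing)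
    show "real (card X) ^ t \<le> real (card R2) ^ t" using cX by (intro power_mono) auto
    show "0 \<le> (1 - p ^ card {a} * (1 - (1 - p) ^ s)\<^sup>2) ^ (card X - t)" using le by simp
  qed simp
  finally show ?thesis .
qed

text \<open>After the second stage the contacts and shadows are known, and the events that a given \<open>w\<close>
  links \<open>a\<close> and \<open>b\<close> are independent.\<close>
lemma prb_contacts_not_linked:
  fixes g d :: nat
  assumes ab: "a \<in> V" "b \<in> B" "a \<noteq> b"
    and deg: "\<And>z. z \<in> R1 \<Longrightarrow> d < card {w \<in> B. {w, z} \<in> F1}"
  defines "many \<equiv> \<lambda>F. \<forall>w\<in>B - {a, b}. 2 * g + 1 \<le> card (contacts (merged F) R2 B C a \<inter> shadow (merged F) R2 C w) \<and>
      2 * g + 1 \<le> card (contacts (merged F) R2 B C b \<inter> shadow (merged F) R2 C w)"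
  shows "prb (pairs V) (\<lambda>F. many F \<and> \<not> linked (merged F) R2 B C a b) \<le>
    (1 - p\<^sup>2 * (1 - (1 - p) ^ g)\<^sup>2) ^ (card B - 2) + (1 - p * (1 - (1 - p) ^ g)\<^sup>2) ^ d"
proof -
  let ?J1 = "stage1 V R1 R2" and ?J2 = "stage2 V R1 R2 a b"
  let ?\<rho> = "1 - (1 - p) ^ g"
  have rho: "0 \<le> p ^ k * ?\<rho>\<^sup>2" "p ^ k * ?\<rho>\<^sup>2 \<le> 1" for k
    using p0 p1 by (auto intro!: mult_le_one power_le_one simp: power_le_one)
  have rho1: "0 \<le> p * ?\<rho>\<^sup>2" "p * ?\<rho>\<^sup>2 \<le> 1" using rho[of 1] by simp_all
  have same: "contacts E R2 B C u = contacts E' R2 B C u" "w \<in> B \<Longrightarrow> shadow E R2 C w = shadow E' R2 C w"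
    if EE: "\<And>e. e \<inter> R2 \<noteq> {} \<Longrightarrow> e \<subseteq> R1 \<union> R2 \<union> {a, b} \<Longrightarrow> e \<in> E \<longleftrightarrow> e \<in> E'" and u: "u = a \<or> u = b" for E E' u w
  proof -
    have sh: "shadow E R2 C w = shadow E' R2 C w" if w: "w \<in> B" for w
    proof -
      have "{x, c} \<in> E \<longleftrightarrow> {x, c} \<in> E'" if "x \<in> R2" "c \<in> C w" for x c
        by (rule EE) (use that C[OF w] in auto)
      then show ?thesis unfolding shadow_def by blast
    qed
    then show "w \<in> B \<Longrightarrow> shadow E R2 C w = shadow E' R2 C w" .
    have "{u, x} \<in> E \<longleftrightarrow> {u, x} \<in> E'" if "x \<in> R2" for x by (rule EE) (use that u in auto)
    then show "contacts E R2 B C u = contacts E' R2 B C u" unfolding contacts_def using sh by blast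
  qed
  have mem2: "e \<in> F \<longleftrightarrow> e \<in> F \<inter> ?J2" if "e \<inter> R2 \<noteq> {}" "e \<subseteq> R1 \<union> R2 \<union> {a, b}" "F \<subseteq> pairs V" for e F
    using that by (auto simp: stage2_def)
  show ?thesis
  proof (rule prb_stage_merge[OF fin(4), where J = ?J2])
    show "?J2 \<subseteq> pairs V" by (auto simp: stage2_def)
    show "0 \<le> (1 - p\<^sup>2 * ?\<rho>\<^sup>2) ^ (card B - 2) + (1 - p * ?\<rho>\<^sup>2) ^ d" using rho[of 2] rho1 by simp
    show "many F = many (F \<inter> ?J2)" if F: "F \<subseteq> pairs V" for F
    proof -
      have EE: "e \<in> merged F \<longleftrightarrow> e \<in> merged (F \<inter> ?J2)" if "e \<inter> R2 \<noteq> {}" "e \<subseteq> R1 \<union> R2 \<union> {a, b}" for e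
        using merged_fresh[of e F] merged_fresh[of e "F \<inter> ?J2"] mem2[OF that F] that(1) by blast
      have "contacts (merged F) R2 B C a = contacts (merged (F \<inter> ?J2)) R2 B C a"
        "contacts (merged F) R2 B C b = contacts (merged (F \<inter> ?J2)) R2 B C b"
        "\<And>w. w \<in> B \<Longrightarrow> shadow (merged F) R2 C w = shadow (merged (F \<inter> ?J2)) R2 C w"
        using same[OF EE] by blast+
      then show ?thesis unfolding many_def by simp
    qed
    fix F2 assume F2: "F2 \<subseteq> ?J2" "many F2"
    let ?E0 = "merged F2"
    have choice: "\<exists>Y1 Y2. Y1 \<subseteq> contacts ?E0 R2 B C a \<inter> shadow ?E0 R2 C w - {a} \<and>
        Y2 \<subseteq> contacts ?E0 R2 B C b \<inter> shadow ?E0 R2 C w - {a} \<and> Y1 \<inter> Y2 = {} \<and> card Y1 = g \<and> card Y2 = g"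
      if w: "w \<in> B - {a, b}" for w
    proof -
      define Xa Xb where "Xa = contacts ?E0 R2 B C a \<inter> shadow ?E0 R2 C w" and "Xb = contacts ?E0 R2 B C b \<inter> shadow ?E0 R2 C w"
      have f: "finite Xa" "finite Xb" by (rule finite_subset[OF _ fin(2)]; auto simp: Xa_def Xb_def contacts_def)+
      have c: "2 * g + 1 \<le> card Xa" "2 * g + 1 \<le> card Xb" using F2(2) w by (auto simp: many_def Xa_def Xb_def)
      have da: "2 * g \<le> card (Xa - {a})" "2 * g \<le> card (Xb - {a})"
        using c diff_card_le_card_Diff[of "{a}" Xa] diff_card_le_card_Diff[of "{a}" Xb] by simp_all
      then have "g \<le> card (Xb - {a})" by simp
      then obtain Y2 where Y2: "Y2 \<subseteq> Xb - {a}" "card Y2 = g" by (auto dest!: subset_of_card)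
      have fY2: "finite Y2" by (rule finite_subset[OF Y2(1)]) (use f(2) in simp)
      have "card (Xa - {a}) - card Y2 \<le> card (Xa - {a} - Y2)" by (rule diff_card_le_card_Diff[OF fY2])
      then have "g \<le> card (Xa - {a} - Y2)" using da(1) Y2(2) by linarith
      then obtain Y1 where Y1: "Y1 \<subseteq> Xa - {a} - Y2" "card Y1 = g" by (auto dest!: subset_of_card)
      show ?thesis using Y1 Y2 unfolding Xa_def Xb_def by blast
    qed
    then have "\<forall>w\<in>B - {a, b}. \<exists>Y. fst Y \<subseteq> contacts ?E0 R2 B C a \<inter> shadow ?E0 R2 C w - {a} \<and>
        snd Y \<subseteq> contacts ?E0 R2 B C b \<inter> shadow ?E0 R2 C w - {a} \<and> fst Y \<inter> snd Y = {} \<and> card (fst Y) = g \<and> card (snd Y) = g"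
      by (metis fst_conv snd_conv)
    then obtain Y where Y: "\<And>w. w \<in> B - {a, b} \<Longrightarrow> fst (Y w) \<subseteq> contacts ?E0 R2 B C a \<inter> shadow ?E0 R2 C w - {a} \<and>
        snd (Y w) \<subseteq> contacts ?E0 R2 B C b \<inter> shadow ?E0 R2 C w - {a} \<and> fst (Y w) \<inter> snd (Y w) = {} \<and>
        card (fst (Y w)) = g \<and> card (snd (Y w)) = g" using bchoice by metis
    have YR: "fst (Y w) \<subseteq> R2 - {a}" "snd (Y w) \<subseteq> R2 - {a}" if "w \<in> B - {a, b}" for w
      using Y[OF that] by (auto simp: contacts_def)
    \<comment> \<open>Edges between \<open>B\<close> and \<open>R1\<close> were revealed in the first stage. So for \<open>a \<in> R1\<close> only the neighbours \<open>w\<close> of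
      \<open>a\<close> are candidates, and the degree condition provides enough of them.\<close>
    define Q W where "Q = (if a \<in> R1 then {b} else {a, b})"
      and "W = (if a \<in> R1 then {w \<in> B - {b}. {w, a} \<in> F1} else B - {a, b})"
    have W: "W \<subseteq> B - {a, b}" using disj by (auto simp: W_def)
    have "prb (pairs V) (\<lambda>F. \<not> linked (merged (F2 \<union> (F - ?J2))) R2 B C a b) \<le>
        prb (pairs V) (\<lambda>F. \<forall>w\<in>W. \<not> hub F w Q (fst (Y w)) (snd (Y w)))"
    proof (rule prb_mono)
      fix F assume F: "F \<subseteq> pairs V" "\<not> linked (merged (F2 \<union> (F - ?J2))) R2 B C a b"
      let ?E2 = "merged (F2 \<union> (F - ?J2))"
      show "\<forall>w\<in>W. \<not> hub F w Q (fst (Y w)) (snd (Y w))"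
      proof (rule ballI, rule notI)
        fix w assume w: "w \<in> W" and h: "hub F w Q (fst (Y w)) (snd (Y w))"
        have wB: "w \<in> B - {a, b}" using w W by blast
        have EE: "e \<in> ?E0 \<longleftrightarrow> e \<in> ?E2" if e: "e \<inter> R2 \<noteq> {}" "e \<subseteq> R1 \<union> R2 \<union> {a, b}" for e
        proof -
          have "e \<in> F - ?J2 \<Longrightarrow> False" using e F(1) by (auto simp: stage2_def)
          then show ?thesis using merged_fresh[of e F2] merged_fresh[of e "F2 \<union> (F - ?J2)"] e(1) by blast
        qed
        have ct: "contacts ?E0 R2 B C a = contacts ?E2 R2 B C a" "contacts ?E0 R2 B C b = contacts ?E2 R2 B C b"
            "shadow ?E0 R2 C w = shadow ?E2 R2 C w"
          using same[OF EE] wB by blast+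
        have fresh: "{w, v} \<in> ?E2" if v: "{w, v} \<in> F" "v \<in> R2 \<or> v \<in> B" for v
        proof -
          have "{w, v} \<notin> ?J2"
            using v(2) wB disj by (auto simp: stage2_def)
          then show ?thesis using v wB disj merged_fresh[of "{w, v}" "F2 \<union> (F - ?J2)"] by auto
        qed
        obtain x y where xy: "x \<in> fst (Y w)" "{w, x} \<in> F" "y \<in> snd (Y w)" "{w, y} \<in> F" using h by (auto simp: hub_def)
        have "{w, x} \<in> ?E2" "{w, y} \<in> ?E2" using fresh[OF xy(2)] fresh[OF xy(4)] YR[OF wB] xy by auto
        moreover have "x \<in> contacts ?E2 R2 B C a \<inter> shadow ?E2 R2 C w" "y \<in> contacts ?E2 R2 B C b \<inter> shadow ?E2 R2 C w"
          using Y[OF wB] xy(1,3) unfolding ct by blast+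
        moreover have "{w, b} \<in> ?E2"
        proof (rule fresh)
          show "{w, b} \<in> F" using h unfolding hub_def Q_def by (simp split: if_splits)
        qed (use ab in auto)
        moreover have "{w, a} \<in> ?E2"
        proof (cases "a \<in> R1")
          case True
          then show ?thesis using w by (simp add: W_def)
        next
          case False
          then show ?thesis using h ab V(2) by (intro fresh) (auto simp: hub_def Q_def)
        qed
        ultimately have "linked ?E2 R2 B C a b" unfolding linked_def using wB by blast
        then show False using F(2) by blast
      qed
    qed
    also have "\<dots> \<le> (1 - p ^ card Q * ?\<rho>\<^sup>2) ^ card W"
    proof (rule prb_no_hub[OF V(1)])
      show "W \<subseteq> V" using W V(2) by blast
      fix w assume w: "w \<in> W"
      then have wB: "w \<in> B - {a, b}" using W by blast
      show "Q \<union> fst (Y w) \<union> snd (Y w) \<subseteq> V - W"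
        using YR[OF wB] ab V(2) disj W by (auto simp: Q_def)
      show "Q \<inter> fst (Y w) = {} \<and> Q \<inter> snd (Y w) = {} \<and> fst (Y w) \<inter> snd (Y w) = {}"
        using YR[OF wB] Y[OF wB] ab disj by (auto simp: Q_def)
      show "card (fst (Y w)) = g \<and> card (snd (Y w)) = g" using Y[OF wB] by blast
    qed
    also have "\<dots> \<le> (1 - p\<^sup>2 * ?\<rho>\<^sup>2) ^ (card B - 2) + (1 - p * ?\<rho>\<^sup>2) ^ d"
    proof (cases "a \<in> R1")
      case True
      have "d \<le> card W"
      proof -
        have "W = {w \<in> B. {w, a} \<in> F1} - {b}" using True by (auto simp: W_def)
        then have "card {w \<in> B. {w, a} \<in> F1} - 1 \<le> card W"
          using diff_card_le_card_Diff[of "{b}" "{w \<in> B. {w, a} \<in> F1}"] by simp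
        then show ?thesis using deg[OF True] by linarith
      qed
      then have "(1 - p * ?\<rho>\<^sup>2) ^ card W \<le> (1 - p * ?\<rho>\<^sup>2) ^ d" using rho1 by (intro power_decreasing) auto
      then show ?thesis using rho[of 2] True by (simp add: Q_def add_increasing)
    next
      case False
      have "card B - card {a, b} \<le> card W"
        using False by (simp add: W_def) (rule diff_card_le_card_Diff, simp)
      then have "card B - 2 \<le> card W" using ab(3) by simp
      then have "(1 - p\<^sup>2 * ?\<rho>\<^sup>2) ^ card W \<le> (1 - p\<^sup>2 * ?\<rho>\<^sup>2) ^ (card B - 2)" using rho[of 2] by (intro power_decreasing) auto
      moreover have "card Q = 2" using False ab(3) by (simp add: Q_def)
      ultimately show ?thesis using rho1 by (simp add: add_increasing2)
    qed
    finally show "prb (pairs V) (\<lambda>F. \<not> linked (merged (F2 \<union> (F - ?J2))) R2 B C a b) \<le>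
      (1 - p\<^sup>2 * ?\<rho>\<^sup>2) ^ (card B - 2) + (1 - p * ?\<rho>\<^sup>2) ^ d" .
  qed
qed

text \<open>Union bound over all pairs. For each pair, either some \<open>w\<close> shares few contacts with \<open>a\<close> or with \<open>b\<close>,
  or the third stage fails.\<close>
lemma prb_not_all_linked:
  assumes n: "card V \<le> n" and t: "2 * g + 2 \<le> card R2"
    and deg: "\<And>z. z \<in> R1 \<Longrightarrow> d < card {w \<in> B. {w, z} \<in> F1}"
  shows "prb (pairs V) (\<lambda>F. \<exists>a\<in>V. \<exists>b\<in>B. a \<noteq> b \<and> \<not> linked (merged F) R2 B C a b) \<le>
    real n * (real n * (2 * (real n * (real (card R2) ^ (2 * g + 1) * (1 - p * (1 - (1 - p) ^ s)\<^sup>2) ^ (card R2 - 1 - (2 * g + 1)))) +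
      ((1 - p\<^sup>2 * (1 - (1 - p) ^ g)\<^sup>2) ^ (card B - 2) + (1 - p * (1 - (1 - p) ^ g)\<^sup>2) ^ d)))"
    (is "_ \<le> real n * (real n * ?bound)")
proof -
  let ?I = "pairs V"
  let ?t = "2 * g + 1"
  let ?\<beta> = "real (card R2) ^ ?t * (1 - p * (1 - (1 - p) ^ s)\<^sup>2) ^ (card R2 - 1 - ?t)"
  have "card B \<le> card V" by (rule card_mono[OF V(1)]) (use V(2) in blast)
  then have cB: "card B \<le> n" using n by linarith
  let ?few = "\<lambda>u w F. card (contacts (merged F) R2 B C u \<inter> shadow (merged F) R2 C w) < ?t"
  have beta: "0 \<le> ?\<beta>"
    using p0 p1 by (auto intro!: mult_nonneg_nonneg zero_le_power mult_le_one power_le_one simp: power_le_one)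
  have nb: "real (card B) * ?\<beta> \<le> real n * ?\<beta>" using cB beta by (intro mult_right_mono) auto
  have pair: "prb ?I (\<lambda>F. \<not> linked (merged F) R2 B C a b) \<le> ?bound" if ab: "a \<in> V" "b \<in> B" "a \<noteq> b" for a b
  proof -
    let ?W = "B - {a, b}"
    let ?many = "\<lambda>F. \<forall>w\<in>?W. ?t \<le> card (contacts (merged F) R2 B C a \<inter> shadow (merged F) R2 C w) \<and>
      ?t \<le> card (contacts (merged F) R2 B C b \<inter> shadow (merged F) R2 C w)"
    have few: "prb ?I (\<lambda>F. \<exists>w\<in>?W. ?few u w F) \<le> real n * ?\<beta>" if u: "u = a \<or> u = b" for u
    proof -
      have "prb ?I (\<lambda>F. \<exists>w\<in>?W. ?few u w F) \<le> real (card ?W) * ?\<beta>"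
      proof (rule prb_union_le)
        fix w assume "w \<in> ?W"
        then show "prb ?I (\<lambda>F. ?few u w F) \<le> ?\<beta>"
          using u ab V(2) t by (intro prb_few_contacts) auto
      qed (use fin(3) in simp)
      also have "\<dots> \<le> real (card B) * ?\<beta>"
        using beta fin(3) card_mono[of B ?W] by (intro mult_right_mono) auto
      finally show ?thesis using nb by linarith
    qed
    have "prb ?I (\<lambda>F. \<not> linked (merged F) R2 B C a b) \<le>
        prb ?I (\<lambda>F. ((\<exists>w\<in>?W. ?few a w F) \<or> (\<exists>w\<in>?W. ?few b w F)) \<or> (?many F \<and> \<not> linked (merged F) R2 B C a b))"
      by (rule prb_mono) (auto simp: not_less)
    also have "\<dots> \<le> (prb ?I (\<lambda>F. \<exists>w\<in>?W. ?few a w F) + prb ?I (\<lambda>F. \<exists>w\<in>?W. ?few b w F)) +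
        prb ?I (\<lambda>F. ?many F \<and> \<not> linked (merged F) R2 B C a b)"
      by (rule order_trans[OF prb_disj]) (intro add_mono prb_disj order_refl)
    also have "\<dots> \<le> (real n * ?\<beta> + real n * ?\<beta>) +
        ((1 - p\<^sup>2 * (1 - (1 - p) ^ g)\<^sup>2) ^ (card B - 2) + (1 - p * (1 - (1 - p) ^ g)\<^sup>2) ^ d)"
      by (intro add_mono few prb_contacts_not_linked[OF ab deg]) auto
    finally show ?thesis by simp
  qed
  have pos: "0 \<le> ?bound"
  proof (cases "\<exists>a b. a \<in> V \<and> b \<in> B \<and> a \<noteq> b")
    case True
    then show ?thesis using pair prb_nonneg order_trans by blast
  next
    case False
    have "0 \<le> 1 - p\<^sup>2 * (1 - (1 - p) ^ g)\<^sup>2" "0 \<le> 1 - p * (1 - (1 - p) ^ g)\<^sup>2"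
      using p0 p1 by (auto intro!: mult_le_one power_le_one simp: power_le_one)
    then show ?thesis using beta by simp
  qed
  have "prb ?I (\<lambda>F. \<exists>a\<in>V. \<exists>b\<in>B. a \<noteq> b \<and> \<not> linked (merged F) R2 B C a b) \<le> real (card V) * (real (card B) * ?bound)"
  proof (rule prb_union_le[OF V(1)])
    fix a assume a: "a \<in> V"
    show "prb ?I (\<lambda>F. \<exists>b\<in>B. a \<noteq> b \<and> \<not> linked (merged F) R2 B C a b) \<le> real (card B) * ?bound"
    proof (rule prb_union_le[OF fin(3)])
      fix b assume b: "b \<in> B"
      show "prb ?I (\<lambda>F. a \<noteq> b \<and> \<not> linked (merged F) R2 B C a b) \<le> ?bound"
      proof (cases "a = b")
        case True
        then show ?thesis using pos by (simp add: prb_def)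
      next
        case False
        then show ?thesis using pair[OF a b] by simp
      qed
    qed
  qed
  also have "\<dots> \<le> real n * (real n * ?bound)"
    using n cB pos by (intro mult_mono mult_right_mono mult_nonneg_nonneg) auto
  finally show ?thesis .
qed

end

context coin begin

text \<open>The edges at \<open>w\<close> are revealed first. The edges between its neighbours are then still random, so
  that the exploration can be carried out among more than \<open>h\<close> vertices.\<close>
lemma prb_no_cluster:
  assumes V: "finite V" "R \<subseteq> V" "w \<in> V" "w \<notin> R"
    and z: "0 \<le> z" "z \<le> 1" "(1 - p + p * z) ^ M \<le> z" and S: "M + k * s \<le> h + 1" "0 < k" "0 < s"
    and y: "0 < y" "y \<le> 1"
  shows "prb (pairs V) (\<lambda>F. \<not> (\<exists>C. cluster F R w C \<and> s \<le> card C)) \<le> (1 - p + p * y) ^ card R / y ^ h + z ^ k"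
proof -
  let ?I = "pairs V"
  let ?J = "(\<lambda>c. {w, c}) ` R"
  have fI: "finite ?I" by (rule finite_pairs[OF V(1)])
  have JI: "?J \<subseteq> ?I" using V by auto
  have inj: "inj_on (\<lambda>c. {w, c}) R" by (auto simp: inj_on_def doubleton_eq_iff)
  define N where "N F = {c \<in> R. {w, c} \<in> F}" for F
  have cN: "card (N F) = card (F \<inter> ?J)" for F
  proof -
    have "F \<inter> ?J = (\<lambda>c. {w, c}) ` N F" by (auto simp: N_def)
    moreover have "inj_on (\<lambda>c. {w, c}) (N F)" by (rule inj_on_subset[OF inj]) (auto simp: N_def)
    ultimately show ?thesis by (simp add: card_image)
  qed
  have "prb ?I (\<lambda>F. \<not> (\<exists>C. cluster F R w C \<and> s \<le> card C)) \<le>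
      prb ?I (\<lambda>F. card (F \<inter> ?J) \<le> h \<or> (h + 1 \<le> card (N F) \<and> \<not> (\<exists>C. cluster F R w C \<and> s \<le> card C)))"
    by (rule prb_mono) (auto simp: cN)
  also have "\<dots> \<le> prb ?I (\<lambda>F. card (F \<inter> ?J) \<le> h) + prb ?I (\<lambda>F. h + 1 \<le> card (N F) \<and> \<not> (\<exists>C. cluster F R w C \<and> s \<le> card C))"
    by (rule prb_disj)
  also have "prb ?I (\<lambda>F. card (F \<inter> ?J) \<le> h) \<le> (1 - p + p * y) ^ card R / y ^ h"
    using prb_card_le[OF fI JI y, of h] by (simp add: card_image[OF inj])
  also have "prb ?I (\<lambda>F. h + 1 \<le> card (N F) \<and> \<not> (\<exists>C. cluster F R w C \<and> s \<le> card C)) \<le> z ^ k"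
  proof (rule prb_stage_merge[OF fI JI])
    show "(h + 1 \<le> card (N F)) = (h + 1 \<le> card (N (F \<inter> ?J)))" for F by (simp add: cN Int_assoc)
    fix F1 assume F1: "F1 \<subseteq> ?J" "h + 1 \<le> card (N F1)"
    let ?K = "N F1"
    have KR: "?K \<subseteq> R" by (auto simp: N_def)
    have fK: "finite ?K" by (rule finite_subset[OF order_trans[OF KR V(2)] V(1)])
    have KI: "pairs ?K \<subseteq> ?I" using KR V(2) by (auto simp: pairs_def)
    have "prb ?I (\<lambda>F'. \<not> (\<exists>C. cluster (F1 \<union> (F' - ?J)) R w C \<and> s \<le> card C)) \<le>
        prb ?I (\<lambda>F'. \<not> (\<exists>C\<subseteq>?K. s \<le> card C \<and> (\<forall>x\<in>C. \<forall>y\<in>C. conn (F' \<inter> pairs C) x y)))"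
    proof (rule prb_mono)
      fix F' assume n: "\<not> (\<exists>C. cluster (F1 \<union> (F' - ?J)) R w C \<and> s \<le> card C)"
      show "\<not> (\<exists>C\<subseteq>?K. s \<le> card C \<and> (\<forall>x\<in>C. \<forall>y\<in>C. conn (F' \<inter> pairs C) x y))"
      proof
        assume "\<exists>C\<subseteq>?K. s \<le> card C \<and> (\<forall>x\<in>C. \<forall>y\<in>C. conn (F' \<inter> pairs C) x y)"
        then obtain C where C: "C \<subseteq> ?K" "s \<le> card C" "\<And>x y. x \<in> C \<Longrightarrow> y \<in> C \<Longrightarrow> conn (F' \<inter> pairs C) x y" by blast
        have sub: "F' \<inter> pairs C \<subseteq> (F1 \<union> (F' - ?J)) \<inter> pairs C"
        proof
          fix e assume e: "e \<in> F' \<inter> pairs C"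
          have "w \<notin> C" using C(1) KR V(4) by blast
          then have "e \<notin> ?J" using e by (auto simp: pairs_def)
          then show "e \<in> (F1 \<union> (F' - ?J)) \<inter> pairs C" using e by blast
        qed
        have "cluster (F1 \<union> (F' - ?J)) R w C" unfolding cluster_def
        proof (intro conjI ballI)
          show "C \<subseteq> R" using C(1) KR by blast
          show "{w, c} \<in> F1 \<union> (F' - ?J)" if "c \<in> C" for c using C(1) that by (auto simp: N_def)
          show "conn ((F1 \<union> (F' - ?J)) \<inter> pairs C) x y" if "x \<in> C" "y \<in> C" for x y
            using C(3)[OF that] sub by (rule conn_mono)
        qed
        then show False using n C(2) by blast
      qed
    qed
    also have "\<dots> = prb (pairs ?K) (\<lambda>F'. \<not> (\<exists>C\<subseteq>?K. s \<le> card C \<and> (\<forall>x\<in>C. \<forall>y\<in>C. conn (F' \<inter> pairs C) x y)))"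
    proof (rule prb_restrict[OF fI KI])
      fix F' :: "'a set set"
      have "F' \<inter> pairs C = (F' \<inter> pairs ?K) \<inter> pairs C" if "C \<subseteq> ?K" for C using that by (auto simp: pairs_def)
      then show "(\<not> (\<exists>C\<subseteq>?K. s \<le> card C \<and> (\<forall>x\<in>C. \<forall>y\<in>C. conn (F' \<inter> pairs C) x y))) =
        (\<not> (\<exists>C\<subseteq>?K. s \<le> card C \<and> (\<forall>x\<in>C. \<forall>y\<in>C. conn (F' \<inter> pairs ?K \<inter> pairs C) x y)))" by metis
    qed
    also have "\<dots> \<le> z ^ k"
      using S F1(2) by (intro prb_no_component[OF fK z _ S(2,3)]) linarith
    finally show "prb ?I (\<lambda>F'. \<not> (\<exists>C. cluster (F1 \<union> (F' - ?J)) R w C \<and> s \<le> card C)) \<le> z ^ k" .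
  qed (use z in simp)
  finally show ?thesis by simp
qed

definition structured :: "'a set set \<Rightarrow> 'a set \<Rightarrow> 'a set \<Rightarrow> 'a set \<Rightarrow> bool" where
  "structured F R1 R2 B \<longleftrightarrow> (\<exists>C. (\<forall>w\<in>B. cluster F R1 w (C w) \<and> C w \<noteq> {}) \<and>
     (\<forall>a\<in>R1 \<union> R2 \<union> B. \<forall>b\<in>B. a \<noteq> b \<longrightarrow> linked F R2 B C a b))"

lemma structured_mono:
  assumes "structured F R1 R2 B" "F \<subseteq> E"
  shows "structured E R1 R2 B"
proof -
  obtain C where C: "\<forall>w\<in>B. cluster F R1 w (C w) \<and> C w \<noteq> {}"
    "\<forall>a\<in>R1 \<union> R2 \<union> B. \<forall>b\<in>B. a \<noteq> b \<longrightarrow> linked F R2 B C a b"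
    using assms(1) unfolding structured_def by (elim exE conjE)
  have sh: "shadow F R2 C w \<subseteq> shadow E R2 C w" for w using assms(2) by (auto simp: shadow_def)
  have ct: "contacts F R2 B C a \<subseteq> contacts E R2 B C a" for a using assms(2) sh by (auto simp: contacts_def)
  have lk: "linked E R2 B C a b" if "linked F R2 B C a b" for a b
    using that assms(2) sh ct unfolding linked_def by blast
  have cl: "cluster E R1 w D" if "cluster F R1 w D" for w D
  proof -
    have "conn (E \<inter> pairs D) x y" if "conn (F \<inter> pairs D) x y" for x y
      using that by (rule conn_mono) (use assms(2) in blast)
    then show ?thesis using that assms(2) unfolding cluster_def by blast
  qed
  show ?thesis unfolding structured_def
  proof (intro exI[of _ C] conjI ballI impI)
    show "cluster E R1 w (C w)" "C w \<noteq> {}" if "w \<in> B" for w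
      using bspec[OF C(1) that] cl by simp_all
    show "linked E R2 B C a b" if "a \<in> R1 \<union> R2 \<union> B" "b \<in> B" "a \<noteq> b" for a b
      using bspec[OF bspec[OF C(2) that(1)] that(2)] that(3) lk by simp
  qed
qed

lemma prb_not_structured:
  fixes R1 R2 B :: "'a set" and g d s k h M n r1 b0 m2 :: nat and y z :: real
  assumes V: "finite V" "V = R1 \<union> R2 \<union> B" and disj: "R1 \<inter> R2 = {}" "R1 \<inter> B = {}" "R2 \<inter> B = {}"
    and sizes: "card V \<le> n" "r1 \<le> card R1" "card R2 = m2" "b0 \<le> card B" "2 * g + 2 \<le> m2"
    and z: "0 \<le> z" "z \<le> 1" "(1 - p + p * z) ^ M \<le> z" and S: "M + k * (2 * s + 1) \<le> h + 1" "0 < k"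
    and y: "0 < y" "y \<le> 1"
  shows "prb (pairs V) (\<lambda>F. \<not> structured F R1 R2 B) \<le>
    real n * ((1 - p + p * y) ^ r1 / y ^ h + z ^ k) + real n * ((1 - p + p * y) ^ b0 / y ^ d) +
    real n * (real n * (2 * (real n * (real m2 ^ (2 * g + 1) * (1 - p * (1 - (1 - p) ^ s)\<^sup>2) ^ (m2 - 1 - (2 * g + 1)))) +
      ((1 - p\<^sup>2 * (1 - (1 - p) ^ g)\<^sup>2) ^ (b0 - 2) + (1 - p * (1 - (1 - p) ^ g)\<^sup>2) ^ d)))"
    (is "_ \<le> ?T1 + ?T2 + ?T3 b0")
proof -
  let ?I = "pairs V" and ?J = "stage1 V R1 R2"
  have fin: "finite R1" "finite R2" "finite B" "finite ?I" using V by (auto intro: finite_pairs)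
  have yb: "0 \<le> 1 - p + p * y" "1 - p + p * y \<le> 1" using p0 p1 y mult_left_mono[of y 1 p] by auto
  have "card R1 \<le> card V" "card B \<le> card V" by (rule card_mono[OF V(1)]; use V(2) in blast)+
  then have cn: "card R1 \<le> n" "card B \<le> n" using sizes(1) by linarith+
  define cl where "cl w F \<longleftrightarrow> (\<exists>C. cluster F R1 w C \<and> 2 * s + 1 \<le> card C)" for w F
  define dg where "dg v F \<longleftrightarrow> d < card {w \<in> B. {w, v} \<in> F}" for v F
  define good where "good F \<longleftrightarrow> (\<forall>w\<in>B. cl w F) \<and> (\<forall>v\<in>R1. dg v F)" for F
  have J_iff: "e \<in> F \<longleftrightarrow> e \<in> F \<inter> ?J" if "F \<subseteq> ?I" "e \<inter> R2 = {}" "e \<inter> R1 \<noteq> {}" for e F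
    using that by (auto simp: stage1_def)
  have cluster_J: "cluster F R1 w C = cluster F' R1 w C"
    if w: "w \<in> B" and FF: "\<And>e. e \<inter> R2 = {} \<Longrightarrow> e \<inter> R1 \<noteq> {} \<Longrightarrow> e \<in> F \<longleftrightarrow> e \<in> F'" for w C F F'
  proof (cases "C \<subseteq> R1")
    case True
    have "{w, c} \<in> F \<longleftrightarrow> {w, c} \<in> F'" if "c \<in> C" for c by (rule FF) (use that True w disj in auto)
    moreover have "F \<inter> pairs C = F' \<inter> pairs C"
    proof -
      have "e \<in> F \<longleftrightarrow> e \<in> F'" if e: "e \<in> pairs C" for e
      proof -
        obtain u v where uv: "e = {u, v}" "u \<in> C" "v \<in> C" using e by (rule pairs_E)
        show ?thesis by (rule FF) (use uv True disj in auto)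
      qed
      then show ?thesis by auto
    qed
    ultimately show ?thesis by (simp add: cluster_def)
  qed (simp add: cluster_def)
  have "prb ?I (\<lambda>F. \<not> structured F R1 R2 B) \<le>
      prb ?I (\<lambda>F. ((\<exists>w\<in>B. \<not> cl w F) \<or> (\<exists>v\<in>R1. \<not> dg v F)) \<or> (good F \<and> \<not> structured F R1 R2 B))"
    by (rule prb_mono) (auto simp: good_def)
  also have "\<dots> \<le> (prb ?I (\<lambda>F. \<exists>w\<in>B. \<not> cl w F) + prb ?I (\<lambda>F. \<exists>v\<in>R1. \<not> dg v F)) +
      prb ?I (\<lambda>F. good F \<and> \<not> structured F R1 R2 B)"
    by (rule order_trans[OF prb_disj]) (intro add_mono prb_disj order_refl)
  also have "prb ?I (\<lambda>F. \<exists>w\<in>B. \<not> cl w F) \<le> ?T1"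
  proof -
    have "prb ?I (\<lambda>F. \<exists>w\<in>B. \<not> cl w F) \<le> real (card B) * ((1 - p + p * y) ^ r1 / y ^ h + z ^ k)"
    proof (rule prb_union_le[OF fin(3)])
      fix w assume w: "w \<in> B"
      have "prb ?I (\<lambda>F. \<not> cl w F) \<le> (1 - p + p * y) ^ card R1 / y ^ h + z ^ k"
        unfolding cl_def by (rule prb_no_cluster[OF V(1) _ _ _ z S]) (use w V(2) disj y in auto)
      also have "(1 - p + p * y) ^ card R1 / y ^ h \<le> (1 - p + p * y) ^ r1 / y ^ h"
        using yb y sizes(2) by (intro divide_right_mono power_decreasing) auto
      finally show "prb ?I (\<lambda>F. \<not> cl w F) \<le> (1 - p + p * y) ^ r1 / y ^ h + z ^ k" by simp
    qed
    also have "\<dots> \<le> ?T1" using cn z y yb by (intro mult_right_mono) auto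
    finally show ?thesis .
  qed
  also have "prb ?I (\<lambda>F. \<exists>v\<in>R1. \<not> dg v F) \<le> ?T2"
  proof -
    have "prb ?I (\<lambda>F. \<exists>v\<in>R1. \<not> dg v F) \<le> real (card R1) * ((1 - p + p * y) ^ b0 / y ^ d)"
    proof (rule prb_union_le[OF fin(1)])
      fix v assume v: "v \<in> R1"
      let ?S = "(\<lambda>w. {w, v}) ` B"
      have inj: "inj_on (\<lambda>w. {w, v}) B" by (auto simp: inj_on_def doubleton_eq_iff)
      have SI: "?S \<subseteq> ?I" using v V(2) disj by auto
      have "card {w \<in> B. {w, v} \<in> F} = card (F \<inter> ?S)" for F
      proof -
        have "F \<inter> ?S = (\<lambda>w. {w, v}) ` {w \<in> B. {w, v} \<in> F}" by auto
        moreover have "inj_on (\<lambda>w. {w, v}) {w \<in> B. {w, v} \<in> F}" by (rule inj_on_subset[OF inj]) auto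
        ultimately show ?thesis by (simp add: card_image)
      qed
      then have "prb ?I (\<lambda>F. \<not> dg v F) = prb ?I (\<lambda>F. card (F \<inter> ?S) \<le> d)" by (simp add: dg_def not_less)
      also have "\<dots> \<le> (1 - p + p * y) ^ card ?S / y ^ d" by (rule prb_card_le[OF fin(4) SI y])
      also have "\<dots> \<le> (1 - p + p * y) ^ b0 / y ^ d"
        using yb y sizes(4) by (intro divide_right_mono power_decreasing) (auto simp: card_image[OF inj])
      finally show "prb ?I (\<lambda>F. \<not> dg v F) \<le> (1 - p + p * y) ^ b0 / y ^ d" .
    qed
    also have "\<dots> \<le> ?T2" using cn y yb by (intro mult_right_mono) auto
    finally show ?thesis .
  qed
  also have "prb ?I (\<lambda>F. good F \<and> \<not> structured F R1 R2 B) \<le> ?T3 b0"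
  proof (rule prb_stage_merge[OF fin(4), where J = ?J])
    show "?J \<subseteq> ?I" by (auto simp: stage1_def)
    have nn: "0 \<le> 1 - p * (1 - (1 - p) ^ i)\<^sup>2" "0 \<le> 1 - p\<^sup>2 * (1 - (1 - p) ^ i)\<^sup>2" "1 - p\<^sup>2 * (1 - (1 - p) ^ i)\<^sup>2 \<le> 1" for i
      using p0 p1 by (auto intro!: mult_le_one power_le_one simp: power_le_one)
    show "0 \<le> ?T3 b0" using nn by (intro mult_nonneg_nonneg add_nonneg_nonneg zero_le_power) auto
    show "good F = good (F \<inter> ?J)" if F: "F \<subseteq> ?I" for F
    proof -
      have "cl w F = cl w (F \<inter> ?J)" if w: "w \<in> B" for w
        unfolding cl_def using cluster_J[OF w J_iff[OF F]] by simp
      moreover have "dg v F = dg v (F \<inter> ?J)" if v: "v \<in> R1" for v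
      proof -
        have "{w, v} \<in> F \<longleftrightarrow> {w, v} \<in> F \<inter> ?J" if "w \<in> B" for w
          by (rule J_iff[OF F]) (use v that disj in auto)
        then have "{w \<in> B. {w, v} \<in> F} = {w \<in> B. {w, v} \<in> F \<inter> ?J}" by blast
        then show ?thesis by (simp only: dg_def)
      qed
      ultimately show ?thesis unfolding good_def by simp
    qed
    fix F1 assume F1: "F1 \<subseteq> ?J" "good F1"
    have "\<forall>w\<in>B. \<exists>C. cluster F1 R1 w C \<and> 2 * s + 1 \<le> card C" using F1(2) by (simp add: good_def cl_def)
    then obtain C where "\<forall>w\<in>B. cluster F1 R1 w (C w) \<and> 2 * s + 1 \<le> card (C w)" using bchoice by metis
    then have CL: "cluster F1 R1 w (C w)" "2 * s + 1 \<le> card (C w)" if "w \<in> B" for w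
      using that by blast+
    let ?m = "\<lambda>F'. F1 \<union> (F' - ?J)"
    interpret sc: split_coin p V R1 R2 B C F1 s
      by unfold_locales (use V disj CL F1 in \<open>auto simp: cluster_def\<close>)
    have "prb ?I (\<lambda>F'. \<not> structured (?m F') R1 R2 B) \<le>
        prb ?I (\<lambda>F'. \<exists>a\<in>V. \<exists>b\<in>B. a \<noteq> b \<and> \<not> linked (?m F') R2 B C a b)"
    proof (rule prb_mono)
      fix F' assume F': "F' \<subseteq> ?I" "\<not> structured (?m F') R1 R2 B"
      have "cluster (?m F') R1 w (C w) \<and> C w \<noteq> {}" if w: "w \<in> B" for w
      proof -
        have eq: "e \<in> ?m F' \<longleftrightarrow> e \<in> F1" if "e \<inter> R2 = {}" "e \<inter> R1 \<noteq> {}" for e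
          using that F'(1) by (auto simp: stage1_def)
        have "cluster (?m F') R1 w (C w) = cluster F1 R1 w (C w)" by (rule cluster_J[OF w eq])
        then have "cluster (?m F') R1 w (C w)" using CL(1)[OF w] by simp
        moreover have "C w \<noteq> {}" using CL(2)[OF w] by auto
        ultimately show ?thesis by blast
      qed
      then have "\<forall>w\<in>B. cluster (?m F') R1 w (C w) \<and> C w \<noteq> {}" by (rule ballI)
      then have "\<not> (\<forall>a\<in>R1 \<union> R2 \<union> B. \<forall>b\<in>B. a \<noteq> b \<longrightarrow> linked (?m F') R2 B C a b)"
        using F'(2) unfolding structured_def by (metis (no_types, lifting))
      then show "\<exists>a\<in>V. \<exists>b\<in>B. a \<noteq> b \<and> \<not> linked (?m F') R2 B C a b"
        unfolding V(2) by simp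
    qed
    also have "\<dots> \<le> ?T3 (card B)"
      using sc.prb_not_all_linked[of n g d] sizes F1(2) by (simp add: good_def dg_def)
    also have "\<dots> \<le> ?T3 b0"
      using nn sizes(4) p0 by (intro mult_left_mono add_mono power_decreasing) auto
    finally show "prb ?I (\<lambda>F'. \<not> structured (F1 \<union> (F' - ?J)) R1 R2 B) \<le> ?T3 b0" .
  qed
  finally show ?thesis by simp
qed

text \<open>The neighbours of the root 1 are revealed first. The graph on the other vertices is not
  affected by this, and so any partition of the neighbours into \<open>R1\<close> and \<open>R2\<close> may be used.\<close>
lemma prb_no_activating_tree:
  fixes g d s k h M n r1 m2 b0 lo hi :: nat and y z :: real
  assumes n: "0 < n" and sizes: "r1 + m2 \<le> lo" "b0 + hi + 1 \<le> n" "0 < b0" "2 * g + 2 \<le> m2"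
    and z: "0 \<le> z" "z \<le> 1" "(1 - p + p * z) ^ M \<le> z" and S: "M + k * (2 * s + 1) \<le> h + 1" "0 < k"
    and y: "0 < y" "y \<le> 1"
  shows "prb (pairs {1..n}) (\<lambda>F. \<not> (tree_activates ({1..n}, F) \<and> cherry_covered ({1..n}, F))) \<le>
    (1 - p + p * y) ^ (n - 1) / y ^ lo + (1 + p) ^ n / 2 ^ hi +
    (real n * ((1 - p + p * y) ^ r1 / y ^ h + z ^ k) + real n * ((1 - p + p * y) ^ b0 / y ^ d) +
    real n * (real n * (2 * (real n * (real m2 ^ (2 * g + 1) * (1 - p * (1 - (1 - p) ^ s)\<^sup>2) ^ (m2 - 1 - (2 * g + 1)))) +
      ((1 - p\<^sup>2 * (1 - (1 - p) ^ g)\<^sup>2) ^ (b0 - 2) + (1 - p * (1 - (1 - p) ^ g)\<^sup>2) ^ d))))"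
    (is "_ \<le> ?T1 + ?T2 + ?T3")
proof -
  let ?V = "{1..n}"
  let ?I = "pairs ?V"
  define V0 where "V0 = {2..n}"
  have V0: "?V = insert 1 V0" "1 \<notin> V0" "finite V0" "card V0 = n - 1" using n by (auto simp: V0_def)
  let ?J = "(\<lambda>x. {1, x}) ` V0"
  have fI: "finite ?I" by (simp add: finite_pairs)
  have JI: "?J \<subseteq> ?I" using V0 by auto
  have IJ: "?I - ?J = pairs V0"
  proof
    show "?I - ?J \<subseteq> pairs V0"
    proof
      fix e assume e: "e \<in> ?I - ?J"
      then have "e \<in> ?I" by simp
      then obtain u v where uv: "e = {u, v}" "u \<noteq> v" "u \<in> ?V" "v \<in> ?V" by (rule pairs_E)
      have v: "x \<in> V0 \<or> x = 1" if "x \<in> ?V" for x using that by (auto simp: V0_def)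
      have "u \<noteq> 1"
      proof
        assume u: "u = 1"
        then have "v \<in> V0" using v[OF uv(4)] uv(2) by simp
        then have "e \<in> ?J" unfolding uv(1) u by (rule imageI)
        then show False using e by simp
      qed
      moreover have "v \<noteq> 1"
      proof
        assume v1: "v = 1"
        then have "u \<in> V0" using v[OF uv(3)] uv(2) by simp
        then have "{1, u} \<in> ?J" by (rule imageI)
        then have "e \<in> ?J" unfolding uv(1) v1 by (simp only: insert_commute)
        then show False using e by simp
      qed
      ultimately show "e \<in> pairs V0" using uv v by auto
    qed
    show "pairs V0 \<subseteq> ?I - ?J"
    proof
      fix e assume e: "e \<in> pairs V0"
      then have "e \<in> ?I" by (auto simp: pairs_def V0_def)
      moreover have "1 \<notin> e" using e V0(2) by (auto simp: pairs_def)
      then have "e \<notin> ?J" by auto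
      ultimately show "e \<in> ?I - ?J" by simp
    qed
  qed
  have inj: "inj_on (\<lambda>x. {1, x}) V0" by (auto simp: inj_on_def doubleton_eq_iff)
  have cJ: "card ?J = n - 1" using card_image[OF inj] V0(4) by (simp only:)
  define N where "N F = {x \<in> V0. {1, x} \<in> F}" for F
  have cN: "card (N F) = card (F \<inter> ?J)" for F
  proof -
    have "F \<inter> ?J = (\<lambda>x. {1, x}) ` N F" by (auto simp: N_def)
    moreover have "inj_on (\<lambda>x. {1, x}) (N F)" by (rule inj_on_subset[OF inj]) (auto simp: N_def)
    ultimately show ?thesis by (simp add: card_image)
  qed
  let ?good = "\<lambda>F. lo \<le> card (N F) \<and> card (N F) \<le> hi"
  let ?A = "\<lambda>F. \<not> (tree_activates (?V, F) \<and> cherry_covered (?V, F))"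
  have "prb ?I ?A \<le> prb ?I (\<lambda>F. (card (F \<inter> ?J) \<le> lo \<or> hi \<le> card (F \<inter> ?J)) \<or> (?good F \<and> ?A F))"
    by (rule prb_mono) (auto simp: cN)
  also have "\<dots> \<le> (prb ?I (\<lambda>F. card (F \<inter> ?J) \<le> lo) + prb ?I (\<lambda>F. hi \<le> card (F \<inter> ?J))) + prb ?I (\<lambda>F. ?good F \<and> ?A F)"
    by (rule order_trans[OF prb_disj]) (intro add_mono prb_disj order_refl)
  also have "prb ?I (\<lambda>F. card (F \<inter> ?J) \<le> lo) \<le> ?T1"
    using prb_card_le[OF fI JI y, of lo] unfolding cJ .
  also have "prb ?I (\<lambda>F. hi \<le> card (F \<inter> ?J)) \<le> ?T2"
  proof -
    have "prb ?I (\<lambda>F. hi \<le> card (F \<inter> ?J)) \<le> (1 - p + p * 2) ^ card ?J / 2 ^ hi"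
      by (rule prb_card_ge[OF fI JI]) simp
    also have "\<dots> = (1 + p) ^ (n - 1) / 2 ^ hi" unfolding cJ by (simp add: add.commute)
    also have "\<dots> \<le> ?T2" using p0 by (intro divide_right_mono power_increasing) auto
    finally show ?thesis .
  qed
  also have "prb ?I (\<lambda>F. ?good F \<and> ?A F) \<le> ?T3"
  proof (rule prb_stage[OF fI JI])
    have nn: "0 \<le> 1 - p * (1 - (1 - p) ^ i)\<^sup>2" "0 \<le> 1 - p\<^sup>2 * (1 - (1 - p) ^ i)\<^sup>2" for i
      using p0 p1 by (auto intro!: mult_le_one power_le_one simp: power_le_one)
    have "0 \<le> 1 - p + p * y" using p0 p1 y by auto
    then show "0 \<le> ?T3" using nn z y p0 p1 by (intro mult_nonneg_nonneg add_nonneg_nonneg zero_le_power divide_nonneg_nonneg) auto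
    show "?good F = ?good (F \<inter> ?J)" for F by (simp add: cN Int_assoc)
    fix F1 assume F1: "F1 \<subseteq> ?J" "?good F1"
    define R where "R = N F1"
    have R: "R \<subseteq> V0" "finite R" "lo \<le> card R" "card R \<le> hi" using F1(2) V0(3) by (auto simp: R_def N_def)
    have "m2 \<le> card R" using R(3) sizes(1) by linarith
    then obtain R2 where R2: "R2 \<subseteq> R" "card R2 = m2" by (auto dest!: subset_of_card)
    define R1 B where "R1 = R - R2" and "B = V0 - R"
    have fR2: "finite R2" by (rule finite_subset[OF R2(1) R(2)])
    have cR1: "r1 \<le> card R1" unfolding R1_def using card_Diff_subset[OF fR2 R2(1)] R2(2) R(3) sizes(1) by linarith
    have cB: "b0 \<le> card B" unfolding B_def using card_Diff_subset[OF R(2,1)] V0(4) R(4) sizes(2) by linarith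
    have part: "V0 = R1 \<union> R2 \<union> B" "R1 \<inter> R2 = {}" "R1 \<inter> B = {}" "R2 \<inter> B = {}"
      using R2 R(1) by (auto simp: R1_def B_def)
    have "prb (?I - ?J) (\<lambda>F'. ?A (F1 \<union> F')) \<le> prb (pairs V0) (\<lambda>F. \<not> structured F R1 R2 B)"
      unfolding IJ
    proof (rule prb_mono, rule notI)
      fix F' assume F': "F' \<subseteq> pairs V0" "?A (F1 \<union> F')" "structured F' R1 R2 B"
      let ?E = "F1 \<union> F'"
      have "structured ?E R1 R2 B" using F'(3) by (rule structured_mono) simp
      then obtain C where C: "\<forall>w\<in>B. cluster ?E R1 w (C w) \<and> C w \<noteq> {}"
        "\<forall>a\<in>R1 \<union> R2 \<union> B. \<forall>b\<in>B. a \<noteq> b \<longrightarrow> linked ?E R2 B C a b"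
        unfolding structured_def by (elim exE conjE)
      have "tree_activates (?V, ?E) \<and> cherry_covered (?V, ?E)"
      proof (rule linked_tree_activates[where r = 1 and ?R1.0 = R1 and ?R2.0 = R2 and B = B and C = C])
        show "?V = insert 1 (R1 \<union> R2 \<union> B)" "1 \<notin> R1 \<union> R2 \<union> B" using V0(1,2) part(1) by simp_all
        show "(R1 \<union> R2) \<inter> B = {}" using part by blast
        show "B \<noteq> {}" using cB sizes(3) by auto
        have "pairs V0 \<subseteq> ?I" using V0(1) by (auto simp: pairs_def)
        then show "?E \<subseteq> ?I" using F1(1) JI F'(1) by blast
        show "{1, x} \<in> ?E \<longleftrightarrow> x \<in> R1 \<union> R2" if "x \<in> ?V" for x
        proof -
          have "{1, x} \<notin> F'"
          proof
            assume "{1, x} \<in> F'"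
            then have "{1, x} \<in> pairs V0" using F'(1) by blast
            then show False using V0(2) by simp
          qed
          moreover have "{1, x} \<in> F1 \<longleftrightarrow> x \<in> R"
          proof
            assume a: "{1, x} \<in> F1"
            then have "{1, x} \<in> ?J" using F1(1) by blast
            then obtain x' where x': "{1, x} = {1, x'}" "x' \<in> V0" by (rule imageE)
            then have "x \<in> V0" unfolding doubleton_eq_iff by (elim disjE conjE) simp_all
            then show "x \<in> R" using a by (simp add: R_def N_def)
          qed (simp add: R_def N_def)
          moreover have "R1 \<union> R2 = R" using R2(1) by (auto simp: R1_def)
          ultimately show ?thesis by simp
        qed
        show "cluster ?E R1 w (C w) \<and> C w \<noteq> {}" if "w \<in> B" for w by (rule bspec[OF C(1) that])
        show "linked ?E R2 B C a b" if "a \<in> R1 \<union> R2 \<union> B" "b \<in> B" "a \<noteq> b" for a b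
          using bspec[OF bspec[OF C(2) that(1)] that(2)] that(3) by simp
      qed simp
      then show False using F'(2) by blast
    qed
    also have "\<dots> \<le> ?T3"
      by (rule prb_not_structured[OF V0(3) part])
        (use cR1 R2(2) cB sizes(4) V0(4) z S y in simp_all)
    finally show "prb (?I - ?J) (\<lambda>F'. ?A (F1 \<union> F')) \<le> ?T3" .
  qed
  finally show ?thesis by simp
qed

end

section \<open>Above the threshold\<close>

text \<open>One term for each way to fail, in this order: the root has too few or too many neighbours; some
  \<open>w\<close> has too few neighbours in \<open>R1\<close>, or no cluster among them; some vertex of \<open>R1\<close> has too few
  neighbours in \<open>B\<close>; some vertex has too few contacts in a shadow; two vertices are not linked.\<close>
definition supercritical_bound :: "real \<Rightarrow> nat \<Rightarrow> real" where
  "supercritical_bound e n =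
    exp (1 - (e / 8)\<^sup>2 / 8 * real n powr (2 / 3)) + 2 * exp (ln 2 * (1 - real n / 4) + 2 * real n powr (2 / 3)) +
    real n * exp (1 - (e / 8)\<^sup>2 / 8 * real n powr (1 / 3)) + real n * exp (e / 2 * (1 - real n powr (1 / 50))) +
    real n * exp (1 - e / 256 * real n powr (2 / 3)) +
    2 * real n ^ 3 * exp (ln (real n) * (2 * real n powr (1 / 5) + 1) - e / 256 * real n powr (4 / 15)) +
    real n ^ 2 * (exp (- (real n powr (1 / 15) / 48)) + exp (- (real n powr (1 / 15) / 128)))"

lemma supercritical_bound_tendsto: "0 < e \<Longrightarrow> supercritical_bound e \<longlonglongrightarrow> 0"
proof -
  assume e: "0 < e"
  have "(\<lambda>n. exp (1 - (e / 8)\<^sup>2 / 8 * real n powr (2 / 3))) \<longlonglongrightarrow> 0" using e by real_asymp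
  moreover have "(\<lambda>n. 2 * exp (ln 2 * (1 - real n / 4) + 2 * real n powr (2 / 3))) \<longlonglongrightarrow> 0" by real_asymp
  moreover have "(\<lambda>n. real n * exp (1 - (e / 8)\<^sup>2 / 8 * real n powr (1 / 3))) \<longlonglongrightarrow> 0" using e by real_asymp
  moreover have "(\<lambda>n. real n * exp (e / 2 * (1 - real n powr (1 / 50)))) \<longlonglongrightarrow> 0" using e by real_asymp
  moreover have "(\<lambda>n. real n * exp (1 - e / 256 * real n powr (2 / 3))) \<longlonglongrightarrow> 0" using e by real_asymp
  moreover have "(\<lambda>n. 2 * real n ^ 3 * exp (ln (real n) * (2 * real n powr (1 / 5) + 1) - e / 256 * real n powr (4 / 15))) \<longlonglongrightarrow> 0"
    using e by real_asymp
  moreover have "(\<lambda>n. real n ^ 2 * (exp (- (real n powr (1 / 15) / 48)) + exp (- (real n powr (1 / 15) / 128)))) \<longlonglongrightarrow> 0"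
    by real_asymp
  ultimately have "supercritical_bound e \<longlonglongrightarrow> 0 + 0 + 0 + 0 + 0 + 0 + 0"
    unfolding supercritical_bound_def by (intro tendsto_add)
  then show ?thesis by simp
qed

lemma prob_supercritical:
  fixes e :: real
  assumes e: "0 < e" "e \<le> 1 / 4"
  shows "\<forall>\<^sub>F n in sequentially. measure_pmf.prob (gnp n ((1 + e) * real n powr (- 1 / 3)))
    {G. \<not> (tree_activates G \<and> cherry_covered G)} \<le> supercritical_bound e n"
proof -
  \<comment> \<open>The relative loss in each of four places: the root degree, the split into \<open>R1\<close> and \<open>R2\<close>, the degree
    into \<open>R1\<close>, and the vertices used up by the exploration. In total \<open>(1 - 4 * c) * (1 + e) ^ 3 > 1 + e\<close>, so
    the exploration stays supercritical.\<close>
  define c where "c = e / 8"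
  have c: "0 < c" "c \<le> 1 / 32" using e by (auto simp: c_def)
  have ev: "\<forall>\<^sub>F n in sequentially. 4 \<le> n"
    "\<forall>\<^sub>F n in sequentially. (1 + e) * real n powr (- 1 / 3) \<le> e"
    "\<forall>\<^sub>F n in sequentially. 3 * (real n powr (1 / 50) * real n powr (3 / 10)) \<le> c * real n powr (1 / 3)"
    "\<forall>\<^sub>F n in sequentially. 1 \<le> real n powr (1 / 50)"
    "\<forall>\<^sub>F n in sequentially. 2 \<le> real n powr (1 / 5)"
    "\<forall>\<^sub>F n in sequentially. 2 \<le> real n powr (3 / 10)"
    "\<forall>\<^sub>F n in sequentially. c / 2 * real n powr (2 / 3) \<le> c * real n powr (2 / 3) - 3 - 2 * real n powr (1 / 5)"
    "\<forall>\<^sub>F n in sequentially. real n / 3 \<le> real n / 2 - 3"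
    "\<forall>\<^sub>F n in sequentially. real n powr (2 / 3) / 8 \<le> real n powr (2 / 3) / 4 - 1"
    "\<forall>\<^sub>F n in sequentially. 2 * real n powr (3 / 10) * real n powr (- 1 / 3) \<le> 1"
    "\<forall>\<^sub>F n in sequentially. 2 * real n powr (1 / 5) * real n powr (- 1 / 3) \<le> 1"
    using e c by real_asymp+
  show ?thesis
    using ev
  proof eventually_elim
    case (elim n)
    define x where "x = real n powr (- 1 / 3)"
    define p where "p = (1 + e) * x"
    have n4: "4 \<le> real n" using elim(1) by simp
    have x0: "0 < x" using n4 by (simp add: x_def)
    have pw: "real n powr a * real n powr b = real n powr c'" if "a + b = c'" for a b c' :: real
      using that by (auto simp: powr_add)
    have nx: "real n * x = real n powr (2 / 3)" using pw[of 1 "- 1 / 3" "2 / 3"] n4 by (simp add: x_def)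
    have nxx: "real n powr (2 / 3) * x = real n powr (1 / 3)" unfolding x_def by (rule pw) simp
    have nxxx: "real n powr (1 / 3) * x = 1" using pw[of "1 / 3" "- 1 / 3" 0] n4 by (simp add: x_def)
    have pe: "p \<le> e" using elim(2) unfolding p_def x_def .
    then have p: "0 \<le> p" "p \<le> e" "p \<le> 1" "x \<le> p" "p \<le> 2 * x"
      using x0 e mult_right_mono[of 1 "1 + e" x] mult_right_mono[of "1 + e" 2 x] by (auto simp: p_def)
    interpret coin p by unfold_locales (use p in auto)
    define N1 N2 where "N1 = real n * p" and "N2 = N1 * p"
    have N1: "N1 = (1 + e) * real n powr (2 / 3)" unfolding N1_def p_def using nx by (simp add: mult_ac)
    have N2: "N2 = (1 + e)\<^sup>2 * real n powr (1 / 3)"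
      unfolding N2_def N1 p_def using nxx by (simp add: power2_eq_square mult_ac)
    have N3: "N2 * p = (1 + e) ^ 3"
      unfolding N2 p_def using nxxx by (simp add: power2_eq_square power3_eq_cube mult_ac)
    have N1x: "real n powr (2 / 3) \<le> N1" "N1 \<le> 2 * real n powr (2 / 3)"
      unfolding N1 using e mult_right_mono[of 1 "1 + e" "real n powr (2 / 3)"] mult_right_mono[of "1 + e" 2 "real n powr (2 / 3)"] by auto
    have N2x: "real n powr (1 / 3) \<le> N2"
    proof -
      have "1 \<le> (1 + e)\<^sup>2" using e by simp
      then show ?thesis unfolding N2 using mult_right_mono[of 1 "(1 + e)\<^sup>2" "real n powr (1 / 3)"] by simp
    qed
    have N2N1: "N2 \<le> N1" "0 \<le> N2" "0 \<le> N1" using p by (auto simp: N2_def N1_def mult_left_le)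
    define t where "t = c / 4"
    have t: "0 < t" "t \<le> 1 / 128" using c by (auto simp: t_def)
    define lo r1 m2 hi b0 h M d k s g where
      "lo = nat \<lfloor>(1 - c) * N1\<rfloor>" and "r1 = nat \<lfloor>(1 - 2 * c) * N1\<rfloor>" and "m2 = nat \<lfloor>c * N1\<rfloor>" and
      "hi = nat \<lfloor>real n / 4\<rfloor>" and "b0 = nat \<lfloor>real n / 2\<rfloor>" and "h = nat \<lfloor>(1 - 3 * c) * N2\<rfloor>" and
      "M = nat \<lfloor>(1 - 4 * c) * N2\<rfloor>" and "d = nat \<lfloor>N1 / 4\<rfloor>" and "k = nat \<lfloor>real n powr (1 / 50)\<rfloor>" and
      "s = nat \<lfloor>real n powr (3 / 10)\<rfloor>" and "g = nat \<lfloor>real n powr (1 / 5)\<rfloor>"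
    \<comment> \<open>The cluster size \<open>s\<close>, as the power 3/10 of \<open>n\<close>, is smaller than the degree \<open>N2\<close> by a power of \<open>n\<close>, which
      leaves room for \<open>k\<close> explorations, and still
      every shadow has far more than \<open>2 * g + 1\<close> contacts. The number \<open>g\<close> of usable contacts is so large that
      \<open>n * p\<^sup>2 * (g * p)\<^sup>2\<close>, the number of linking vertices up to a constant, is a positive power of \<open>n\<close>.\<close>
    have fl: "real (nat \<lfloor>r\<rfloor>) \<le> r \<and> r - 1 < real (nat \<lfloor>r\<rfloor>)" if "0 \<le> r" for r :: real
      using that by (auto simp: of_nat_nat)
    have c1: "0 \<le> 1 - c" "0 \<le> 1 - 2 * c" "0 \<le> 1 - 3 * c" "0 \<le> 1 - 4 * c" using c by auto
    have lo: "real lo \<le> (1 - c) * N1" "(1 - c) * N1 - 1 < real lo" unfolding lo_def using fl[of "(1 - c) * N1"] c1 N2N1 by simp_all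
    have r1: "real r1 \<le> (1 - 2 * c) * N1" "(1 - 2 * c) * N1 - 1 < real r1" unfolding r1_def using fl[of "(1 - 2 * c) * N1"] c1 N2N1 by simp_all
    have m2: "real m2 \<le> c * N1" "c * N1 - 1 < real m2" unfolding m2_def using fl[of "c * N1"] c N2N1 by simp_all
    have hi: "real hi \<le> real n / 4" "real n / 4 - 1 < real hi" unfolding hi_def using fl[of "real n / 4"] by simp_all
    have b0: "real b0 \<le> real n / 2" "real n / 2 - 1 < real b0" unfolding b0_def using fl[of "real n / 2"] by simp_all
    have h: "real h \<le> (1 - 3 * c) * N2" "(1 - 3 * c) * N2 - 1 < real h" unfolding h_def using fl[of "(1 - 3 * c) * N2"] c1 N2N1 by simp_all
    have M: "real M \<le> (1 - 4 * c) * N2" "(1 - 4 * c) * N2 - 1 < real M" unfolding M_def using fl[of "(1 - 4 * c) * N2"] c1 N2N1 by simp_all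
    have d: "real d \<le> N1 / 4" "N1 / 4 - 1 < real d" unfolding d_def using fl[of "N1 / 4"] N2N1 by simp_all
    have k: "real k \<le> real n powr (1 / 50)" "real n powr (1 / 50) - 1 < real k" unfolding k_def using fl[of "real n powr (1 / 50)"] by simp_all
    have s: "real s \<le> real n powr (3 / 10)" "real n powr (3 / 10) - 1 < real s" unfolding s_def using fl[of "real n powr (3 / 10)"] by simp_all
    have g: "real g \<le> real n powr (1 / 5)" "real n powr (1 / 5) - 1 < real g" unfolding g_def using fl[of "real n powr (1 / 5)"] by simp_all
    have k0: "0 < k" using elim(4) unfolding k_def by simp
    have cN1: "c * real n powr (2 / 3) \<le> c * N1" using N1x c by (intro mult_left_mono) auto
    have m2g: "c / 2 * real n powr (2 / 3) \<le> real m2 - 2 - 2 * real g" using elim(7) m2(2) g(1) cN1 by linarith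
    have sz: "r1 + m2 \<le> lo"
    proof -
      have "real (r1 + m2) \<le> (1 - c) * N1" using r1(1) m2(1) by (simp add: algebra_simps)
      then have "real (r1 + m2) < real lo + 1" using lo(2) by linarith
      then show ?thesis by linarith
    qed
    have sz2: "b0 + hi + 1 \<le> n"
    proof -
      have "real (b0 + hi + 1) \<le> real n" using b0(1) hi(1) n4 by simp
      then show ?thesis by linarith
    qed
    have sz3: "0 < b0" unfolding b0_def using n4 by simp
    have sz4: "2 * g + 2 \<le> m2"
    proof -
      have "0 \<le> c / 2 * real n powr (2 / 3)" using c by simp
      then have "real (2 * g + 2) \<le> real m2" using m2g by simp
      then show ?thesis by linarith
    qed
    have S: "M + k * (2 * s + 1) \<le> h + 1"
    proof -
      have "real k * (2 * real s + 1) \<le> real n powr (1 / 50) * (3 * real n powr (3 / 10))"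
        using k(1) s(1) elim(6) by (intro mult_mono) auto
      also have "\<dots> \<le> c * real n powr (1 / 3)" using elim(3) by simp
      also have "\<dots> \<le> c * N2" using N2x c by (intro mult_left_mono) auto
      finally have "real k * (2 * real s + 1) \<le> c * N2" .
      then have "real M + real k * (2 * real s + 1) \<le> (1 - 3 * c) * N2" using M(1) by (simp add: algebra_simps)
      moreover have "real (M + k * (2 * s + 1)) = real M + real k * (2 * real s + 1)" by (simp add: algebra_simps)
      ultimately have "real (M + k * (2 * s + 1)) < real (h + 2)" using h(2) by linarith
      then show ?thesis by linarith
    qed
    define z where "z = 1 - e / 2"
    have z: "0 \<le> z" "z \<le> 1" using e by (auto simp: z_def)
    have zM: "(1 - p + p * z) ^ M \<le> z"
    proof -
      have pM: "1 + e \<le> p * real M"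
      proof -
        have "(1 - 4 * c) * (1 + e) ^ 3 - p \<le> p * real M"
        proof -
          have "((1 - 4 * c) * N2 - 1) * p \<le> real M * p" using M(2) p by (intro mult_right_mono) auto
          moreover have "((1 - 4 * c) * N2 - 1) * p = (1 - 4 * c) * (N2 * p) - p" by (simp add: algebra_simps)
          ultimately show ?thesis unfolding N3 by (simp add: mult.commute)
        qed
        moreover have "1 + 2 * e \<le> (1 - 4 * c) * (1 + e) ^ 3"
        proof -
          have e2: "e * e \<le> e * (1 / 4)" using e by (intro mult_left_mono) auto
          have e3: "0 \<le> e * (e * e)" using e by simp
          have "1 + 3 * e \<le> (1 + e) ^ 3" using e e3 by (simp add: power3_eq_cube algebra_simps)
          then have "(1 - e / 2) * (1 + 3 * e) \<le> (1 - e / 2) * (1 + e) ^ 3" using e by (intro mult_left_mono) auto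
          moreover have "1 + 2 * e \<le> (1 - e / 2) * (1 + 3 * e)" using e2 e by (simp add: algebra_simps)
          ultimately show ?thesis by (simp add: c_def)
        qed
        ultimately show ?thesis using p(2) by linarith
      qed
      have "(1 - p + p * z) ^ M = (1 - p * (e / 2)) ^ M" by (simp add: z_def algebra_simps)
      also have "\<dots> \<le> exp (- ((1 + e) * (e / 2)))"
      proof (rule power_le_exp)
        show "p * (e / 2) \<le> 1" using p e mult_le_one[of p "e / 2"] by simp
        show "(1 + e) * (e / 2) \<le> p * (e / 2) * real M"
          using mult_right_mono[OF pM, of "e / 2"] e by (simp add: mult_ac)
      qed (use p e in auto)
      also have "\<dots> \<le> exp (ln z)"
      proof -
        have "- (e / 2) - 2 * (e / 2)\<^sup>2 \<le> ln (1 - e / 2)" using ln_one_minus_pos_lower_bound[of "e / 2"] e by simp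
        moreover have "(1 + e) * (e / 2) = e / 2 + 2 * (e / 2)\<^sup>2" by (simp add: power2_eq_square algebra_simps)
        ultimately show ?thesis unfolding z_def exp_le_cancel_iff by linarith
      qed
      also have "\<dots> = z" using e by (simp add: z_def)
      finally show ?thesis .
    qed
    define y where "y = 1 - t"
    have y: "0 < y" "y \<le> 1" using t by (auto simp: y_def)
    have pt: "p * t \<le> 1" using p t mult_le_one[of p t] by simp
    have tilt: "(1 - p + p * y) ^ N / y ^ j \<le> exp (1 - c\<^sup>2 / 8 * L)"
      if L: "0 \<le> L" and j: "real j \<le> (1 - c') * L" and N: "(1 - c' + c) * L - p \<le> p * real N" and c': "0 \<le> c'" "c' \<le> 1" for L c' :: real and N j
    proof -
      have "real j * (t + 2 * t\<^sup>2) \<le> (1 - c') * L * (t + 2 * t\<^sup>2)" using j t by (intro mult_right_mono) auto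
      also have "\<dots> = t * ((1 - c') * L) + (1 - c') * (2 * t\<^sup>2 * L)" by (simp add: algebra_simps)
      also have "\<dots> \<le> t * ((1 - c') * L) + 1 * (2 * t\<^sup>2 * L)" using L c' by (intro add_left_mono mult_right_mono) auto
      finally have a: "real j * (t + 2 * t\<^sup>2) \<le> t * ((1 - c') * L) + 2 * t\<^sup>2 * L" by simp
      have b: "t * ((1 - c' + c) * L - p) \<le> t * (p * real N)" using N t by (intro mult_left_mono) auto
      have "real j * (t + 2 * t\<^sup>2) - p * t * real N \<le> 2 * t\<^sup>2 * L - t * c * L + p * t"
        using a b by (simp add: algebra_simps)
      also have "\<dots> \<le> 1 - c\<^sup>2 / 8 * L" using pt by (simp add: t_def power2_eq_square algebra_simps)
      finally have ex: "real j * (t + 2 * t\<^sup>2) - p * t * real N \<le> 1 - c\<^sup>2 / 8 * L" .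
      have "(1 - p + p * y) ^ N / y ^ j \<le> exp (real j * (t + 2 * t\<^sup>2) - p * t * real N)"
        unfolding y_def by (rule tilted_power_bound) (use p t in auto)
      also have "\<dots> \<le> exp (1 - c\<^sup>2 / 8 * L)" using ex by simp
      finally show ?thesis .
    qed
    have T1: "(1 - p + p * y) ^ (n - 1) / y ^ lo \<le> exp (1 - c\<^sup>2 / 8 * real n powr (2 / 3))"
    proof -
      have "(1 - p + p * y) ^ (n - 1) / y ^ lo \<le> exp (1 - c\<^sup>2 / 8 * N1)"
      proof (rule tilt[of _ _ c])
        show "(1 - c + c) * N1 - p \<le> p * real (n - 1)" using elim(1) by (simp add: N1_def of_nat_diff algebra_simps)
      qed (use lo c N2N1 in auto)
      also have "\<dots> \<le> exp (1 - c\<^sup>2 / 8 * real n powr (2 / 3))"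
        using mult_left_mono[OF N1x(1), of "c\<^sup>2 / 8"] by simp
      finally show ?thesis .
    qed
    have T2: "(1 + p) ^ n / 2 ^ hi \<le> 2 * exp (ln 2 * (1 - real n / 4) + 2 * real n powr (2 / 3))"
    proof -
      have "(1 + p) ^ n \<le> exp p ^ n" using p exp_ge_add_one_self[of p] by (intro power_mono) (auto simp: add.commute)
      also have "\<dots> = exp N1" by (simp add: exp_of_nat_mult[symmetric] N1_def)
      also have "\<dots> \<le> exp (2 * real n powr (2 / 3))" using N1x by simp
      finally have a: "(1 + p) ^ n \<le> exp (2 * real n powr (2 / 3))" .
      have "exp (ln 2 * (real n / 4 - 1)) \<le> exp (ln 2 * real hi)" using hi(2) by simp
      also have "\<dots> = 2 ^ hi" by (simp add: exp_of_nat2_mult)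
      finally have "exp (ln 2 * (real n / 4 - 1)) \<le> 2 ^ hi" .
      then have "(1 + p) ^ n / 2 ^ hi \<le> exp (2 * real n powr (2 / 3)) / exp (ln 2 * (real n / 4 - 1))"
        using a by (intro frac_le) auto
      also have "\<dots> = exp (ln 2 * (1 - real n / 4) + 2 * real n powr (2 / 3))"
        by (simp add: exp_diff[symmetric] algebra_simps)
      also have "\<dots> \<le> 2 * exp (ln 2 * (1 - real n / 4) + 2 * real n powr (2 / 3))" by simp
      finally show ?thesis .
    qed
    have T3: "(1 - p + p * y) ^ r1 / y ^ h \<le> exp (1 - c\<^sup>2 / 8 * real n powr (1 / 3))"
    proof -
      have "(1 - p + p * y) ^ r1 / y ^ h \<le> exp (1 - c\<^sup>2 / 8 * N2)"
      proof (rule tilt[of _ _ "3 * c"])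
        have "((1 - 2 * c) * N1 - 1) * p \<le> real r1 * p" using r1(2) p by (intro mult_right_mono) auto
        then show "(1 - 3 * c + c) * N2 - p \<le> p * real r1" by (simp add: N2_def algebra_simps)
      qed (use h c N2N1 in auto)
      also have "\<dots> \<le> exp (1 - c\<^sup>2 / 8 * real n powr (1 / 3))"
        using mult_left_mono[OF N2x, of "c\<^sup>2 / 8"] by simp
      finally show ?thesis .
    qed
    have T4: "z ^ k \<le> exp (e / 2 * (1 - real n powr (1 / 50)))"
    proof -
      have "z ^ k \<le> exp (- (e / 2 * real k))" unfolding z_def using e by (intro power_le_exp) auto
      also have "\<dots> \<le> exp (e / 2 * (1 - real n powr (1 / 50)))"
        using mult_left_mono[of "real n powr (1 / 50) - 1" "real k" "e / 2"] k(2) e by (simp add: algebra_simps)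
      finally show ?thesis .
    qed
    have T5: "(1 - p + p * y) ^ b0 / y ^ d \<le> exp (1 - e / 256 * real n powr (2 / 3))"
    proof -
      have "(1 - p + p * y) ^ b0 / y ^ d \<le> exp (real d * (t + 2 * t\<^sup>2) - p * t * real b0)"
        unfolding y_def by (rule tilted_power_bound) (use p t in auto)
      also have "\<dots> \<le> exp (1 - e / 256 * real n powr (2 / 3))"
      proof -
        have "real d * (t + 2 * t\<^sup>2) \<le> N1 / 4 * (t + 2 * t\<^sup>2)" using d(1) t by (intro mult_right_mono) auto
        moreover have "t\<^sup>2 \<le> t * (1 / 128)" using t unfolding power2_eq_square by (intro mult_left_mono) auto
        then have "N1 / 4 * (t + 2 * t\<^sup>2) \<le> N1 / 4 * (3 / 2 * t)" using N2N1 t by (intro mult_left_mono) auto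
        moreover have "t * (p * (real n / 2 - 1)) \<le> t * (p * real b0)" using b0(2) t p by (intro mult_left_mono) auto
        ultimately have "real d * (t + 2 * t\<^sup>2) - p * t * real b0 \<le> 3 / 8 * (t * N1) - t * N1 / 2 + p * t"
          by (simp add: N1_def algebra_simps)
        also have "\<dots> \<le> 1 - t * N1 / 8" using pt by linarith
        also have "\<dots> \<le> 1 - e / 256 * real n powr (2 / 3)"
          using mult_left_mono[OF N1x(1), of t] t by (simp add: t_def c_def)
        finally show ?thesis by simp
      qed
      finally show ?thesis .
    qed
    have sp: "real s * p \<le> 1" and gp: "real g * p \<le> 1"
    proof -
      have "real s * p \<le> real n powr (3 / 10) * (2 * x)" using s(1) p by (intro mult_mono) auto
      then show "real s * p \<le> 1" using elim(10) by (simp add: x_def)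
      have "real g * p \<le> real n powr (1 / 5) * (2 * x)" using g(1) p by (intro mult_mono) auto
      then show "real g * p \<le> 1" using elim(11) by (simp add: x_def)
    qed
    have qs: "real n powr (- 1 / 30) / 4 \<le> 1 - (1 - p) ^ s"
    proof -
      have "real n powr (3 / 10) / 2 * x \<le> real s * p" using s(2) elim(6) p x0 by (intro mult_mono) auto
      moreover have "real n powr (3 / 10) * x = real n powr (- 1 / 30)" unfolding x_def by (rule pw) simp
      ultimately have "real n powr (- 1 / 30) / 4 \<le> real s * p / 2" by simp
      then show ?thesis using hit_lower_bound[OF p(1,3) sp] by linarith
    qed
    have qg: "real n powr (- 2 / 15) / 4 \<le> 1 - (1 - p) ^ g"
    proof -
      have "real n powr (1 / 5) / 2 * x \<le> real g * p" using g(2) elim(5) p x0 by (intro mult_mono) auto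
      moreover have "real n powr (1 / 5) * x = real n powr (- 2 / 15)" unfolding x_def by (rule pw) simp
      ultimately have "real n powr (- 2 / 15) / 4 \<le> real g * p / 2" by simp
      then show ?thesis using hit_lower_bound[OF p(1,3) gp] by linarith
    qed
    have sqs: "real n powr (- 1 / 15) / 16 \<le> (1 - (1 - p) ^ s)\<^sup>2"
    proof -
      have "(real n powr (- 1 / 30) / 4)\<^sup>2 \<le> (1 - (1 - p) ^ s)\<^sup>2" using qs by (intro power_mono) auto
      moreover have "(real n powr (- 1 / 30))\<^sup>2 = real n powr (- 1 / 15)" unfolding power2_eq_square by (rule pw) simp
      ultimately show ?thesis by (simp add: power_divide)
    qed
    have sqg: "real n powr (- 4 / 15) / 16 \<le> (1 - (1 - p) ^ g)\<^sup>2"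
    proof -
      have "(real n powr (- 2 / 15) / 4)\<^sup>2 \<le> (1 - (1 - p) ^ g)\<^sup>2" using qg by (intro power_mono) auto
      moreover have "(real n powr (- 2 / 15))\<^sup>2 = real n powr (- 4 / 15)" unfolding power2_eq_square by (rule pw) simp
      ultimately show ?thesis by (simp add: power_divide)
    qed
    have le1: "p * (1 - (1 - p) ^ i)\<^sup>2 \<le> 1" "p\<^sup>2 * (1 - (1 - p) ^ i)\<^sup>2 \<le> 1" for i
      using p by (auto intro!: mult_le_one power_le_one simp: power_le_one)
    have T6: "real m2 ^ (2 * g + 1) * (1 - p * (1 - (1 - p) ^ s)\<^sup>2) ^ (m2 - 1 - (2 * g + 1)) \<le>
        exp (ln (real n) * (2 * real n powr (1 / 5) + 1) - e / 256 * real n powr (4 / 15))"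
    proof -
      have m2n: "real m2 \<le> real n"
      proof -
        have "c * N1 \<le> 1 * N1" using c N2N1 by (intro mult_right_mono) auto
        moreover have "N1 \<le> real n" using p by (simp add: N1_def mult_left_le)
        ultimately show ?thesis using m2(1) by linarith
      qed
      have "real m2 ^ (2 * g + 1) \<le> real n ^ (2 * g + 1)" using m2n by (intro power_mono) auto
      also have "\<dots> = exp (real (2 * g + 1) * ln (real n))" using n4 by (subst exp_of_nat_mult) simp
      also have "\<dots> \<le> exp ((2 * real n powr (1 / 5) + 1) * ln (real n))"
        using g(1) n4 by (simp add: mult_right_mono)
      finally have a: "real m2 ^ (2 * g + 1) \<le> exp (ln (real n) * (2 * real n powr (1 / 5) + 1))" by (simp add: mult.commute)
      have b: "(1 - p * (1 - (1 - p) ^ s)\<^sup>2) ^ (m2 - 1 - (2 * g + 1)) \<le> exp (- (e / 256 * real n powr (4 / 15)))"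
      proof (rule power_le_exp)
        have "x * (real n powr (- 1 / 15) / 16) * (c / 2 * real n powr (2 / 3)) \<le>
            p * (1 - (1 - p) ^ s)\<^sup>2 * real (m2 - 1 - (2 * g + 1))"
          using p x0 sqs m2g sz4 c by (intro mult_mono) (auto simp: of_nat_diff)
        moreover have "x * (real n powr (- 1 / 15) / 16) * (c / 2 * real n powr (2 / 3)) =
            c / 32 * ((real n powr (2 / 3) * x) * real n powr (- 1 / 15))" by simp
        moreover have "(real n powr (2 / 3) * x) * real n powr (- 1 / 15) = real n powr (4 / 15)"
          unfolding nxx by (rule pw) simp
        ultimately have "c / 32 * real n powr (4 / 15) \<le> p * (1 - (1 - p) ^ s)\<^sup>2 * real (m2 - 1 - (2 * g + 1))"
          by metis
        then show "e / 256 * real n powr (4 / 15) \<le> p * (1 - (1 - p) ^ s)\<^sup>2 * real (m2 - 1 - (2 * g + 1))"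
          unfolding c_def by simp
      qed (use p le1 in auto)
      have "real m2 ^ (2 * g + 1) * (1 - p * (1 - (1 - p) ^ s)\<^sup>2) ^ (m2 - 1 - (2 * g + 1)) \<le>
          exp (ln (real n) * (2 * real n powr (1 / 5) + 1)) * exp (- (e / 256 * real n powr (4 / 15)))"
        using a b le1 by (intro mult_mono) auto
      then show ?thesis by (simp add: exp_add[symmetric])
    qed
    have T7: "(1 - p\<^sup>2 * (1 - (1 - p) ^ g)\<^sup>2) ^ (b0 - 2) \<le> exp (- (real n powr (1 / 15) / 48))"
    proof (rule power_le_exp)
      have "real n / 3 \<le> real (b0 - 2)" using elim(8) b0(2) by linarith
      then have "x\<^sup>2 * (real n powr (- 4 / 15) / 16) * (real n / 3) \<le> p\<^sup>2 * (1 - (1 - p) ^ g)\<^sup>2 * real (b0 - 2)"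
        using p x0 sqg by (intro mult_mono power_mono) auto
      moreover have "x\<^sup>2 * (real n powr (- 4 / 15) / 16) * (real n / 3) = ((real n * x) * x) * real n powr (- 4 / 15) / 48"
        by (simp add: power2_eq_square)
      moreover have "((real n * x) * x) * real n powr (- 4 / 15) = real n powr (1 / 15)"
        unfolding nx nxx by (rule pw) simp
      ultimately show "real n powr (1 / 15) / 48 \<le> p\<^sup>2 * (1 - (1 - p) ^ g)\<^sup>2 * real (b0 - 2)" by linarith
    qed (use p le1 in auto)
    have T8: "(1 - p * (1 - (1 - p) ^ g)\<^sup>2) ^ d \<le> exp (- (real n powr (1 / 15) / 128))"
    proof (rule power_le_exp)
      have "real n powr (2 / 3) / 8 \<le> real d" using elim(9) d(2) N1x(1) by linarith
      then have "x * (real n powr (- 4 / 15) / 16) * (real n powr (2 / 3) / 8) \<le> p * (1 - (1 - p) ^ g)\<^sup>2 * real d"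
        using p x0 sqg by (intro mult_mono) auto
      moreover have "x * (real n powr (- 4 / 15) / 16) * (real n powr (2 / 3) / 8) = (real n powr (2 / 3) * x) * real n powr (- 4 / 15) / 128"
        by simp
      moreover have "(real n powr (2 / 3) * x) * real n powr (- 4 / 15) = real n powr (1 / 15)"
        unfolding nxx by (rule pw) simp
      ultimately show "real n powr (1 / 15) / 128 \<le> p * (1 - (1 - p) ^ g)\<^sup>2 * real d" by linarith
    qed (use p le1 in auto)
    have n0: "0 < n" using elim(1) by simp
    have "measure_pmf.prob (gnp n p) {G. \<not> (tree_activates G \<and> cherry_covered G)} \<le>
      (1 - p + p * y) ^ (n - 1) / y ^ lo + (1 + p) ^ n / 2 ^ hi +
      (real n * ((1 - p + p * y) ^ r1 / y ^ h + z ^ k) + real n * ((1 - p + p * y) ^ b0 / y ^ d) +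
      real n * (real n * (2 * (real n * (real m2 ^ (2 * g + 1) * (1 - p * (1 - (1 - p) ^ s)\<^sup>2) ^ (m2 - 1 - (2 * g + 1)))) +
      ((1 - p\<^sup>2 * (1 - (1 - p) ^ g)\<^sup>2) ^ (b0 - 2) + (1 - p * (1 - (1 - p) ^ g)\<^sup>2) ^ d))))"
      unfolding prob_gnp by (rule prb_no_activating_tree[OF n0 sz sz2 sz3 sz4 z zM S k0 y])
    also have "\<dots> \<le> exp (1 - c\<^sup>2 / 8 * real n powr (2 / 3)) + 2 * exp (ln 2 * (1 - real n / 4) + 2 * real n powr (2 / 3)) +
      (real n * (exp (1 - c\<^sup>2 / 8 * real n powr (1 / 3)) + exp (e / 2 * (1 - real n powr (1 / 50)))) +
       real n * exp (1 - e / 256 * real n powr (2 / 3)) +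
       real n * (real n * (2 * (real n * exp (ln (real n) * (2 * real n powr (1 / 5) + 1) - e / 256 * real n powr (4 / 15))) +
        (exp (- (real n powr (1 / 15) / 48)) + exp (- (real n powr (1 / 15) / 128))))))"
      by (intro add_mono mult_left_mono T1 T2 T3 T4 T5 T6 T7 T8) auto
    also have "\<dots> = supercritical_bound e n"
      unfolding supercritical_bound_def c_def by (simp add: algebra_simps power2_eq_square power3_eq_cube)
    finally show ?case by (simp add: p_def x_def)
  qed
qed

section \<open>The threshold\<close>

lemma (in coin) prb_insert:
  assumes "finite I" "x \<notin> I"
  shows "prb (insert x I) A = (1 - p) * prb I A + p * prb I (\<lambda>F. A (insert x F))"
proof -
  have "Pow {x} = {{}, {x}}" by auto
  moreover have "insert x I - {x} = I" using assms by auto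
  ultimately show ?thesis
    using prb_split[of "insert x I" "{x}" A] assms by (simp add: wt_def)
qed

text \<open>Induction on \<open>I\<close>: the larger probability shifts weight from the case without \<open>x\<close> to the case with \<open>x\<close>, in
  which \<open>A\<close> is more likely.\<close>
lemma prb_increasing:
  assumes p: "0 \<le> p" "p \<le> p'" "p' \<le> 1" and fin: "finite I"
    and up: "\<And>F F'. A F \<Longrightarrow> F \<subseteq> F' \<Longrightarrow> F' \<subseteq> I \<Longrightarrow> A F'"
  shows "coin.prb p I A \<le> coin.prb p' I A"
  using fin up
proof (induction I arbitrary: A)
  case empty
  interpret P: coin p by unfold_locales (use p in auto)
  interpret P': coin p' by unfold_locales (use p in auto)
  show ?case by (simp add: P.prb_def P'.prb_def P.wt_def P'.wt_def)
next
  case (insert x I)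
  interpret P: coin p by unfold_locales (use p in auto)
  interpret P': coin p' by unfold_locales (use p in auto)
  let ?A' = "\<lambda>F. A (insert x F)"
  have 1: "P.prb I A \<le> P'.prb I A" using insert.prems by (intro insert.IH) blast
  have 2: "P.prb I ?A' \<le> P'.prb I ?A'"
  proof (rule insert.IH)
    fix F F' assume "A (insert x F)" "F \<subseteq> F'" "F' \<subseteq> I"
    then show "A (insert x F')" using insert.prems[of "insert x F" "insert x F'"] by blast
  qed
  have 3: "P'.prb I A \<le> P'.prb I ?A'"
  proof (rule P'.prb_mono)
    fix F assume "F \<subseteq> I" "A F"
    then show "A (insert x F)" using insert.prems[of F "insert x F"] by blast
  qed
  have "P.prb (insert x I) A = (1 - p) * P.prb I A + p * P.prb I ?A'" by (rule P.prb_insert[OF insert.hyps])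
  also have "\<dots> \<le> (1 - p) * P'.prb I A + p * P'.prb I ?A'"
    using 1 2 p by (intro add_mono mult_left_mono) auto
  also have "\<dots> = P'.prb I A + p * (P'.prb I ?A' - P'.prb I A)" by (simp add: algebra_simps)
  also have "\<dots> \<le> P'.prb I A + p' * (P'.prb I ?A' - P'.prb I A)"
    using 3 p by (intro add_left_mono mult_right_mono) auto
  also have "\<dots> = P'.prb (insert x I) A"
    unfolding P'.prb_insert[OF insert.hyps] by (simp add: algebra_simps)
  finally show ?case .
qed

lemma prob_gnp_increasing:
  assumes p: "0 \<le> p" "p \<le> p'" "p' \<le> 1"
    and up: "\<And>E E'. A ({1..n}, E) \<Longrightarrow> E \<subseteq> E' \<Longrightarrow> E' \<subseteq> pairs {1..n} \<Longrightarrow> A ({1..n}, E')"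
  shows "measure_pmf.prob (gnp n p) {G. A G} \<le> measure_pmf.prob (gnp n p') {G. A G}"
proof -
  have c: "coin p" "coin p'" using p by (auto simp: coin_def)
  show ?thesis
    unfolding coin.prob_gnp[OF c(1)] coin.prob_gnp[OF c(2)]
    by (rule prb_increasing[OF p finite_pairs]) (use up in auto)
qed

lemma set_pmf_gnp:
  assumes "G \<in> set_pmf (gnp n p)"
  shows "verts G = {1..n}" "simple_graph G"
  using assms by (auto simp: gnp_def simple_graph_def)

lemma prob_not:
  "measure_pmf.prob M {x. \<not> P x} = 1 - measure_pmf.prob M {x. P x}"
proof -
  have "{x. \<not> P x} = space (measure_pmf M) - {x. P x}" by auto
  then show ?thesis using measure_pmf.prob_compl[of "{x. P x}" M] by simp
qed

lemma whp_bound: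
  assumes "b \<longlonglongrightarrow> 0" "\<forall>\<^sub>F n in sequentially. measure_pmf.prob (gnp n (p n)) {G. \<not> P n G} \<le> b n"
  shows "whp p P"
  unfolding whp_def
proof (rule tendsto_sandwich)
  show "(\<lambda>n. 1 - b n) \<longlonglongrightarrow> 1" using tendsto_diff[OF tendsto_const assms(1)] by simp
  show "\<forall>\<^sub>F n in sequentially. 1 - b n \<le> measure_pmf.prob (gnp n (p n)) {G. P n G}"
    using assms(2) by eventually_elim (simp add: prob_not)
qed auto

lemma whp_not_bound:
  assumes "whp p P"
  shows "(\<lambda>n. measure_pmf.prob (gnp n (p n)) {G. \<not> P n G}) \<longlonglongrightarrow> 0"
  using tendsto_diff[OF tendsto_const[of 1] assms[unfolded whp_def]] by (simp add: prob_not)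

lemma whp_conj:
  assumes "whp p P" "whp p Q"
  shows "whp p (\<lambda>n G. P n G \<and> Q n G)"
proof (rule whp_bound)
  show "(\<lambda>n. measure_pmf.prob (gnp n (p n)) {G. \<not> P n G} + measure_pmf.prob (gnp n (p n)) {G. \<not> Q n G}) \<longlonglongrightarrow> 0"
    using tendsto_add[OF assms[THEN whp_not_bound]] by simp
  have "measure_pmf.prob M {G. \<not> (P n G \<and> Q n G)} \<le> measure_pmf.prob M {G. \<not> P n G} + measure_pmf.prob M {G. \<not> Q n G}" for M n
  proof -
    have "{G. \<not> (P n G \<and> Q n G)} = {G. \<not> P n G} \<union> {G. \<not> Q n G}" by auto
    then show ?thesis by (simp add: measure_Un_le)
  qed
  then show "\<forall>\<^sub>F n in sequentially. measure_pmf.prob (gnp n (p n)) {G. \<not> (P n G \<and> Q n G)}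
      \<le> measure_pmf.prob (gnp n (p n)) {G. \<not> P n G} + measure_pmf.prob (gnp n (p n)) {G. \<not> Q n G}"
    by simp
qed

text \<open>This is applied to sequences that coincide at all \<open>n\<close> suspected of being bad; it shows that only
  finitely many \<open>n\<close> are bad.\<close>
lemma whp_incompatible:
  assumes P: "whp p P" and Q: "whp p' Q"
    and PQ: "\<forall>\<^sub>F n in sequentially. \<forall>G. verts G = {1..n} \<longrightarrow> simple_graph G \<longrightarrow> \<not> (P n G \<and> Q n G)"
  shows "\<forall>\<^sub>F n in sequentially. p n \<noteq> p' n"
proof -
  have "\<forall>\<^sub>F n in sequentially. 1 / 2 < measure_pmf.prob (gnp n (p n)) {G. P n G}"
    "\<forall>\<^sub>F n in sequentially. 1 / 2 < measure_pmf.prob (gnp n (p' n)) {G. Q n G}"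
    by (rule order_tendstoD(1)[OF P[unfolded whp_def]], simp, rule order_tendstoD(1)[OF Q[unfolded whp_def]], simp)
  then show ?thesis using PQ
  proof eventually_elim
    case (elim n)
    show ?case
    proof
      assume eq: "p n = p' n"
      let ?M = "gnp n (p n)"
      have "measure_pmf.prob ?M {G. P n G} \<le> measure_pmf.prob ?M {G. \<not> Q n G}"
      proof (rule measure_pmf.finite_measure_mono_AE)
        show "AE G in ?M. G \<in> {G. P n G} \<longrightarrow> G \<in> {G. \<not> Q n G}"
          unfolding AE_measure_pmf_iff using elim(3) set_pmf_gnp by blast
      qed simp
      then show False using elim(1,2) eq by (simp add: prob_not)
    qed
  qed
qed

lemma whp_tree_activates:
  fixes \<epsilon> :: real
  assumes e: "0 < \<epsilon>" and p: "\<And>n. p n \<in> {0..1}"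
    and big: "\<forall>\<^sub>F n in sequentially. (1 + \<epsilon>) * real n powr (- 1 / 3) \<le> p n"
  shows "whp p (\<lambda>n G. tree_activates G \<and> cherry_covered G)"
proof -
  define e' where "e' = min \<epsilon> (1 / 4)"
  have e': "0 < e'" "e' \<le> 1 / 4" "e' \<le> \<epsilon>" using e by (auto simp: e'_def)
  show ?thesis
  proof (rule whp_bound[OF supercritical_bound_tendsto[OF e'(1)]])
    show "\<forall>\<^sub>F n in sequentially. measure_pmf.prob (gnp n (p n)) {G. \<not> (tree_activates G \<and> cherry_covered G)} \<le> supercritical_bound e' n"
      using prob_supercritical[OF e'(1,2)] big
    proof eventually_elim
      case (elim n)
      let ?p = "(1 + e') * real n powr (- 1 / 3)"
      have "?p \<le> (1 + \<epsilon>) * real n powr (- 1 / 3)" using e' by (intro mult_right_mono) auto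
      then have le: "?p \<le> p n" using elim(2) by linarith
      have "measure_pmf.prob (gnp n ?p) {G. tree_activates G \<and> cherry_covered G}
          \<le> measure_pmf.prob (gnp n (p n)) {G. tree_activates G \<and> cherry_covered G}"
      proof (rule prob_gnp_increasing[OF _ le])
        fix E E' :: "nat set set"
        assume "tree_activates ({1..n}, E) \<and> cherry_covered ({1..n}, E)" "E \<subseteq> E'" "E' \<subseteq> pairs {1..n}"
        then show "tree_activates ({1..n}, E') \<and> cherry_covered ({1..n}, E')"
          using tree_activates_mono[of "{1..n}" E E'] by (simp add: simple_graph_def)
      qed (use e' p[of n] in auto)
      then show ?case using elim(1) by (simp only: prob_not)
    qed
  qed
qed

lemma whp_no_tree_activates:
  fixes \<epsilon> :: real
  assumes e: "0 < \<epsilon>" and p: "\<And>n. p n \<in> {0..1}"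
    and small: "\<forall>\<^sub>F n in sequentially. p n < real n powr (- 1 / 3 - \<epsilon>)"
  shows "whp p (\<lambda>n G. \<not> tree_activates G)"
proof -
  define e' where "e' = min \<epsilon> (1 / 3)"
  have e': "0 < e'" "e' \<le> 1 / 3" "e' \<le> \<epsilon>" using e by (auto simp: e'_def)
  obtain b where b: "b \<longlonglongrightarrow> 0" "\<forall>\<^sub>F n in sequentially. \<forall>p. 0 \<le> p \<longrightarrow> p \<le> 1 \<longrightarrow> p < real n powr (- 1 / 3 - e') \<longrightarrow>
    measure_pmf.prob (gnp n p) {G. tree_activates G} \<le> b n"
    using prob_tree_activates_tendsto[OF e'(1,2)] by (elim exE conjE)
  show ?thesis
  proof (rule whp_bound[OF b(1)])
    show "\<forall>\<^sub>F n in sequentially. measure_pmf.prob (gnp n (p n)) {G. \<not> \<not> tree_activates G} \<le> b n"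
      using b(2) small eventually_gt_at_top[of 0]
    proof eventually_elim
      case (elim n)
      have "real n powr (- 1 / 3 - \<epsilon>) \<le> real n powr (- 1 / 3 - e')" using elim(3) e' by (intro powr_mono) auto
      then have "p n < real n powr (- 1 / 3 - e')" using elim(2) by linarith
      then show ?case using elim(1) p[of n] by simp
    qed
  qed
qed

lemma prob_not_cherry_covered:
  assumes p: "0 \<le> p" "p \<le> 1"
  shows "measure_pmf.prob (gnp n p) {G. \<not> cherry_covered G} \<le> (real n)\<^sup>2 * exp (- p\<^sup>2 * (real n - 2))"
proof -
  interpret coin p by unfold_locales (use p in auto)
  let ?V = "{1..n}"
  let ?bad = "\<lambda>xy F. fst xy \<noteq> snd xy \<and> \<not> (\<exists>z. {fst xy, z} \<in> F \<and> {snd xy, z} \<in> F)"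
  have 1: "prb (pairs ?V) (?bad xy) \<le> exp (- p\<^sup>2 * (real n - 2))" if xy_in: "xy \<in> ?V \<times> ?V" for xy
  proof -
    obtain x y where xy: "xy = (x, y)" "x \<in> ?V" "y \<in> ?V" using xy_in by (cases xy) simp
    show ?thesis
    proof (cases "x = y")
      case True
      then show ?thesis using xy by (simp add: prb_def)
    next
      case False
      let ?W = "?V - {x, y}"
      have card: "card ?W = n - 2" using False xy by (subst card_Diff_subset) auto
      have "prb (pairs ?V) (?bad xy) \<le> prb (pairs ?V) (\<lambda>F. \<not> (\<exists>a\<in>?W. {x, a} \<in> F \<and> {y, a} \<in> F))"
        by (rule prb_mono) (auto simp: xy)
      also have "\<dots> = 1 - prb (pairs ?V) (\<lambda>F. \<exists>a\<in>?W. {x, a} \<in> F \<and> {y, a} \<in> F)"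
        by (rule prb_not[OF finite_pairs]) simp
      also have "\<dots> \<le> (1 - p\<^sup>2) ^ (n - 2)"
        using prb_common_neighbour[of ?V ?W x y] xy False card by auto
      also have "\<dots> \<le> exp (- (p\<^sup>2 * (real n - 2)))"
        by (rule power_le_exp) (use p in \<open>auto simp: power_le_one intro!: mult_left_mono\<close>)
      finally show ?thesis by simp
    qed
  qed
  have "measure_pmf.prob (gnp n p) {G. \<not> cherry_covered G} = prb (pairs ?V) (\<lambda>F. \<not> cherry_covered (?V, F))"
    by (rule prob_gnp)
  also have "\<dots> \<le> prb (pairs ?V) (\<lambda>F. \<exists>xy\<in>?V \<times> ?V. ?bad xy F)"
    by (rule prb_mono) (auto simp: cherry_covered_def)
  also have "\<dots> \<le> real (card (?V \<times> ?V)) * exp (- p\<^sup>2 * (real n - 2))"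
    by (rule prb_union_le[OF _ 1]) auto
  finally show ?thesis by (simp add: card_cartesian_product power2_eq_square)
qed

lemma wsat_iff_tree_activates:
  assumes "verts G = {1..n}" "simple_graph G" "cherry_covered G" "0 < n"
  shows "wsat_K3 G + 1 = n \<longleftrightarrow> tree_activates G"
  using wsat_tree_iff[OF assms(2) cherry_covered_connected] assms by simp

text \<open>At a bad \<open>n\<close>, the probability \<open>x n\<close> is much smaller than \<open>q n\<close>, so that \<open>wsat(G, K\<^sub>3) = n - 1\<close> should fail,
  and yet it is large enough for an activating tree. At the other \<open>n\<close>, the sequences \<open>p\<close> and \<open>p'\<close> take
  values for which their hypotheses hold trivially.\<close>
lemma threshold_upper:
  fixes \<eta> :: real
  assumes q: "is_p_K3 q" and eta: "0 < \<eta>" "\<eta> \<le> 1 / 6"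
  shows "\<forall>\<^sub>F n in sequentially. q n \<le> real n powr (- 1 / 3 + \<eta>)"
proof -
  define x where "x n = min 1 (real n powr (- 1 / 3 + \<eta> / 2))" for n :: nat
  define bad where "bad n \<longleftrightarrow> real n powr (- 1 / 3 + \<eta>) < q n" for n
  define p where "p n = (if bad n then x n else min 1 (max 0 (q n / real n)))" for n
  define p' where "p' n = (if bad n then x n else 1)" for n
  have x01: "0 \<le> x n" "x n \<le> 1" for n by (auto simp: x_def)
  have p01: "p n \<in> {0..1}" "p' n \<in> {0..1}" for n using x01[of n] by (auto simp: p_def p'_def)
  have qpos: "\<forall>\<^sub>F n in sequentially. 0 < q n" using q by (simp add: is_p_K3_def is_threshold_def)
  have "(\<lambda>n. p n / q n) \<longlonglongrightarrow> 0"
  proof (rule tendsto_sandwich)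
    show "\<forall>\<^sub>F n in sequentially. p n / q n \<le> real n powr (- \<eta> / 2) + 1 / real n"
      using qpos eventually_gt_at_top[of 0]
    proof eventually_elim
      case (elim n)
      show ?case
      proof (cases "bad n")
        case True
        have "p n \<le> real n powr (- \<eta> / 2) * real n powr (- 1 / 3 + \<eta>)"
          using True by (simp add: p_def x_def powr_add[symmetric])
        also have "\<dots> \<le> real n powr (- \<eta> / 2) * q n" using True by (intro mult_left_mono) (auto simp: bad_def)
        finally have "p n / q n \<le> real n powr (- \<eta> / 2)" using elim(1) by (simp only: pos_divide_le_eq)
        moreover have "0 \<le> 1 / real n" by simp
        ultimately show ?thesis by linarith
      next
        case False
        have "p n \<le> 1 / real n * q n" using False elim by (simp add: p_def)
        then have "p n / q n \<le> 1 / real n" using elim(1) by (simp only: pos_divide_le_eq)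
        then show ?thesis by (simp add: add_increasing)
      qed
    qed
    show "\<forall>\<^sub>F n in sequentially. 0 \<le> p n / q n"
      using qpos by eventually_elim (use p01 in \<open>simp\<close>)
    show "(\<lambda>n. real n powr (- \<eta> / 2) + 1 / real n) \<longlonglongrightarrow> 0" using eta by real_asymp
  qed auto
  then have 1: "whp p (\<lambda>n G. \<not> wsat_K3 G + 1 = n)"
    using q p01 unfolding is_p_K3_def is_threshold_def by blast
  have "\<forall>\<^sub>F n in sequentially. (1 + 1) * real n powr (- 1 / 3) \<le> p' n"
  proof -
    have "\<forall>\<^sub>F n in sequentially. 2 * real n powr (- 1 / 3) \<le> real n powr (- 1 / 3 + \<eta> / 2)"
      "\<forall>\<^sub>F n in sequentially. 2 * real n powr (- 1 / 3) \<le> 1"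
      using eta by real_asymp+
    then show ?thesis by eventually_elim (auto simp: p'_def x_def)
  qed
  from whp_tree_activates[OF _ p01(2) this] have 2: "whp p' (\<lambda>n G. tree_activates G \<and> cherry_covered G)" by simp
  have "\<forall>\<^sub>F n in sequentially. p n \<noteq> p' n"
  proof (rule whp_incompatible[OF 1 2])
    show "\<forall>\<^sub>F n in sequentially. \<forall>G. verts G = {1..n} \<longrightarrow> simple_graph G \<longrightarrow>
        \<not> (\<not> wsat_K3 G + 1 = n \<and> tree_activates G \<and> cherry_covered G)"
      using eventually_gt_at_top[of 0]
    proof eventually_elim
      case (elim n)
      show ?case using wsat_iff_tree_activates[OF _ _ _ elim] by metis
    qed
  qed
  then show ?thesis by eventually_elim (auto simp: p_def p'_def bad_def not_less split: if_splits)
qed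

text \<open>At a bad \<open>n\<close>, the probability \<open>y n\<close> is much larger than \<open>q n\<close>, so that \<open>wsat(G, K\<^sub>3) = n - 1\<close> should hold.
  But \<open>y n\<close> is too small for an activating tree, though large enough for common neighbours. At the other
  \<open>n\<close>, the upper bound leaves room for a probability much larger than \<open>q n\<close>.\<close>
lemma threshold_lower:
  fixes \<eta> :: real
  assumes q: "is_p_K3 q" and eta: "0 < \<eta>" "\<eta> \<le> 1 / 6"
  shows "\<forall>\<^sub>F n in sequentially. real n powr (- 1 / 3 - \<eta>) \<le> q n"
proof -
  define y where "y n = real n powr (- 1 / 3 - \<eta> / 2)" for n :: nat
  define bad where "bad n \<longleftrightarrow> q n < real n powr (- 1 / 3 - \<eta>)" for n
  define p where "p n = (if bad n then y n else min 1 (max 0 (q n * real n)))" for n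
  have y01: "0 \<le> y n \<and> y n \<le> 1" for n
  proof (cases "n = 0")
    case False
    then have "y n \<le> real n powr 0" unfolding y_def using eta by (intro powr_mono) auto
    then show ?thesis using False by (simp add: y_def)
  qed (simp add: y_def)
  have p01: "p n \<in> {0..1}" for n using y01[of n] by (auto simp: p_def)
  have qpos: "\<forall>\<^sub>F n in sequentially. 0 < q n" using q by (simp add: is_p_K3_def is_threshold_def)
  have qup: "\<forall>\<^sub>F n in sequentially. q n \<le> real n powr (- 1 / 3 + 1 / 6)" by (rule threshold_upper[OF q]) auto
  have "filterlim (\<lambda>n. p n / q n) at_top sequentially"
  proof (rule filterlim_at_top_mono)
    show "filterlim (\<lambda>n. min (real n powr (\<eta> / 2)) (min (real n powr (1 / 6)) (real n))) at_top sequentially"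
      using eta by real_asymp
    show "\<forall>\<^sub>F n in sequentially. min (real n powr (\<eta> / 2)) (min (real n powr (1 / 6)) (real n)) \<le> p n / q n"
      using qpos qup eventually_gt_at_top[of 0]
    proof eventually_elim
      case (elim n)
      show ?case
      proof (cases "bad n")
        case True
        have "real n powr (\<eta> / 2) * q n \<le> real n powr (\<eta> / 2) * real n powr (- 1 / 3 - \<eta>)"
          using True by (intro mult_left_mono) (auto simp: bad_def)
        also have "\<dots> = p n" using True by (simp add: p_def y_def powr_add[symmetric] algebra_simps)
        finally have "real n powr (\<eta> / 2) \<le> p n / q n" using elim(1) by (simp add: pos_le_divide_eq)
        then show ?thesis by simp
      next
        case False
        have "real n powr (1 / 6) * q n \<le> real n powr (1 / 6) * real n powr (- 1 / 3 + 1 / 6)"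
          using elim(2) by (intro mult_left_mono) auto
        also have "\<dots> = 1" using elim(3) by (simp add: powr_add[symmetric])
        finally have a: "real n powr (1 / 6) * q n \<le> 1" .
        have "min (real n powr (1 / 6)) (real n) * q n \<le> p n"
        proof -
          have "min (real n powr (1 / 6)) (real n) * q n \<le> real n powr (1 / 6) * q n"
            "min (real n powr (1 / 6)) (real n) * q n \<le> real n * q n"
            using elim(1) by (auto intro!: mult_right_mono)
          then have "min (real n powr (1 / 6)) (real n) * q n \<le> min 1 (q n * real n)"
            using a unfolding mult.commute[of "q n"] by (intro min.boundedI) linarith+
          moreover have "p n = min 1 (q n * real n)" using False elim(1) by (simp add: p_def)
          ultimately show ?thesis by simp
        qed
        then have "min (real n powr (1 / 6)) (real n) \<le> p n / q n" using elim(1) by (simp only: pos_le_divide_eq)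
        then show ?thesis by simp
      qed
    qed
  qed
  then have 1: "whp p (\<lambda>n G. wsat_K3 G + 1 = n)"
    using q p01 unfolding is_p_K3_def is_threshold_def by blast
  have no: "whp y (\<lambda>n G. \<not> tree_activates G)"
  proof (rule whp_no_tree_activates[of "\<eta> / 4"])
    show "\<forall>\<^sub>F n in sequentially. y n < real n powr (- 1 / 3 - \<eta> / 4)" unfolding y_def using eta by real_asymp
  qed (use eta y01 in auto)
  have ch: "whp y (\<lambda>n. cherry_covered)"
  proof (rule whp_bound)
    show "\<forall>\<^sub>F n in sequentially. measure_pmf.prob (gnp n (y n)) {G. \<not> cherry_covered G}
        \<le> (real n)\<^sup>2 * exp (- (y n)\<^sup>2 * (real n - 2))"
      by (intro always_eventually allI prob_not_cherry_covered) (use y01 in auto)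
    show "(\<lambda>n. (real n)\<^sup>2 * exp (- (y n)\<^sup>2 * (real n - 2))) \<longlonglongrightarrow> 0"
    proof (rule tendsto_sandwich[where f = "\<lambda>_. 0"])
      show "\<forall>\<^sub>F n in sequentially. (real n)\<^sup>2 * exp (- (y n)\<^sup>2 * (real n - 2)) \<le> (real n)\<^sup>2 * exp (- (real n powr (- 5 / 6) * (real n - 2)))"
        using eventually_ge_at_top[of 2]
      proof eventually_elim
        case (elim n)
        have "real n powr (- 5 / 6) \<le> real n powr (2 * (- 1 / 3 - \<eta> / 2))" using elim eta by (intro powr_mono) auto
        also have "\<dots> = (y n)\<^sup>2" by (simp add: y_def power2_eq_square powr_add[symmetric])
        finally show ?case using elim by (auto intro!: mult_left_mono mult_right_mono)
      qed
      show "(\<lambda>n. (real n)\<^sup>2 * exp (- (real n powr (- 5 / 6) * (real n - 2)))) \<longlonglongrightarrow> 0" by real_asymp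
    qed auto
  qed
  have "\<forall>\<^sub>F n in sequentially. p n \<noteq> y n"
  proof (rule whp_incompatible[OF 1 whp_conj[OF no ch]])
    show "\<forall>\<^sub>F n in sequentially. \<forall>G. verts G = {1..n} \<longrightarrow> simple_graph G \<longrightarrow>
        \<not> (wsat_K3 G + 1 = n \<and> \<not> tree_activates G \<and> cherry_covered G)"
      using eventually_gt_at_top[of 0]
    proof eventually_elim
      case (elim n)
      show ?case using wsat_iff_tree_activates[OF _ _ _ elim] by metis
    qed
  qed
  then show ?thesis by eventually_elim (auto simp: p_def bad_def not_less split: if_splits)
qed

lemma threshold_exponent:
  assumes q: "is_p_K3 q"
  shows "\<exists>\<delta>::nat \<Rightarrow> real. \<delta> \<longlonglongrightarrow> 0 \<and> (\<forall>\<^sub>F n in sequentially. q n = real n powr (- 1 / 3 - \<delta> n))"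
proof -
  define \<delta> where "\<delta> n = - 1 / 3 - ln (q n) / ln (real n)" for n :: nat
  have qpos: "\<forall>\<^sub>F n in sequentially. 0 < q n" using q by (simp add: is_p_K3_def is_threshold_def)
  have "\<forall>\<^sub>F n in sequentially. q n = real n powr (- 1 / 3 - \<delta> n)"
    using qpos eventually_ge_at_top[of 2]
  proof eventually_elim
    case (elim n)
    then have "0 < ln (real n)" by simp
    then show ?case using elim by (simp add: \<delta>_def powr_def)
  qed
  moreover have "\<delta> \<longlonglongrightarrow> 0"
  proof (rule tendstoI)
    fix r :: real assume r: "0 < r"
    define \<eta> where "\<eta> = min (r / 2) (1 / 6)"
    have eta: "0 < \<eta>" "\<eta> \<le> 1 / 6" "\<eta> < r" using r by (auto simp: \<eta>_def)
    show "\<forall>\<^sub>F n in sequentially. dist (\<delta> n) 0 < r"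
      using qpos eventually_ge_at_top[of 2] threshold_upper[OF q eta(1,2)] threshold_lower[OF q eta(1,2)]
    proof eventually_elim
      case (elim n)
      have l: "0 < ln (real n)" using elim(2) by simp
      have "ln (q n) \<le> ln (real n powr (- 1 / 3 + \<eta>))" using elim by (intro ln_mono) auto
      then have "ln (q n) \<le> (- 1 / 3 + \<eta>) * ln (real n)" using elim(2) by (simp add: ln_powr)
      then have 1: "ln (q n) / ln (real n) \<le> - 1 / 3 + \<eta>" using l by (simp only: pos_divide_le_eq)
      have "ln (real n powr (- 1 / 3 - \<eta>)) \<le> ln (q n)" using elim by (intro ln_mono) auto
      then have "(- 1 / 3 - \<eta>) * ln (real n) \<le> ln (q n)" using elim(2) by (simp add: ln_powr)
      then have 2: "- 1 / 3 - \<eta> \<le> ln (q n) / ln (real n)" using l by (simp only: pos_le_divide_eq)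
      have "\<bar>\<delta> n\<bar> \<le> \<eta>" using 1 2 unfolding \<delta>_def abs_le_iff by linarith
      then show ?case using eta(3) by (simp add: dist_real_def)
    qed
  qed
  ultimately show ?thesis by blast
qed

theorem theorem1p2:
  "(\<forall>(\<epsilon>::real) (p::nat \<Rightarrow> real). \<epsilon> > 0 \<longrightarrow> (\<forall>n. p n \<in> {0..1}) \<longrightarrow>
      ((\<forall>\<^sub>F n in sequentially. p n \<ge> (1 + \<epsilon>) * real n powr (- 1 / 3)) \<longrightarrow>
         whp p (\<lambda>n G. \<exists>T. is_tree T \<and> subgraph T G \<and> activates T G)) \<and>
      ((\<forall>\<^sub>F n in sequentially. p n < real n powr (- 1 / 3 - \<epsilon>)) \<longrightarrow>
         whp p (\<lambda>n G. \<not> (\<exists>T. is_tree T \<and> subgraph T G \<and> activates T G)))) \<and>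
   (\<forall>q::nat \<Rightarrow> real. is_p_K3 q \<longrightarrow>
      (\<exists>\<delta>::nat \<Rightarrow> real. \<delta> \<longlonglongrightarrow> 0 \<and>
         (\<forall>\<^sub>F n in sequentially. q n = real n powr (- 1 / 3 - \<delta> n))))"
  unfolding tree_activates_def[symmetric]
proof (intro conjI allI impI)
  fix \<epsilon> :: real and p :: "nat \<Rightarrow> real"
  assume e: "\<epsilon> > 0" and p: "\<forall>n. p n \<in> {0..1}"
  {
    assume "\<forall>\<^sub>F n in sequentially. p n \<ge> (1 + \<epsilon>) * real n powr (- 1 / 3)"
    then have "whp p (\<lambda>n G. tree_activates G \<and> cherry_covered G)" using whp_tree_activates e p by blast
    then have "(\<lambda>n. measure_pmf.prob (gnp n (p n)) {G. \<not> (tree_activates G \<and> cherry_covered G)}) \<longlonglongrightarrow> 0"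
      by (rule whp_not_bound)
    then show "whp p (\<lambda>n G. tree_activates G)"
      by (rule whp_bound) (auto intro!: always_eventually measure_pmf.finite_measure_mono)
  }
  assume "\<forall>\<^sub>F n in sequentially. p n < real n powr (- 1 / 3 - \<epsilon>)"
  then show "whp p (\<lambda>n G. \<not> tree_activates G)" using whp_no_tree_activates e p by blast
next
  fix q :: "nat \<Rightarrow> real" assume "is_p_K3 q"
  then show "\<exists>\<delta>::nat \<Rightarrow> real. \<delta> \<longlonglongrightarrow> 0 \<and> (\<forall>\<^sub>F n in sequentially. q n = real n powr (- 1 / 3 - \<delta> n))"
    by (rule threshold_exponent)
qed

end
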